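(* Let $d\ge3$ and $\lambda\in[-2\sqrt{d-1},2\sqrt{d-1}]$, and let $\Psi_\lambda$ be the Gaussian wave with eigenvalue $\lambda$. Then $$\mathbb{D}_{\rm sp}(B_k(C),\Psi_\lambda)-\frac d2\,\mathbb{D}_{\rm sp}(B_k(e),\Psi_\lambda)\ \longrightarrow\ 0\qquad (k\to\infty).$$
   Context: $T_d$ is the infinite $d$-regular tree, vertex set $V_d$, root $o$; $B_k(S)$ is the set of vertices within distance $k$ of $S$, $C=B_1(o)$, $e$ a fixed edge. For finite $F\subseteq V_d$, $W_\lambda(F)=\{f\in\mathbb{R}^F:\lambda f(u)=\sum_{w\sim u}f(w)$ for all $u\in F$ with $B_1(u)\subseteq F\}$. $\Psi_\lambda$ is the unique mean-zero jointly Gaussian family $\{X_u\}_{u\in V_d}$ of variance-one variables, with law invariant under $\mathrm{Aut}(T_d)$, satisfying $\sum_{u\sim o}X_u=\lambda X_o$ a.s. (equivalently, $\mathrm{Cov}(X_u,X_w)=f(\mathrm{dist}(u,w),\lambda/(2\sqrt{d-1}))$ where $f(0,x)=1$ and for $k\ge1$, $f(k,x)=(d(d-1)^{k-1})^{-1/2}\big(\sqrt{(d-1)/d}\,U_k(x)-(d(d-1))^{-1/2}U_{k-2}(x)\big)$ with $U_k$ the Chebyshev polynomials of the second kind, $U_{-1}=0$). $\mathbb{D}_{\rm sp}(F,\mu)$ is the differential entropy of the marginal of $\mu$ on $\mathbb{R}^F$ computed inside $W_\lambda(F)$ (Lebesgue measure on this subspace with the Euclidean structure inherited from $\mathbb{R}^F$).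 *)

theory Defs
  imports "HOL-Probability.Probability"
begin

text \<open>Vertices of T_d are encoded as lists of naturals: the root is [], the
 children of the root are [a] with a < d, and the children of a non-root
 vertex xs are xs @ [a] with a < d - 1.  Every vertex thus has degree d.\<close>

definition tvert :: "nat \<Rightarrow> nat list \<Rightarrow> bool" where
  "tvert d xs \<longleftrightarrow> (xs = [] \<or> (hd xs < d \<and> (\<forall>a\<in>set (tl xs). a < d - 1)))"

definition tadj :: "nat \<Rightarrow> nat list \<Rightarrow> nat list \<Rightarrow> bool" where
  "tadj d u w \<longleftrightarrow> tvert d u \<and> tvert d w \<and> ((\<exists>a. w = u @ [a]) \<or> (\<exists>a. u = w @ [a]))"

fun lcp :: "nat list \<Rightarrow> nat list \<Rightarrow> nat" where
  "lcp (a # xs) (b # ys) = (if a = b then Suc (lcp xs ys) else 0)"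
| "lcp _ _ = 0"

definition tdist :: "nat list \<Rightarrow> nat list \<Rightarrow> nat" where
  "tdist u w = length u + length w - 2 * lcp u w"

definition troot :: "nat list" where "troot = []"

definition tball :: "nat \<Rightarrow> nat \<Rightarrow> nat list set \<Rightarrow> nat list set" where
  "tball d k S = {v. tvert d v \<and> (\<exists>s\<in>S. tdist s v \<le> k)}"

definition tC :: "nat \<Rightarrow> nat list set" where "tC d = tball d 1 {troot}"
definition tedge :: "nat list set" where "tedge = {troot, [0]}"

text \<open>chebU n x = U_{n-1}(x) (Chebyshev polynomials of the second kind,
 shifted by one so that chebU 0 = U_{-1} = 0).\<close>
fun chebU :: "nat \<Rightarrow> real \<Rightarrow> real" where
  "chebU 0 x = 0"
| "chebU (Suc 0) x = 1"
| "chebU (Suc (Suc n)) x = 2 * x * chebU (Suc n) x - chebU n x"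

definition wavecov :: "nat \<Rightarrow> nat \<Rightarrow> real \<Rightarrow> real" where
  "wavecov d k x = (if k = 0 then 1 else
     (1 / sqrt (real d * (real d - 1) ^ (k - 1))) *
       (sqrt ((real d - 1) / real d) * chebU (k + 1) x
        - (1 / sqrt (real d * (real d - 1))) * chebU (k - 1) x))"

text \<open>A mean-zero jointly Gaussian family indexed by the vertices of T_d with
 covariance Cov(X_u, X_w) = f(dist(u,w), lambda/(2 sqrt(d-1))): every finite
 linear combination is centred normal with the prescribed variance
 (a point mass at 0 when that variance is 0).\<close>
definition gaussian_wave :: "nat \<Rightarrow> real \<Rightarrow> 'a measure \<Rightarrow> (nat list \<Rightarrow> 'a \<Rightarrow> real) \<Rightarrow> bool" where
  "gaussian_wave d lam M X \<longleftrightarrow> prob_space M \<and>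
     (\<forall>u. tvert d u \<longrightarrow> X u \<in> borel_measurable M) \<and>
     (\<forall>F c. finite F \<longrightarrow> (\<forall>u\<in>F. tvert d u) \<longrightarrow>
        (let v = (\<Sum>u\<in>F. \<Sum>w\<in>F. c u * c w * wavecov d (tdist u w) (lam / (2 * sqrt (real d - 1))));
             Y = (\<lambda>\<omega>. \<Sum>u\<in>F. c u * X u \<omega>)
         in if v = 0 then (AE \<omega> in M. Y \<omega> = 0)
            else distributed M lborel Y (\<lambda>x. ennreal (normal_density 0 (sqrt v) x))))"

definition Wlam :: "nat \<Rightarrow> real \<Rightarrow> nat list set \<Rightarrow> (nat list \<Rightarrow> real) set" where
  "Wlam d lam F = {f \<in> F \<rightarrow>\<^sub>E UNIV. \<forall>u\<in>F. (\<forall>w. tadj d u w \<longrightarrow> w \<in> F) \<longrightarrow>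
       lam * f u = (\<Sum>w\<in>{w. tadj d u w}. f w)}"

definition is_onb :: "nat list set \<Rightarrow> (nat list \<Rightarrow> real) set \<Rightarrow> nat \<Rightarrow> (nat \<Rightarrow> nat list \<Rightarrow> real) \<Rightarrow> bool" where
  "is_onb F W m b \<longleftrightarrow> (\<forall>i<m. b i \<in> W) \<and>
     (\<forall>i<m. \<forall>j<m. (\<Sum>u\<in>F. b i u * b j u) = (if i = j then 1 else 0)) \<and>
     (\<forall>f\<in>W. \<exists>c. f = (\<lambda>u\<in>F. \<Sum>i<m. c i * b i u))"

text \<open>Lebesgue measure on the subspace W of R^F: image of Lebesgue measure
 on R^m under an isometric parametrisation by an orthonormal basis.\<close>
definition subspace_lebesgue :: "nat list set \<Rightarrow> (nat list \<Rightarrow> real) set \<Rightarrow> (nat list \<Rightarrow> real) measure" where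
  "subspace_lebesgue F W = (let mb = (SOME mb. is_onb F W (fst mb) (snd mb)) in
     distr (\<Pi>\<^sub>M i\<in>{..<fst mb}. lborel) (\<Pi>\<^sub>M u\<in>F. lborel)
       (\<lambda>y. \<lambda>u\<in>F. \<Sum>i<fst mb. y i * snd mb i u))"

definition Dsp :: "nat \<Rightarrow> real \<Rightarrow> nat list set \<Rightarrow> 'a measure \<Rightarrow> (nat list \<Rightarrow> 'a \<Rightarrow> real) \<Rightarrow> real" where
  "Dsp d lam F M X = prob_space.entropy M (exp 1) (subspace_lebesgue F (Wlam d lam F))
      (\<lambda>\<omega>. \<lambda>u\<in>F. X u \<omega>)"

end

theory Submission
  imports Defs "HOL-Real_Asymp.Real_Asymp"
begin

text \<open>On a ball around the root or around an edge, the wave covariance matrix is diagonalised by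
  explicit eigenvectors: radial vectors around the centre, and for every branching vertex \<open>u\<close> the
  vectors supported below \<open>u\<close> that have sum zero over the children of \<open>u\<close> and follow a fixed
  profile \<open>brp\<close> down each branch. The covariance is the sum over these vectors, each weighted by
  its variance (a telescoping product formula for the spherical functions), so the entropy is half
  the sum of \<open>ln (2 \<pi> e v)\<close> over the eigenvalues \<open>v\<close>. The number of eigenvalues of \<open>B\<^sub>k(C)\<close>
  is \<open>d/2\<close> times that of \<open>B\<^sub>k(e)\<close>, all eigenvalues from branchings except those at the root cancel,
  and what remains is a bounded number of eigenvalues that are all asymptotic to
  \<open>innov_var * (U\<^sub>0\<^sup>2 + \<dots> + U\<^sub>k\<^sup>2)\<close>, hence have ratios tending to \<open>1\<close>.

  That the marginal law is the product of its one-dimensional marginals in the eigenbasis follows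
  from a multivariate uniqueness theorem for characteristic functions; the same theorem shows that
  the standard Gaussian, and with it Lebesgue measure on a subspace, does not depend on the
  orthonormal basis.\<close>

subsection \<open>Joint characteristic functions\<close>

text \<open>The covariance matrix on a ball is singular on \<open>R^F\<close>, so a density exists
  only inside \<open>Wlam\<close>. Besides orthogonality it must therefore be known that the
  eigenvectors span \<open>Wlam\<close> and that all eigenvalues are positive.

  The covariance is expanded along the common path of two vertices. When two paths separate one
  level lower, the distance of their ends drops by two, and the spherical function changes by
  \<open>innov_var\<close> times a value of the branch profile; that value is a difference of
  products belonging to the old and the new level of separation. Each level thus supplies an entry
  of the projection to zero-sum vectors on siblings.

  The sum of the squares \<open>U_j^2\<close> grows linearly for \<open>lam\<close> inside the
  spectrum but cubically at its two ends. The limit only needs that this sum diverges and that its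
  newest term is negligible against it. What then makes all remaining ratios tend to the same number
  is an algebraic identity: the radial vectors, whose profiles mix two consecutive Chebyshev
  polynomials, have the same leading constant \<open>innov_var\<close> as the branchings.\<close>

lemma integrable_bounded_mult_iexp:
  fixes Y w :: "'a \<Rightarrow> real"
  assumes "prob_space M"
    and [measurable]: "Y \<in> borel_measurable M" "w \<in> borel_measurable M"
    and wb: "\<And>x. \<bar>w x\<bar> \<le> b"
  shows "integrable M (\<lambda>x. of_real (w x) * iexp (Y x))"
proof -
  interpret prob_space M by fact
  show ?thesis
    by (rule integrable_const_bound[where B=b]) (auto simp: norm_mult wb)
qed

text \<open>Adding a large constant to the weight turns it into a positive measure, to which the
  one-dimensional Levy uniqueness theorem applies.\<close>
lemma weighted_law_of_char:
  fixes Y w :: "'a \<Rightarrow> real" and C :: real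
  assumes "prob_space M" and mu: "real_distribution \<mu>"
    and [measurable]: "Y \<in> borel_measurable M" "w \<in> borel_measurable M"
    and wb: "\<And>x. \<bar>w x\<bar> \<le> b"
    and Y: "\<And>s. (CLINT x|M. iexp (s * Y x)) = char \<mu> s"
    and W: "\<And>s. (CLINT x|M. of_real (w x) * iexp (s * Y x)) = of_real C * char \<mu> s"
    and [measurable]: "A \<in> sets borel"
  shows "(LINT x|M. w x * indicator A (Y x)) = C * measure \<mu> A"
proof -
  interpret prob_space M by fact
  interpret mu: real_distribution \<mu> by fact
  have char_distr: "char (distr M borel Y) = char \<mu>"
  proof
    fix s
    show "char (distr M borel Y) s = char \<mu> s"
      unfolding Y[symmetric] unfolding char_def by (rule integral_distr) auto
  qed
  have eqY: "distr M borel Y = \<mu>"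
    by (rule Levy_uniqueness[OF _ mu char_distr]) simp
  define w' where "w' x = w x + (b + 1)" for x
  define c where "c = C + (b + 1)"
  have [measurable]: "w' \<in> borel_measurable M" unfolding w'_def by measurable
  have w'1: "1 \<le> w' x" for x using wb[of x] unfolding w'_def by linarith
  have wi: "integrable M w" by (rule integrable_const_bound[where B=b]) (auto simp: wb)
  have w'i: "integrable M w'" unfolding w'_def using wi by auto
  have FT: "(CLINT x|M. of_real (w' x) * iexp (s * Y x)) = of_real c * char \<mu> s" for s
  proof -
    have i1: "integrable M (\<lambda>x. of_real (w x) * iexp (s * Y x))"
      by (rule integrable_bounded_mult_iexp[OF _ _ _ wb]) (auto intro: prob_space_axioms)
    have i2: "integrable M (\<lambda>x. iexp (s * Y x))"
      using integrable_bounded_mult_iexp[of M "\<lambda>x. s * Y x" "\<lambda>_. 1" 1] prob_space_axioms by simp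
    have "(CLINT x|M. of_real (w' x) * iexp (s * Y x)) =
       (CLINT x|M. of_real (w x) * iexp (s * Y x) + of_real (b + 1) * iexp (s * Y x))"
      by (simp add: w'_def algebra_simps)
    also have "\<dots> = of_real C * char \<mu> s + of_real (b + 1) * char \<mu> s"
      by (subst Bochner_Integration.integral_add[OF i1]) (use i2 W[of s] Y[of s] in auto)
    finally show ?thesis by (simp add: c_def algebra_simps)
  qed
  \<comment> \<open>Frequency zero identifies \<open>c\<close> with the total mass of the shifted
    weight, so \<open>w' / c\<close> is a probability density.\<close>
  have cw: "c = (LINT x|M. w' x)"
  proof -
    have "complex_of_real c = (CLINT x|M. of_real (w' x))"
      using FT[of 0] by (simp add: mu.char_zero)
    also have "\<dots> = of_real (LINT x|M. w' x)" by simp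
    finally show ?thesis using of_real_eq_iff by blast
  qed
  have "1 \<le> c"
  proof -
    have "(LINT x|M. 1) \<le> (LINT x|M. w' x)"
      using w'1 w'i by (intro integral_mono) auto
    then show ?thesis by (simp add: cw prob_space)
  qed
  define D where "D = density M (\<lambda>x. ennreal (w' x / c))"
  have w'c: "0 \<le> w' x / c" for x using w'1[of x] \<open>1 \<le> c\<close> by simp
  have "prob_space D"
  proof
    have "emeasure D (space D) = (\<integral>\<^sup>+x. ennreal (w' x / c) \<partial>M)"
      unfolding D_def by (subst emeasure_density) (auto intro!: nn_integral_cong)
    also have "\<dots> = ennreal (LINT x|M. w' x / c)"
      by (rule nn_integral_eq_integral) (use w'i w'c in auto)
    also have "\<dots> = 1" using \<open>1 \<le> c\<close> by (simp add: cw[symmetric])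
    finally show "emeasure D (space D) = 1" .
  qed
  then interpret D: prob_space D .
  have [measurable]: "Y \<in> borel_measurable D" unfolding D_def by measurable
  have "char (distr D borel Y) = char \<mu>"
  proof
    fix s
    have "char (distr D borel Y) s = (CLINT x|D. iexp (s * Y x))"
      unfolding char_def by (subst integral_distr) auto
    also have "\<dots> = (CLINT x|M. (w' x / c) *\<^sub>R iexp (s * Y x))"
      unfolding D_def by (subst integral_density) (use w'c in auto)
    also have "\<dots> = (CLINT x|M. (of_real (w' x) * iexp (s * Y x)) * of_real (1/c))"
      by (intro Bochner_Integration.integral_cong) (auto simp: scaleR_conv_of_real)
    also have "\<dots> = char \<mu> s"
      using \<open>1 \<le> c\<close> by (subst integral_mult_left_zero, subst FT) simp
    finally show "char (distr D borel Y) s = char \<mu> s" .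
  qed
  then have eqD: "distr D borel Y = \<mu>"
    by (intro Levy_uniqueness[OF _ mu]) simp_all
  have ind: "measure \<mu> A = (LINT x|N. indicator A (Y x))"
    if "distr N borel Y = \<mu>" and [measurable]: "Y \<in> borel_measurable N" for N
  proof -
    have "measure \<mu> A = (LINT y|\<mu>. indicator A y)" by simp
    also have "\<dots> = (LINT x|N. indicator A (Y x))"
      unfolding that(1)[symmetric] by (rule integral_distr) auto
    finally show ?thesis .
  qed
  have "measure \<mu> A = (LINT x|D. indicator A (Y x))"
    by (rule ind[OF eqD]) measurable
  also have "\<dots> = (LINT x|M. (w' x / c) *\<^sub>R indicator A (Y x))"
    unfolding D_def by (subst integral_density) (use w'c in auto)
  also have "\<dots> = (LINT x|M. (w' x * indicator A (Y x)) * (1/c))"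
    by (intro Bochner_Integration.integral_cong) auto
  also have "\<dots> = (LINT x|M. w' x * indicator A (Y x)) * (1 / c)"
    by (subst integral_mult_left_zero) auto
  finally have 1: "c * measure \<mu> A = (LINT x|M. w' x * indicator A (Y x))"
    using \<open>1 \<le> c\<close> by (simp add: field_simps)
  have iA: "integrable M (\<lambda>x. indicator A (Y x) :: real)"
    by (rule integrable_const_bound[where B=1]) (auto simp: indicator_def)
  have wA: "integrable M (\<lambda>x. w x * indicator A (Y x))"
    by (rule integrable_const_bound[where B=b])
      (use wb order_trans[OF abs_ge_zero wb] in \<open>auto simp: indicator_def\<close>)
  have 2: "measure \<mu> A = (LINT x|M. indicator A (Y x))"
    by (rule ind[OF eqY]) measurable
  have "(LINT x|M. w' x * indicator A (Y x)) =
     (LINT x|M. w x * indicator A (Y x) + (b + 1) * indicator A (Y x))"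
    by (simp add: w'_def algebra_simps)
  also have "\<dots> = (LINT x|M. w x * indicator A (Y x)) + (b + 1) * measure \<mu> A"
    by (subst Bochner_Integration.integral_add[OF wA]) (use iA 2 in auto)
  finally show ?thesis using 1 by (simp add: c_def algebra_simps)
qed

text \<open>Reduces to real weights. Conjugating the hypothesis at \<open>- s\<close> gives the
  transform of \<open>cnj w\<close>, since the characteristic function at \<open>- s\<close> is the
  conjugate of its value at \<open>s\<close>; linear combinations then give the transforms of
  \<open>Re w\<close> and \<open>Im w\<close>.\<close>

lemma weighted_law_of_char_complex:
  fixes Y :: "'a \<Rightarrow> real" and w :: "'a \<Rightarrow> complex" and C :: complex
  assumes M: "prob_space M" and mu: "real_distribution \<mu>"
    and [measurable]: "Y \<in> borel_measurable M" "w \<in> borel_measurable M"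
    and wb: "\<And>x. norm (w x) \<le> b"
    and Y: "\<And>s. (CLINT x|M. iexp (s * Y x)) = char \<mu> s"
    and W: "\<And>s. (CLINT x|M. w x * iexp (s * Y x)) = C * char \<mu> s"
    and A: "A \<in> sets borel"
  shows "(CLINT x|M. w x * indicator A (Y x)) = C * measure \<mu> A"
proof -
  interpret prob_space M by fact
  interpret mu: real_distribution \<mu> by fact
  note [measurable] = A
  have charneg: "cnj (char \<mu> (- s)) = char \<mu> s" for s
    unfolding char_def by (subst Bochner_Integration.integral_cnj[symmetric]) (simp add: exp_cnj)
  have int: "integrable M (\<lambda>x. w x * iexp (s * Y x))" for s
    by (rule integrable_const_bound[where B=b]) (auto simp: norm_mult wb)
  have [measurable]: "(\<lambda>x. cnj (w x)) \<in> borel_measurable M"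
    by (rule borel_measurable_continuous_on[where f=cnj]) (auto intro: continuous_intros)
  have int': "integrable M (\<lambda>x. cnj (w x) * iexp (s * Y x))" for s
    by (rule integrable_const_bound[where B=b]) (auto simp: norm_mult wb)
  have Wc: "(CLINT x|M. cnj (w x) * iexp (s * Y x)) = cnj C * char \<mu> s" for s
  proof -
    have "(CLINT x|M. cnj (w x) * iexp (s * Y x)) = cnj (CLINT x|M. w x * iexp ((- s) * Y x))"
      by (subst Bochner_Integration.integral_cnj[symmetric]) (simp add: exp_cnj)
    also have "\<dots> = cnj C * char \<mu> s" by (simp only: W complex_cnj_mult charneg)
    finally show ?thesis .
  qed
  have re: "of_real (Re (w x)) = (w x + cnj (w x)) * (1/2)" for x
    by (simp add: complex_add_cnj)
  define k where "k = 1 / (2 * \<i>)"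
  have im: "of_real (Im z) = (z - cnj z) * k" for z
    by (simp add: complex_diff_cnj k_def)
  have R: "(LINT x|M. Re (w x) * indicator A (Y x)) = Re C * measure \<mu> A"
  proof (rule weighted_law_of_char[OF M mu, where b=b])
    fix s
    have "(CLINT x|M. of_real (Re (w x)) * iexp (s * Y x))
      = (CLINT x|M. (w x * iexp (s * Y x) + cnj (w x) * iexp (s * Y x)) * (1/2))"
      by (intro Bochner_Integration.integral_cong) (simp_all add: re algebra_simps)
    also have "\<dots> = (C * char \<mu> s + cnj C * char \<mu> s) * (1/2)"
      by (subst integral_mult_left_zero, subst Bochner_Integration.integral_add[OF int int'])
        (simp only: W Wc)
    also have "\<dots> = of_real (Re C) * char \<mu> s"
      using complex_add_cnj[of C] by (simp add: ring_distribs(2)[symmetric])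
    finally show "(CLINT x|M. of_real (Re (w x)) * iexp (s * Y x)) = of_real (Re C) * char \<mu> s" .
  qed (use Y wb abs_Re_le_cmod order_trans in \<open>auto intro: order_trans[OF abs_Re_le_cmod]\<close>)
  have I: "(LINT x|M. Im (w x) * indicator A (Y x)) = Im C * measure \<mu> A"
  proof (rule weighted_law_of_char[OF M mu, where b=b])
    fix s
    have "(CLINT x|M. of_real (Im (w x)) * iexp (s * Y x))
      = (CLINT x|M. (w x * iexp (s * Y x) - cnj (w x) * iexp (s * Y x)) * k)"
      by (intro Bochner_Integration.integral_cong) (simp_all add: im algebra_simps)
    also have "\<dots> = (C * char \<mu> s - cnj C * char \<mu> s) * k"
      by (subst integral_mult_left_zero, subst Bochner_Integration.integral_diff[OF int int'])
        (simp only: W Wc)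
    also have "\<dots> = of_real (Im C) * char \<mu> s"
      by (simp add: im algebra_simps)
    finally show "(CLINT x|M. of_real (Im (w x)) * iexp (s * Y x)) = of_real (Im C) * char \<mu> s" .
  qed (use Y wb in \<open>auto intro: order_trans[OF abs_Im_le_cmod]\<close>)
  have iw: "integrable M (\<lambda>x. w x * indicator A (Y x))"
    by (rule integrable_const_bound[where B=b])
      (use wb order_trans[OF norm_ge_zero wb] in \<open>auto simp: indicator_def\<close>)
  have "Re (w x * indicator A (Y x)) = Re (w x) * indicator A (Y x)"
       "Im (w x * indicator A (Y x)) = Im (w x) * indicator A (Y x)" for x
    by (auto simp: indicator_def)
  then show ?thesis
    using R I integral_Re[OF iw] integral_Im[OF iw] by (simp add: complex_eq_iff)
qed

text \<open>Induction on \<open>J\<close> exchanges one exponential for one indicator at a time. The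
  other factors, indicators and exponentials alike, are carried as a bounded weight, which is why
  the weight has to be complex.\<close>

lemma measure_inter_of_joint_char:
  fixes Y :: "'i \<Rightarrow> 'a \<Rightarrow> real"
  assumes M: "prob_space M" and I: "finite I"
    and mu: "\<And>i. i \<in> I \<Longrightarrow> real_distribution (\<mu> i)"
    and [measurable]: "\<And>i. i \<in> I \<Longrightarrow> Y i \<in> borel_measurable M"
    and ch: "\<And>t. (CLINT x|M. iexp (\<Sum>i\<in>I. t i * Y i x)) = (\<Prod>i\<in>I. char (\<mu> i) (t i))"
    and A: "\<And>i. i \<in> I \<Longrightarrow> A i \<in> sets borel"
    and J: "J \<subseteq> I"
  shows "(CLINT x|M. (\<Prod>i\<in>J. indicator (A i) (Y i x)) * iexp (\<Sum>i\<in>I - J. t i * Y i x))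
         = (\<Prod>i\<in>J. of_real (measure (\<mu> i) (A i))) * (\<Prod>i\<in>I - J. char (\<mu> i) (t i))"
  using finite_subset[OF J I] J
proof (induction J arbitrary: t)
  case empty
  then show ?case using ch by simp
next
  case (insert j J)
  interpret prob_space M by fact
  have j: "j \<in> I" "j \<notin> J" "J \<subseteq> I" using insert by auto
  have sub[measurable]: "\<And>i. i \<in> J \<Longrightarrow> A i \<in> sets borel"
    "\<And>i. i \<in> J \<Longrightarrow> Y i \<in> borel_measurable M"
    "\<And>i. i \<in> I - insert j J \<Longrightarrow> Y i \<in> borel_measurable M"
    "Y j \<in> borel_measurable M" "A j \<in> sets borel"
    using A assms(4) j by auto
  define K where "K = I - insert j J"
  have K: "I - J = insert j K" "j \<notin> K" "finite K" using j I by (auto simp: K_def)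
  define w :: "'a \<Rightarrow> complex"
    where "w x = (\<Prod>i\<in>J. indicator (A i) (Y i x)) * iexp (\<Sum>i\<in>K. t i * Y i x)" for x
  have wm: "w \<in> borel_measurable M" unfolding w_def K_def by measurable
  have wb: "norm (w x) \<le> 1" for x
    unfolding w_def by (auto simp: norm_mult prod_norm[symmetric] indicator_def intro!: prod_le_1)
  define C where "C = (\<Prod>i\<in>J. complex_of_real (measure (\<mu> i) (A i))) * (\<Prod>i\<in>K. char (\<mu> i) (t i))"
  \<comment> \<open>Setting all frequencies but that of \<open>j\<close> to zero gives the marginal
    law.\<close>
  have Yj: "(CLINT x|M. iexp (s * Y j x)) = char (\<mu> j) s" for s
  proof -
    have z: "char (\<mu> i) 0 = 1" if "i \<in> I" for i
      using mu[OF that] by (rule real_distribution.char_zero)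
    have "(\<Sum>i\<in>I. (if i = j then s else 0) * Y i x) = s * Y j x" for x
      using I j by (simp add: if_distrib[of "\<lambda>a. a * _"] cong: if_cong)
    moreover have "(\<Prod>i\<in>I. char (\<mu> i) (if i = j then s else 0)) = char (\<mu> j) s"
      by (subst prod.remove[OF I j(1)]) (auto intro!: prod.neutral simp: z)
    ultimately show ?thesis using ch[of "\<lambda>i. if i = j then s else 0"] by simp
  qed
  have W: "(CLINT x|M. w x * iexp (s * Y j x)) = C * char (\<mu> j) s" for s
  proof -
    have e: "(\<Sum>i\<in>K. (if i = j then s else t i) * y i) = (\<Sum>i\<in>K. t i * y i)" for y :: "'i \<Rightarrow> real"
      using K by (intro sum.cong) auto
    have p: "(\<Prod>i\<in>K. char (\<mu> i) (if i = j then s else t i)) = (\<Prod>i\<in>K. char (\<mu> i) (t i))"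
      using K by (intro prod.cong) auto
    show ?thesis
      using insert.IH[OF j(3), of "\<lambda>i. if i = j then s else t i"] K(2,3)
      by (simp add: K(1) e p w_def C_def exp_add ring_distribs del: of_real_sum) (simp only: ac_simps)
  qed
  have "(CLINT x|M. w x * indicator (A j) (Y j x)) = C * measure (\<mu> j) (A j)"
    by (rule weighted_law_of_char_complex[OF M mu[OF j(1)] _ wm wb Yj W]) auto
  then show ?case
    using insert.hyps by (simp add: K_def w_def C_def ac_simps)
qed

text \<open>For \<open>J = I\<close> the preceding lemma has no exponential left and gives the
  measure of every box; boxes determine a product measure.\<close>

lemma distr_PiM_of_joint_char:
  fixes Y :: "'i \<Rightarrow> 'a \<Rightarrow> real"
  assumes M: "prob_space M" and I: "finite I"
    and mu: "\<And>i. real_distribution (\<mu> i)"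
    and Ym[measurable]: "\<And>i. i \<in> I \<Longrightarrow> Y i \<in> borel_measurable M"
    and ch: "\<And>t. (CLINT x|M. iexp (\<Sum>i\<in>I. t i * Y i x)) = (\<Prod>i\<in>I. char (\<mu> i) (t i))"
  shows "distr M (\<Pi>\<^sub>M i\<in>I. lborel) (\<lambda>x. \<lambda>i\<in>I. Y i x) = (\<Pi>\<^sub>M i\<in>I. \<mu> i)"
proof -
  interpret prob_space M by fact
  interpret R: real_distribution "\<mu> i" for i by (rule mu)
  interpret P: product_sigma_finite \<mu> ..
  have [measurable_cong]: "sets (\<mu> i) = sets borel" for i by simp
  have m: "(\<lambda>x. \<lambda>i\<in>I. Y i x) \<in> measurable M (\<Pi>\<^sub>M i\<in>I. lborel)"
    by (rule measurable_restrict) (use Ym in auto)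
  show ?thesis
  proof (rule P.PiM_eqI[OF I])
    show "sets (distr M (\<Pi>\<^sub>M i\<in>I. lborel) (\<lambda>x. \<lambda>i\<in>I. Y i x)) = sets (Pi\<^sub>M I \<mu>)"
      by (simp, intro sets_PiM_cong) auto
    fix A assume A: "\<And>i. i \<in> I \<Longrightarrow> A i \<in> sets (\<mu> i)"
    then have Ab: "\<And>i. i \<in> I \<Longrightarrow> A i \<in> sets borel" by simp
    define S where "S = (\<lambda>x. \<lambda>i\<in>I. Y i x) -` Pi\<^sub>E I A \<inter> space M"
    have S[measurable]: "S \<in> sets M"
      unfolding S_def by (rule measurable_sets[OF m]) (use I Ab in \<open>auto intro!: sets_PiM_I_finite\<close>)
    have "complex_of_real (measure M S) = (CLINT x|M. of_real (indicator S x))"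
      using S by (subst integral_complex_of_real) simp
    also have "\<dots> = (CLINT x|M. (\<Prod>i\<in>I. indicator (A i) (Y i x)))"
    proof (rule Bochner_Integration.integral_cong)
      fix x assume x: "x \<in> space M"
      have "x \<in> S \<longleftrightarrow> (\<forall>i\<in>I. Y i x \<in> A i)" using x by (auto simp: S_def)
      then show "complex_of_real (indicator S x) = (\<Prod>i\<in>I. indicator (A i) (Y i x))"
        using I by (auto simp: indicator_def of_real_prod[symmetric])
    qed simp
    also have "\<dots> = (\<Prod>i\<in>I. of_real (measure (\<mu> i) (A i)))"
      using measure_inter_of_joint_char[OF M I mu Ym ch Ab subset_refl] by simp
    finally have "measure M S = (\<Prod>i\<in>I. measure (\<mu> i) (A i))"
      by (simp only: of_real_prod[symmetric] of_real_eq_iff)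
    then show "emeasure (distr M (\<Pi>\<^sub>M i\<in>I. lborel) (\<lambda>x. \<lambda>i\<in>I. Y i x)) (Pi\<^sub>E I A)
        = (\<Prod>i\<in>I. emeasure (\<mu> i) (A i))"
      using I Ab by (subst emeasure_distr[OF m])
        (auto intro!: sets_PiM_I_finite simp: S_def[symmetric] emeasure_eq_measure
           R.emeasure_eq_measure prod_ennreal)
  qed
qed

section \<open>Normal laws and product densities\<close>

lemma sum_mult_delta:
  fixes c :: "nat \<Rightarrow> real"
  assumes "i < m"
  shows "(\<Sum>j<m. c j * (if i = j then 1 else 0)) = c i"
  using assms by (simp add: if_distrib cong: if_cong)

lemma sum_square_swap:
  fixes a :: "'i \<Rightarrow> real"
  shows "(\<Sum>u\<in>F. (\<Sum>i\<in>I. a i * g i u)\<^sup>2) = (\<Sum>i\<in>I. \<Sum>j\<in>I. a i * a j * (\<Sum>u\<in>F. g i u * g j u))"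
proof -
  have "(\<Sum>u\<in>F. (\<Sum>i\<in>I. a i * g i u)\<^sup>2) = (\<Sum>u\<in>F. \<Sum>i\<in>I. \<Sum>j\<in>I. a i * a j * (g i u * g j u))"
    by (intro sum.cong) (auto simp: power2_eq_square sum_product mult_ac)
  also have "\<dots> = (\<Sum>i\<in>I. \<Sum>u\<in>F. \<Sum>j\<in>I. a i * a j * (g i u * g j u))"
    by (rule sum.swap)
  also have "\<dots> = (\<Sum>i\<in>I. \<Sum>j\<in>I. \<Sum>u\<in>F. a i * a j * (g i u * g j u))"
    by (intro sum.cong refl sum.swap)
  finally show ?thesis by (simp add: sum_distrib_left)
qed

lemma char_centred_normal:
  assumes "prob_space M" and D: "distributed M lborel Y (normal_density 0 \<sigma>)" and "0 < \<sigma>"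
  shows "(CLINT x|M. iexp (t * Y x)) = of_real (exp (- (\<sigma> * t)\<^sup>2 / 2))"
proof -
  interpret prob_space M by fact
  define Z where "Z x = Y x / \<sigma>" for x
  have Z: "distributed M lborel Z std_normal_density"
    using D normal_standard_normal_convert[OF \<open>0 < \<sigma>\<close>, of Y 0] by (simp add: Z_def[abs_def])
  have [measurable]: "Z \<in> borel_measurable M"
    using distributed_measurable[OF Z] by simp
  have "of_real (exp (- (\<sigma> * t)\<^sup>2 / 2)) = char std_normal_distribution (\<sigma> * t)"
    by (simp add: char_std_normal_distribution)
  also have "\<dots> = char (distr M lborel Z) (\<sigma> * t)"
    using distributed_distr_eq_density[OF Z] by simp
  also have "\<dots> = (CLINT x|M. iexp ((\<sigma> * t) * Z x))"
    unfolding char_def by (rule integral_distr) auto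
  also have "\<dots> = (CLINT x|M. iexp (t * Y x))"
    using \<open>0 < \<sigma>\<close> by (simp add: Z_def)
  finally show ?thesis by simp
qed

lemma real_distribution_normal:
  "0 < \<sigma> \<Longrightarrow> real_distribution (density lborel (normal_density 0 \<sigma>))"
  using prob_space_normal_density[of \<sigma> 0]
  by (auto simp: real_distribution_def real_distribution_axioms_def)

lemma char_normal_density:
  assumes "0 < \<sigma>"
  shows "char (density lborel (normal_density 0 \<sigma>)) t = of_real (exp (- (\<sigma> * t)\<^sup>2 / 2))"
proof -
  interpret real_distribution "density lborel (normal_density 0 \<sigma>)"
    by (rule real_distribution_normal) fact
  have "distributed (density lborel (normal_density 0 \<sigma>)) lborel (\<lambda>x. x) (normal_density 0 \<sigma>)"
    unfolding distributed_def
    by (auto intro!: measure_eqI simp: emeasure_distr)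
  from char_centred_normal[OF prob_space_axioms this assms, of t] show ?thesis
    by (simp add: char_def)
qed

lemma PiM_density:
  fixes g :: "'i \<Rightarrow> real \<Rightarrow> real"
  assumes I: "finite I" and [measurable]: "\<And>i. g i \<in> borel_measurable borel"
    and nn: "\<And>i x. 0 \<le> g i x"
    and P: "\<And>i. prob_space (density lborel (g i))"
  shows "(\<Pi>\<^sub>M i\<in>I. density lborel (g i)) =
    density (\<Pi>\<^sub>M i\<in>I. lborel) (\<lambda>x. ennreal (\<Prod>i\<in>I. g i (x i)))"
proof -
  interpret L: product_sigma_finite "\<lambda>_. lborel :: real measure" ..
  interpret R: prob_space "density lborel (g i)" for i by (rule P)
  interpret P: product_sigma_finite "\<lambda>i. density lborel (g i)" ..
  show ?thesis
  proof (rule P.PiM_eqI[OF I, symmetric])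
    show "sets (density (\<Pi>\<^sub>M i\<in>I. lborel) (\<lambda>x. ennreal (\<Prod>i\<in>I. g i (x i))))
      = sets (\<Pi>\<^sub>M i\<in>I. density lborel (g i))"
      by (simp, intro sets_PiM_cong) auto
    fix A assume "\<And>i. i \<in> I \<Longrightarrow> A i \<in> sets (density lborel (g i))"
    then have A: "\<And>i. i \<in> I \<Longrightarrow> A i \<in> sets borel" by simp
    have "emeasure (density (\<Pi>\<^sub>M i\<in>I. lborel) (\<lambda>x. ennreal (\<Prod>i\<in>I. g i (x i)))) (Pi\<^sub>E I A)
      = (\<integral>\<^sup>+x. ennreal (\<Prod>i\<in>I. g i (x i)) * indicator (Pi\<^sub>E I A) x \<partial>(\<Pi>\<^sub>M i\<in>I. lborel))"
      using I A by (intro emeasure_density) (auto intro!: sets_PiM_I_finite)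
    also have "\<dots> = (\<integral>\<^sup>+x. (\<Prod>i\<in>I. ennreal (g i (x i)) * indicator (A i) (x i)) \<partial>(\<Pi>\<^sub>M i\<in>I. lborel))"
    proof (rule nn_integral_cong)
      fix x assume "x \<in> space (\<Pi>\<^sub>M i\<in>I. lborel :: real measure)"
      then have "(indicator (Pi\<^sub>E I A) x :: ennreal) = (\<Prod>i\<in>I. indicator (A i) (x i))"
        using I by (auto simp: indicator_def space_PiM PiE_iff prod_zero_iff)
      then show "ennreal (\<Prod>i\<in>I. g i (x i)) * indicator (Pi\<^sub>E I A) x =
          (\<Prod>i\<in>I. ennreal (g i (x i)) * indicator (A i) (x i))"
        using nn by (simp add: prod_ennreal prod.distrib)
    qed
    also have "\<dots> = (\<Prod>i\<in>I. \<integral>\<^sup>+x. ennreal (g i x) * indicator (A i) x \<partial>lborel)"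
      using A by (intro L.product_nn_integral_prod I borel_measurable_times_ennreal borel_measurable_indicator) auto
    also have "\<dots> = (\<Prod>i\<in>I. emeasure (density lborel (g i)) (A i))"
      using A by (intro prod.cong refl emeasure_density[symmetric]) auto
    finally show "emeasure (density (\<Pi>\<^sub>M i\<in>I. lborel) (\<lambda>x. ennreal (\<Prod>i\<in>I. g i (x i)))) (Pi\<^sub>E I A)
      = (\<Prod>i\<in>I. emeasure (density lborel (g i)) (A i))" .
  qed
qed

subsection \<open>Lebesgue measure on a subspace\<close>

definition onb_vec :: "nat list set \<Rightarrow> nat \<Rightarrow> (nat \<Rightarrow> nat list \<Rightarrow> real) \<Rightarrow> (nat \<Rightarrow> real) \<Rightarrow> nat list \<Rightarrow> real"
  where "onb_vec F m b y = (\<lambda>u\<in>F. \<Sum>i<m. y i * b i u)"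

text \<open>Left inverse of \<open>onb_vec\<close> on extensional vectors. Being defined on all of
  \<open>R^F\<close>, it carries densities from coordinates to the ambient space.\<close>

definition onb_coord :: "nat list set \<Rightarrow> nat \<Rightarrow> (nat \<Rightarrow> nat list \<Rightarrow> real) \<Rightarrow> (nat list \<Rightarrow> real) \<Rightarrow> nat \<Rightarrow> real"
  where "onb_coord F m b f = (\<lambda>i\<in>{..<m}. \<Sum>u\<in>F. b i u * f u)"

lemma measurable_onb_vec [measurable]:
  "onb_vec F m b \<in> measurable (\<Pi>\<^sub>M i\<in>{..<m}. lborel) (\<Pi>\<^sub>M u\<in>F. lborel)"
  unfolding onb_vec_def[abs_def] by measurable

lemma measurable_onb_coord [measurable]:
  "onb_coord F m b \<in> measurable (\<Pi>\<^sub>M u\<in>F. lborel) (\<Pi>\<^sub>M i\<in>{..<m}. lborel)"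
  unfolding onb_coord_def[abs_def] by measurable

lemma is_onbD:
  assumes "is_onb F W m b"
  shows "\<And>i. i < m \<Longrightarrow> b i \<in> W"
    and "\<And>i j. i < m \<Longrightarrow> j < m \<Longrightarrow> (\<Sum>u\<in>F. b i u * b j u) = (if i = j then 1 else 0)"
    and "\<And>f. f \<in> W \<Longrightarrow> \<exists>c. f = (\<lambda>u\<in>F. \<Sum>i<m. c i * b i u)"
  using assms by (auto simp: is_onb_def)

lemma onb_expansion:
  assumes onb: "is_onb F W m b" and "f \<in> W" "u \<in> F"
  shows "(\<Sum>i<m. (\<Sum>w\<in>F. b i w * f w) * b i u) = f u"
proof -
  obtain c where c: "f = (\<lambda>u\<in>F. \<Sum>i<m. c i * b i u)" using is_onbD(3)[OF onb \<open>f \<in> W\<close>] by blast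
  have "(\<Sum>w\<in>F. b i w * f w) = c i" if "i < m" for i
  proof -
    have "(\<Sum>w\<in>F. b i w * f w) = (\<Sum>w\<in>F. \<Sum>j<m. c j * (b i w * b j w))"
      by (intro sum.cong) (auto simp: c sum_distrib_left mult_ac)
    also have "\<dots> = (\<Sum>j<m. c j * (\<Sum>w\<in>F. b i w * b j w))"
      by (subst sum.swap) (simp add: sum_distrib_left)
    also have "\<dots> = (\<Sum>j<m. c j * (if i = j then 1 else 0))"
      using that by (intro sum.cong) (auto simp: is_onbD(2)[OF onb])
    also have "\<dots> = c i" using that by (rule sum_mult_delta)
    finally show ?thesis .
  qed
  then show ?thesis using \<open>u \<in> F\<close> by (simp add: c)
qed

lemma onb_coord_vec:
  assumes onb: "is_onb F W m b" and "y \<in> extensional {..<m}"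
  shows "onb_coord F m b (onb_vec F m b y) = y"
proof
  fix i
  show "onb_coord F m b (onb_vec F m b y) i = y i"
  proof (cases "i < m")
    case True
    have "(\<Sum>w\<in>F. b i w * (\<Sum>j<m. y j * b j w)) = (\<Sum>j<m. y j * (\<Sum>w\<in>F. b i w * b j w))"
      by (simp add: sum_distrib_left mult_ac, subst sum.swap, simp)
    also have "\<dots> = (\<Sum>j<m. y j * (if i = j then 1 else 0))"
      using True by (intro sum.cong) (auto simp: is_onbD(2)[OF onb])
    also have "\<dots> = y i" using True by (rule sum_mult_delta)
    finally show ?thesis using True by (simp add: onb_coord_def onb_vec_def)
  qed (use assms(2) in \<open>auto simp: onb_coord_def extensional_def\<close>)
qed

lemma onb_vec_norm:
  assumes onb: "is_onb F W m b" and F: "finite F"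
  shows "(\<Sum>u\<in>F. (onb_vec F m b y u)\<^sup>2) = (\<Sum>i<m. (y i)\<^sup>2)"
proof -
  have "(\<Sum>u\<in>F. (onb_vec F m b y u)\<^sup>2) = (\<Sum>u\<in>F. (\<Sum>i<m. y i * b i u)\<^sup>2)"
    by (simp add: onb_vec_def)
  also have "\<dots> = (\<Sum>i<m. \<Sum>j<m. y i * y j * (\<Sum>u\<in>F. b i u * b j u))"
    by (rule sum_square_swap)
  also have "\<dots> = (\<Sum>i<m. \<Sum>j<m. y i * y j * (if i = j then 1 else 0))"
    by (intro sum.cong) (auto simp: is_onbD(2)[OF onb])
  also have "\<dots> = (\<Sum>i<m. (y i)\<^sup>2)"
    by (simp add: sum_mult_delta power2_eq_square)
  finally show ?thesis .
qed

abbreviation std_gauss :: "nat \<Rightarrow> (nat \<Rightarrow> real) measure"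
  where "std_gauss m \<equiv> \<Pi>\<^sub>M i\<in>{..<m}. std_normal_distribution"

lemma sets_std_gauss [measurable_cong]: "sets (std_gauss m) = sets (\<Pi>\<^sub>M i\<in>{..<m}. lborel)"
  by (intro sets_PiM_cong) auto

lemma char_std_gauss:
  "(CLINT y|std_gauss m. iexp (\<Sum>i<m. s i * y i)) = of_real (exp (- (\<Sum>i<m. (s i)\<^sup>2) / 2))"
proof -
  interpret real_distribution std_normal_distribution by (rule real_dist_normal_dist)
  interpret P: product_sigma_finite "\<lambda>_::nat. std_normal_distribution" ..
  have "(CLINT y|std_gauss m. iexp (\<Sum>i<m. s i * y i))
    = (CLINT y|std_gauss m. \<Prod>i<m. iexp (s i * y i))"
    by (simp add: sum_distrib_left exp_sum)
  also have "\<dots> = (\<Prod>i<m. CLINT x|std_normal_distribution. iexp (s i * x))"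
    by (rule P.product_integral_prod) (auto intro!: integrable_iexp)
  also have "\<dots> = (\<Prod>i<m. of_real (exp (- (s i)\<^sup>2 / 2)))"
    unfolding char_def[symmetric] char_std_normal_distribution ..
  also have "\<dots> = of_real (exp (\<Sum>i<m. - (s i)\<^sup>2 / 2))"
    by (simp add: exp_sum of_real_prod)
  finally show ?thesis by (simp add: sum_negf sum_divide_distrib)
qed

text \<open>Parseval's identity for \<open>b i'\<close> expanded in \<open>c\<close>. The transition
  matrix has orthonormal rows and, with the bases exchanged, orthonormal columns.\<close>

lemma onb_gram_orthogonal:
  assumes c: "is_onb F W n c" and b: "is_onb F W m b" and F: "finite F" and i: "i < m" "i' < m"
  shows "(\<Sum>j<n. (\<Sum>u\<in>F. b i u * c j u) * (\<Sum>u\<in>F. b i' u * c j u)) = (if i = i' then 1 else 0)"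
proof -
  have "(\<Sum>j<n. (\<Sum>u\<in>F. b i u * c j u) * (\<Sum>u\<in>F. b i' u * c j u))
    = (\<Sum>u\<in>F. b i u * (\<Sum>j<n. (\<Sum>w\<in>F. c j w * b i' w) * c j u))"
    (is "?l = _")
  proof -
    have "?l = (\<Sum>j<n. \<Sum>u\<in>F. b i u * ((\<Sum>w\<in>F. c j w * b i' w) * c j u))"
      by (intro sum.cong) (auto simp: sum_distrib_right mult_ac)
    then show ?thesis by (subst (asm) sum.swap) (simp add: sum_distrib_left)
  qed
  also have "\<dots> = (\<Sum>u\<in>F. b i u * b i' u)"
    using onb_expansion[OF c is_onbD(1)[OF b i(2)]] by (intro sum.cong) auto
  also have "\<dots> = (if i = i' then 1 else 0)" by (rule is_onbD(2)[OF b i])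
  finally show ?thesis .
qed

text \<open>The squared entries of the transition matrix sum to \<open>m\<close> by rows and to
  \<open>n\<close> by columns.\<close>

lemma onb_card_unique:
  assumes c: "is_onb F W n c" and b: "is_onb F W m b" and F: "finite F"
  shows "n = m"
proof -
  let ?q = "\<lambda>i j. (\<Sum>u\<in>F. b i u * c j u)"
  have "real m = (\<Sum>i<m. \<Sum>j<n. ?q i j * ?q i j)"
    using onb_gram_orthogonal[OF c b F] by simp
  also have "\<dots> = (\<Sum>j<n. \<Sum>i<m. ?q i j * ?q i j)" by (rule sum.swap)
  also have "\<dots> = real n"
    using onb_gram_orthogonal[OF b c F] by (simp add: mult.commute)
  finally show ?thesis by simp
qed

text \<open>Rotation invariance is proved for the Gaussian and transferred to Lebesgue measure, whose
  density with respect to the Gaussian depends only on the Euclidean norm.\<close>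
lemma distr_std_gauss_onb:
  assumes c: "is_onb F W n c" and b: "is_onb F W m b" and F: "finite F"
  shows "distr (std_gauss m) (\<Pi>\<^sub>M u\<in>F. lborel) (onb_vec F m b) =
         distr (std_gauss n) (\<Pi>\<^sub>M u\<in>F. lborel) (onb_vec F n c)"
proof -
  interpret N: prob_space std_normal_distribution by (rule prob_space_normal_density) simp
  interpret G: prob_space "std_gauss n" by (intro prob_space_PiM N.prob_space_axioms)
  define q where "q i j = (\<Sum>u\<in>F. b i u * c j u)" for i j
  have "distr (std_gauss n) (\<Pi>\<^sub>M i\<in>{..<m}. lborel) (\<lambda>y. \<lambda>i\<in>{..<m}. \<Sum>j<n. q i j * y j) = std_gauss m"
  proof (rule distr_PiM_of_joint_char)
    show "real_distribution std_normal_distribution" by (rule real_dist_normal_dist)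
    fix t :: "nat \<Rightarrow> real"
    define s where "s j = (\<Sum>i<m. t i * q i j)" for j
    \<comment> \<open>Orthogonality of \<open>q\<close> preserves the norm of the frequency, the
      only quantity on which the Gaussian characteristic function depends.\<close>
    have "(\<Sum>j<n. (s j)\<^sup>2) = (\<Sum>i<m. \<Sum>i'<m. t i * t i' * (\<Sum>j<n. q i j * q i' j))"
      unfolding s_def by (rule sum_square_swap)
    also have "\<dots> = (\<Sum>i<m. \<Sum>i'<m. t i * t i' * (if i = i' then 1 else 0))"
      using onb_gram_orthogonal[OF c b F] by (intro sum.cong) (auto simp: q_def)
    also have "\<dots> = (\<Sum>i<m. (t i)\<^sup>2)"
      by (simp add: sum_mult_delta power2_eq_square)
    finally have s2: "(\<Sum>j<n. (s j)\<^sup>2) = (\<Sum>i<m. (t i)\<^sup>2)" .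
    have lin: "(\<Sum>i<m. t i * (\<Sum>j<n. q i j * y j)) = (\<Sum>j<n. s j * y j)" for y
      by (simp add: s_def sum_distrib_left sum_distrib_right mult_ac) (subst sum.swap, simp)
    show "(CLINT y|std_gauss n. iexp (\<Sum>i<m. t i * (\<Sum>j<n. q i j * y j)))
      = (\<Prod>i<m. char std_normal_distribution (t i))"
      unfolding lin char_std_gauss s2
      by (simp add: char_std_normal_distribution of_real_prod[symmetric] exp_sum[symmetric]
          sum_negf sum_divide_distrib del: of_real_exp of_real_prod)
  qed (auto intro: G.prob_space_axioms)
  also have "(\<lambda>y. \<lambda>i\<in>{..<m}. \<Sum>j<n. q i j * y j) = (\<lambda>y. onb_coord F m b (onb_vec F n c y))"
    unfolding onb_coord_def onb_vec_def q_def
    by (intro ext restrict_ext) (simp add: sum_distrib_left sum_distrib_right mult_ac, subst sum.swap, simp)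
  finally have "distr (std_gauss m) (\<Pi>\<^sub>M u\<in>F. lborel) (onb_vec F m b) =
     distr (distr (std_gauss n) (\<Pi>\<^sub>M i\<in>{..<m}. lborel) (\<lambda>y. onb_coord F m b (onb_vec F n c y)))
       (\<Pi>\<^sub>M u\<in>F. lborel) (onb_vec F m b)" by simp
  also have "\<dots> = distr (std_gauss n) (\<Pi>\<^sub>M u\<in>F. lborel)
      (onb_vec F m b \<circ> (\<lambda>y. onb_coord F m b (onb_vec F n c y)))"
    by (rule distr_distr) measurable
  also have "(onb_vec F m b \<circ> (\<lambda>y. onb_coord F m b (onb_vec F n c y))) = onb_vec F n c"
  proof (intro ext)
    fix y u
    show "(onb_vec F m b \<circ> (\<lambda>y. onb_coord F m b (onb_vec F n c y))) y u = onb_vec F n c y u"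
    proof (cases "u \<in> F")
      case True
      have "(\<Sum>i<m. (\<Sum>w\<in>F. b i w * (\<Sum>j<n. y j * c j w)) * b i u) =
            (\<Sum>i<m. \<Sum>j<n. y j * ((\<Sum>w\<in>F. b i w * c j w) * b i u))"
        by (intro sum.cong refl) (simp add: sum_distrib_left sum_distrib_right mult_ac, subst sum.swap, simp)
      also have "\<dots> = (\<Sum>j<n. y j * (\<Sum>i<m. (\<Sum>w\<in>F. b i w * c j w) * b i u))"
        by (subst sum.swap) (simp add: sum_distrib_left)
      also have "\<dots> = (\<Sum>j<n. y j * c j u)"
        using onb_expansion[OF b is_onbD(1)[OF c] True] by (intro sum.cong) auto
      finally show ?thesis using True by (simp add: onb_vec_def onb_coord_def)
    qed (simp add: onb_vec_def)
  qed
  finally show ?thesis .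
qed

lemma lborel_PiM_eq_density_std_gauss:
  "(\<Pi>\<^sub>M i\<in>{..<m}. lborel) =
     density (std_gauss m) (\<lambda>y. ennreal (sqrt (2 * pi) ^ m * exp ((\<Sum>i<m. (y i)\<^sup>2) / 2)))"
proof -
  have g: "std_gauss m = density (\<Pi>\<^sub>M i\<in>{..<m}. lborel) (\<lambda>x. ennreal (\<Prod>i<m. std_normal_density (x i)))"
    by (rule PiM_density) (auto intro: prob_space_normal_density)
  have "ennreal (\<Prod>i<m. std_normal_density (x i)) * ennreal (sqrt (2 * pi) ^ m * exp ((\<Sum>i<m. (x i)\<^sup>2) / 2)) = 1"
    for x :: "nat \<Rightarrow> real"
  proof -
    have "(\<Prod>i<m. std_normal_density (x i)) = (\<Prod>i<m. exp (- ((x i)\<^sup>2 / 2))) / sqrt (2 * pi) ^ m"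
      by (simp add: std_normal_density_def prod_dividef)
    also have "\<dots> = exp (- ((\<Sum>i<m. (x i)\<^sup>2) / 2)) / sqrt (2 * pi) ^ m"
      by (simp add: exp_sum[symmetric] sum_negf sum_divide_distrib)
    finally have "(\<Prod>i<m. std_normal_density (x i)) * (sqrt (2 * pi) ^ m * exp ((\<Sum>i<m. (x i)\<^sup>2) / 2)) = 1"
      by (simp add: exp_minus)
    then show ?thesis by (simp add: ennreal_mult[symmetric] prod_nonneg del: prod_ennreal)
  qed
  then have "density (std_gauss m) (\<lambda>y. ennreal (sqrt (2 * pi) ^ m * exp ((\<Sum>i<m. (y i)\<^sup>2) / 2)))
    = density (\<Pi>\<^sub>M i\<in>{..<m}. lborel) (\<lambda>_. 1)"
    unfolding g by (subst density_density_eq) simp_all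
  then show ?thesis by (simp add: density_1)
qed

text \<open>The definition takes its basis from \<open>SOME\<close>; this frees the choice, so that
  an eigenbasis of the covariance may be used.\<close>

lemma subspace_lebesgue_eq:
  assumes F: "finite F" and onb: "is_onb F W m b"
  shows "subspace_lebesgue F W = distr (\<Pi>\<^sub>M i\<in>{..<m}. lborel) (\<Pi>\<^sub>M u\<in>F. lborel) (onb_vec F m b)"
proof -
  \<comment> \<open>Reciprocal of the Gaussian density, written in terms of the vector instead of
    its coordinates, so that two bases of the same size share it.\<close>
  define H where "H m f = sqrt (2 * pi) ^ m * exp ((\<Sum>u\<in>F. (f u)\<^sup>2) / 2)" for m :: nat and f :: "nat list \<Rightarrow> real"
  have [measurable]: "H m \<in> borel_measurable (\<Pi>\<^sub>M u\<in>F. lborel)" for m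
    unfolding H_def[abs_def] by measurable
  have L: "distr (\<Pi>\<^sub>M i\<in>{..<m}. lborel) (\<Pi>\<^sub>M u\<in>F. lborel) (onb_vec F m b)
    = density (distr (std_gauss m) (\<Pi>\<^sub>M u\<in>F. lborel) (onb_vec F m b)) (\<lambda>f. ennreal (H m f))"
    if b: "is_onb F W m b" for m b
  proof -
    have "density (distr (std_gauss m) (\<Pi>\<^sub>M u\<in>F. lborel) (onb_vec F m b)) (\<lambda>f. ennreal (H m f))
      = distr (density (std_gauss m) (\<lambda>y. ennreal (H m (onb_vec F m b y)))) (\<Pi>\<^sub>M u\<in>F. lborel) (onb_vec F m b)"
      by (rule density_distr) measurable
    then show ?thesis
      unfolding H_def onb_vec_norm[OF b F] lborel_PiM_eq_density_std_gauss[symmetric] ..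
  qed
  define mb where "mb = (SOME mb. is_onb F W (fst mb) (snd mb))"
  have mb: "is_onb F W (fst mb) (snd mb)"
    unfolding mb_def by (rule someI[of _ "(m, b)"]) (simp add: onb)
  have "subspace_lebesgue F W
     = distr (\<Pi>\<^sub>M i\<in>{..<fst mb}. lborel) (\<Pi>\<^sub>M u\<in>F. lborel) (onb_vec F (fst mb) (snd mb))"
    unfolding subspace_lebesgue_def mb_def[symmetric] Let_def onb_vec_def[abs_def] ..
  also have "\<dots> = distr (\<Pi>\<^sub>M i\<in>{..<m}. lborel) (\<Pi>\<^sub>M u\<in>F. lborel) (onb_vec F m b)"
    unfolding L[OF mb] L[OF onb] distr_std_gauss_onb[OF onb mb F]
    by (simp add: onb_card_unique[OF mb onb F])
  finally show ?thesis .
qed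

subsection \<open>Entropy of the wave\<close>

lemma normal_log_expectation:
  assumes "prob_space M" and D: "distributed M lborel Y (normal_density 0 \<sigma>)" and "0 < \<sigma>"
  shows "integrable M (\<lambda>x. ln (normal_density 0 \<sigma> (Y x)))"
    and "(LINT x|M. ln (normal_density 0 \<sigma> (Y x))) = - ln (2 * pi * exp 1 * \<sigma>\<^sup>2) / 2"
proof -
  interpret information_space M "exp 1"
    using \<open>prob_space M\<close> by (simp add: information_space_def information_space_axioms_def)
  have e: "ln (normal_density 0 \<sigma> x) = - ln (2 * pi * \<sigma>\<^sup>2) / 2 - x\<^sup>2 * (1 / (2 * \<sigma>\<^sup>2))" for x
  proof -
    have "0 < 2 * pi * \<sigma>\<^sup>2" using \<open>0 < \<sigma>\<close> by simp
    then show ?thesis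
      by (simp add: normal_density_def ln_mult_pos ln_div ln_sqrt del: zero_less_mult_iff)
  qed
  have "integrable lborel (\<lambda>x. normal_density 0 \<sigma> x * ln (normal_density 0 \<sigma> x))"
    unfolding e right_diff_distrib mult.assoc[symmetric]
    using integrable_normal_moment[OF \<open>0 < \<sigma>\<close>, of 0 2] integrable_normal_density[OF \<open>0 < \<sigma>\<close>]
    by (intro Bochner_Integration.integrable_diff integrable_mult_left) auto
  then show "integrable M (\<lambda>x. ln (normal_density 0 \<sigma> (Y x)))"
    by (subst distributed_integrable[OF D, symmetric]) auto
  have "(LINT x|M. ln (normal_density 0 \<sigma> (Y x))) = (LINT x|lborel. normal_density 0 \<sigma> x * ln (normal_density 0 \<sigma> x))"
    by (subst distributed_integral[OF D]) auto
  also have "\<dots> = - entropy (exp 1) lborel Y"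
    by (subst entropy_distr[OF D]) (auto simp: log_def)
  also have "\<dots> = - ln (2 * pi * exp 1 * \<sigma>\<^sup>2) / 2"
    by (subst entropy_normal_density[OF \<open>0 < \<sigma>\<close> D]) (simp add: log_def)
  finally show "(LINT x|M. ln (normal_density 0 \<sigma> (Y x))) = - ln (2 * pi * exp 1 * \<sigma>\<^sup>2) / 2" .
qed

definition wcov :: "nat \<Rightarrow> real \<Rightarrow> nat list \<Rightarrow> nat list \<Rightarrow> real"
  where "wcov d lam u w = wavecov d (tdist u w) (lam / (2 * sqrt (real d - 1)))"

lemma quadratic_form_expansion:
  fixes b :: "'i \<Rightarrow> 'u \<Rightarrow> real"
  shows "(\<Sum>u\<in>F. \<Sum>w\<in>F. c u * c w * (\<Sum>i\<in>I. v i * b i u * b i w)) = (\<Sum>i\<in>I. v i * (\<Sum>u\<in>F. c u * b i u)\<^sup>2)"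
proof -
  have "(\<Sum>u\<in>F. \<Sum>w\<in>F. c u * c w * (\<Sum>i\<in>I. v i * b i u * b i w))
     = (\<Sum>u\<in>F. \<Sum>w\<in>F. \<Sum>i\<in>I. v i * ((c u * b i u) * (c w * b i w)))"
    by (intro sum.cong refl) (simp add: sum_distrib_left mult_ac)
  also have "\<dots> = (\<Sum>u\<in>F. \<Sum>i\<in>I. \<Sum>w\<in>F. v i * ((c u * b i u) * (c w * b i w)))"
    by (intro sum.cong refl sum.swap)
  also have "\<dots> = (\<Sum>i\<in>I. \<Sum>u\<in>F. \<Sum>w\<in>F. v i * ((c u * b i u) * (c w * b i w)))"
    by (rule sum.swap)
  also have "\<dots> = (\<Sum>i\<in>I. v i * (\<Sum>u\<in>F. c u * b i u)\<^sup>2)"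
    by (simp only: power2_eq_square sum_product) (simp only: sum_distrib_left)
  finally show ?thesis .
qed

context
  fixes d :: nat and lam :: real and M :: "'a measure" and X :: "nat list \<Rightarrow> 'a \<Rightarrow> real"
  assumes wave: "gaussian_wave d lam M X"
begin

lemma wave_prob_space: "prob_space M"
  using wave by (simp add: gaussian_wave_def)

lemma wave_measurable: "tvert d u \<Longrightarrow> X u \<in> borel_measurable M"
  using wave by (simp add: gaussian_wave_def)

lemma wave_lincomb:
  assumes "finite F" "\<And>u. u \<in> F \<Longrightarrow> tvert d u"
    and "v = (\<Sum>u\<in>F. \<Sum>w\<in>F. c u * c w * wcov d lam u w)"
  shows "v = 0 \<Longrightarrow> AE \<omega> in M. (\<Sum>u\<in>F. c u * X u \<omega>) = 0"
    and "v \<noteq> 0 \<Longrightarrow> distributed M lborel (\<lambda>\<omega>. \<Sum>u\<in>F. c u * X u \<omega>) (normal_density 0 (sqrt v))"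
proof -
  have "let v = (\<Sum>u\<in>F. \<Sum>w\<in>F. c u * c w * wavecov d (tdist u w) (lam / (2 * sqrt (real d - 1))));
             Y = (\<lambda>\<omega>. \<Sum>u\<in>F. c u * X u \<omega>)
         in if v = 0 then (AE \<omega> in M. Y \<omega> = 0)
            else distributed M lborel Y (\<lambda>x. ennreal (normal_density 0 (sqrt v) x))"
    using wave assms(1,2) unfolding gaussian_wave_def by blast
  then have "if v = 0 then (AE \<omega> in M. (\<Sum>u\<in>F. c u * X u \<omega>) = 0)
      else distributed M lborel (\<lambda>\<omega>. \<Sum>u\<in>F. c u * X u \<omega>) (normal_density 0 (sqrt v))"
    unfolding Let_def assms(3) wcov_def .
  then show "v = 0 \<Longrightarrow> AE \<omega> in M. (\<Sum>u\<in>F. c u * X u \<omega>) = 0"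
    and "v \<noteq> 0 \<Longrightarrow> distributed M lborel (\<lambda>\<omega>. \<Sum>u\<in>F. c u * X u \<omega>) (normal_density 0 (sqrt v))"
    by presburger+
qed

text \<open>The point mass obeys the same formula as the proper normal laws, so joint laws can be
  computed before it is known which combinations vanish.\<close>

lemma wave_char:
  assumes "finite F" "\<And>u. u \<in> F \<Longrightarrow> tvert d u"
    and v: "v = (\<Sum>u\<in>F. \<Sum>w\<in>F. c u * c w * wcov d lam u w)" "0 \<le> v"
  shows "(CLINT \<omega>|M. iexp (\<Sum>u\<in>F. c u * X u \<omega>)) = of_real (exp (- v / 2))"
proof (cases "v = 0")
  case True
  interpret prob_space M by (rule wave_prob_space)
  have [measurable]: "\<And>u. u \<in> F \<Longrightarrow> X u \<in> borel_measurable M" using assms(2) wave_measurable by auto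
  have "(CLINT \<omega>|M. iexp (\<Sum>u\<in>F. c u * X u \<omega>)) = (CLINT \<omega>|M. 1)"
  proof (rule integral_cong_AE)
    show "AE \<omega> in M. iexp (\<Sum>u\<in>F. c u * X u \<omega>) = 1"
      by (rule AE_mp[OF wave_lincomb(1)[OF assms(1-2) v(1) True]]) (auto intro!: AE_I2)
  qed simp_all
  then show ?thesis using True by (simp add: prob_space)
next
  case False
  then show ?thesis
    using char_centred_normal[OF wave_prob_space wave_lincomb(2)[OF assms(1-2) v(1)], of 1] v(2)
    by simp
qed

text \<open>The coordinates in the eigenbasis are independent normals with variances
  \<open>v i\<close>, and the wave is recovered from them almost surely. Its law thus has a product
  density with respect to Lebesgue measure on the subspace, and entropies of the coordinates add
  up.\<close>

lemma Dsp_eigenbasis: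
  assumes F: "finite F" "\<And>u. u \<in> F \<Longrightarrow> tvert d u"
    and onb: "is_onb F (Wlam d lam F) m b"
    and vpos: "\<And>i. i < m \<Longrightarrow> 0 < v i"
    and cov: "\<And>u w. u \<in> F \<Longrightarrow> w \<in> F \<Longrightarrow> wcov d lam u w = (\<Sum>i<m. v i * b i u * b i w)"
  shows "Dsp d lam F M X = (\<Sum>i<m. ln (2 * pi * exp 1 * v i) / 2)"
proof -
  interpret information_space M "exp 1"
    using wave_prob_space by (simp add: information_space_def information_space_axioms_def)
  have Xm[measurable]: "\<And>u. u \<in> F \<Longrightarrow> X u \<in> borel_measurable M" using F wave_measurable by auto
  define Y where "Y i \<omega> = (\<Sum>u\<in>F. b i u * X u \<omega>)" for i \<omega>
  have [measurable]: "Y i \<in> borel_measurable M" for i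
    unfolding Y_def[abs_def] by measurable
  \<comment> \<open>Padded with 1 beyond \<open>m\<close>, because the product-law lemma asks for a
    probability distribution at every index.\<close>
  define v' where "v' i = (if i < m then v i else 1)" for i
  have v': "0 < v' i" for i using vpos by (simp add: v'_def)
  have var: "(\<Sum>u\<in>F. \<Sum>w\<in>F. c u * c w * wcov d lam u w) = (\<Sum>i<m. v i * (\<Sum>u\<in>F. c u * b i u)\<^sup>2)" for c
    unfolding quadratic_form_expansion[symmetric] by (intro sum.cong refl) (simp add: cov)
  have var_b: "(\<Sum>u\<in>F. \<Sum>w\<in>F. c u * c w * wcov d lam u w) = (\<Sum>i<m. v i * (t i)\<^sup>2)"
    if "\<And>u. c u = (\<Sum>j<m. t j * b j u)" for c t
    unfolding var
  proof (intro sum.cong refl, goal_cases)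
    case (1 i)
    have "(\<Sum>u\<in>F. c u * b i u) = (\<Sum>j<m. t j * (\<Sum>u\<in>F. b i u * b j u))"
      unfolding that by (simp add: sum_distrib_left sum_distrib_right mult_ac) (subst sum.swap, simp)
    also have "\<dots> = (\<Sum>j<m. t j * (if i = j then 1 else 0))"
      using 1 by (intro sum.cong refl) (simp add: is_onbD(2)[OF onb])
    also have "\<dots> = t i" using 1 by (intro sum_mult_delta) simp
    finally show ?case by simp
  qed
  have Ydist: "distributed M lborel (Y i) (normal_density 0 (sqrt (v i)))" if i: "i < m" for i
  proof -
    have "(\<Sum>j<m. v j * (if j = i then 1 else 0)\<^sup>2) = v i"
      using i by (simp add: if_distrib[of "\<lambda>x. x\<^sup>2"] if_distrib[of "(*) _"] cong: if_cong)
    moreover have "b i u = (\<Sum>j<m. (if j = i then 1 else 0) * b j u)" for u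
      using i by (simp add: if_distrib[of "\<lambda>x. x * _"] cong: if_cong)
    ultimately have "v i = (\<Sum>u\<in>F. \<Sum>w\<in>F. b i u * b i w * wcov d lam u w)"
      using var_b[of "b i" "\<lambda>j. if j = i then 1 else 0"] by simp
    from wave_lincomb(2)[OF F this] vpos[OF i] show ?thesis by (simp add: Y_def[abs_def])
  qed
  have law: "distr M (\<Pi>\<^sub>M i\<in>{..<m}. lborel) (\<lambda>\<omega>. \<lambda>i\<in>{..<m}. Y i \<omega>)
      = (\<Pi>\<^sub>M i\<in>{..<m}. density lborel (normal_density 0 (sqrt (v' i))))"
  proof (rule distr_PiM_of_joint_char)
    show "real_distribution (density lborel (normal_density 0 (sqrt (v' i))))" for i
      using v' by (intro real_distribution_normal) simp
    fix t :: "nat \<Rightarrow> real"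
    have "(\<Sum>i<m. t i * Y i \<omega>) = (\<Sum>u\<in>F. (\<Sum>i<m. t i * b i u) * X u \<omega>)" for \<omega>
      unfolding Y_def by (simp add: sum_distrib_left sum_distrib_right mult_ac) (subst sum.swap, simp)
    moreover have "0 \<le> (\<Sum>i<m. v i * (t i)\<^sup>2)"
      using vpos by (intro sum_nonneg) (simp add: less_imp_le)
    ultimately have "(CLINT \<omega>|M. iexp (\<Sum>i<m. t i * Y i \<omega>)) = of_real (exp (- (\<Sum>i<m. v i * (t i)\<^sup>2) / 2))"
      using wave_char[OF F var_b[symmetric, OF refl, of t]] by simp
    also have "\<dots> = (\<Prod>i<m. of_real (exp (- (v i * (t i)\<^sup>2) / 2)))"
      by (simp add: of_real_prod[symmetric] exp_sum[symmetric] sum_negf sum_divide_distrib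
          del: of_real_exp of_real_prod)
    also have "\<dots> = (\<Prod>i<m. char (density lborel (normal_density 0 (sqrt (v' i)))) (t i))"
    proof (intro prod.cong refl, goal_cases)
      case (1 i)
      then show ?case
        using vpos[of i] by (subst char_normal_density) (auto simp: v'_def power_mult_distrib less_imp_le)
    qed
    finally show "(CLINT \<omega>|M. iexp (\<Sum>i<m. t i * Y i \<omega>))
       = (\<Prod>i<m. char (density lborel (normal_density 0 (sqrt (v' i)))) (t i))" .
  qed (auto intro: prob_space_axioms)
  have dens: "(\<Pi>\<^sub>M i\<in>{..<m}. density lborel (normal_density 0 (sqrt (v' i))))
     = density (\<Pi>\<^sub>M i\<in>{..<m}. lborel) (\<lambda>y. ennreal (\<Prod>i<m. normal_density 0 (sqrt (v' i)) (y i)))"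
    using v' by (intro PiM_density) (auto intro!: prob_space_normal_density)
  let ?E = "onb_vec F m b" and ?K = "onb_coord F m b"
  let ?L = "subspace_lebesgue F (Wlam d lam F)"
  let ?X = "\<lambda>\<omega>. \<lambda>u\<in>F. X u \<omega>"
  have sets_L: "sets ?L = sets (\<Pi>\<^sub>M u\<in>F. lborel)" and L: "?L = distr (\<Pi>\<^sub>M i\<in>{..<m}. lborel) (\<Pi>\<^sub>M u\<in>F. lborel) ?E"
    by (simp_all add: subspace_lebesgue_eq[OF F(1) onb])
  note [measurable_cong] = sets_L
  have Xmeas[measurable]: "?X \<in> measurable M (\<Pi>\<^sub>M u\<in>F. lborel)"
    by (rule measurable_restrict) (use Xm in auto)
  have KX: "?K (?X \<omega>) = (\<lambda>i\<in>{..<m}. Y i \<omega>)" for \<omega>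
    by (auto simp: onb_coord_def Y_def intro!: restrict_ext)
  have "AE \<omega> in M. X u \<omega> = (\<Sum>i<m. Y i \<omega> * b i u)" if u: "u \<in> F" for u
  proof -
    \<comment> \<open>The unit vector at \<open>u\<close> minus its projection to the span of the
      \<open>b i\<close>. It is orthogonal to every \<open>b j\<close>, so the corresponding
      combination of the wave has variance zero.\<close>
    define c where "c w = (if w = u then 1 else 0) - (\<Sum>i<m. b i u * b i w)" for w
    have "(\<Sum>w\<in>F. c w * b j w) = 0" if j: "j < m" for j
    proof -
      have "(\<Sum>w\<in>F. c w * b j w) = (\<Sum>w\<in>F. (if w = u then b j w else 0))
          - (\<Sum>w\<in>F. \<Sum>i<m. b i u * (b j w * b i w))"
        unfolding sum_subtractf[symmetric]
        by (intro sum.cong refl) (simp add: c_def algebra_simps sum_distrib_left)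
      also have "\<dots> = b j u - (\<Sum>i<m. b i u * (\<Sum>w\<in>F. b j w * b i w))"
        using u F(1) by (subst sum.swap) (simp add: sum_distrib_left)
      also have "(\<Sum>i<m. b i u * (\<Sum>w\<in>F. b j w * b i w)) = (\<Sum>i<m. b i u * (if j = i then 1 else 0))"
        using j by (intro sum.cong refl) (simp add: is_onbD(2)[OF onb])
      also have "\<dots> = b j u" using j by (rule sum_mult_delta)
      finally show ?thesis by simp
    qed
    then have "0 = (\<Sum>u\<in>F. \<Sum>w\<in>F. c u * c w * wcov d lam u w)" by (simp add: var)
    then have "AE \<omega> in M. (\<Sum>w\<in>F. c w * X w \<omega>) = 0"
      using wave_lincomb(1)[OF F refl, of c] by simp
    then show ?thesis
    proof eventually_elim
      case (elim \<omega>)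
      have "(\<Sum>w\<in>F. c w * X w \<omega>) = (\<Sum>w\<in>F. if w = u then X w \<omega> else 0) - (\<Sum>w\<in>F. \<Sum>i<m. b i w * X w \<omega> * b i u)"
        unfolding sum_subtractf[symmetric]
        by (intro sum.cong refl) (simp add: c_def algebra_simps sum_distrib_left)
      also have "\<dots> = X u \<omega> - (\<Sum>i<m. Y i \<omega> * b i u)"
        using u F(1) by (subst sum.swap) (simp add: Y_def sum_distrib_right)
      finally show ?case using elim by simp
    qed
  qed
  then have "AE \<omega> in M. \<forall>u\<in>F. X u \<omega> = (\<Sum>i<m. Y i \<omega> * b i u)"
    using F(1) by (intro AE_finite_allI)
  then have AE_X: "AE \<omega> in M. ?X \<omega> = ?E (\<lambda>i\<in>{..<m}. Y i \<omega>)"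
    by eventually_elim (auto simp: onb_vec_def intro!: restrict_ext)
  define G where "G f = (\<Prod>i<m. normal_density 0 (sqrt (v' i)) (?K f i))" for f
  have [measurable]: "G \<in> borel_measurable (\<Pi>\<^sub>M u\<in>F. lborel)"
  proof -
    have "G f = (\<Prod>i<m. normal_density 0 (sqrt (v' i)) (\<Sum>u\<in>F. b i u * f u))" for f
      unfolding G_def by (intro prod.cong refl) (simp add: onb_coord_def)
    then have "G = (\<lambda>f. \<Prod>i<m. normal_density 0 (sqrt (v' i)) (\<Sum>u\<in>F. b i u * f u))" by blast
    then show ?thesis by simp
  qed
  have Gpos: "0 < G f" for f using v' by (auto simp: G_def intro!: prod_pos normal_density_pos)
  have "distr M ?L ?X = distr M (\<Pi>\<^sub>M u\<in>F. lborel) (?E \<circ> (\<lambda>\<omega>. \<lambda>i\<in>{..<m}. Y i \<omega>))"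
    using AE_X by (intro distr_cong_AE) (auto simp: sets_L intro: Xmeas)
  also have "\<dots> = distr (distr M (\<Pi>\<^sub>M i\<in>{..<m}. lborel) (\<lambda>\<omega>. \<lambda>i\<in>{..<m}. Y i \<omega>)) (\<Pi>\<^sub>M u\<in>F. lborel) ?E"
    by (rule distr_distr[symmetric]) measurable
  also have "\<dots> = distr (density (\<Pi>\<^sub>M i\<in>{..<m}. lborel) (\<lambda>y. ennreal (\<Prod>i<m. normal_density 0 (sqrt (v' i)) (y i)))) (\<Pi>\<^sub>M u\<in>F. lborel) ?E"
    unfolding law dens ..
  \<comment> \<open>\<open>onb_coord\<close> inverts \<open>onb_vec\<close> on extensional
    \<open>y\<close>, and these fill the space of the product measure.\<close>
  also have "density (\<Pi>\<^sub>M i\<in>{..<m}. lborel) (\<lambda>y. ennreal (\<Prod>i<m. normal_density 0 (sqrt (v' i)) (y i)))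
     = density (\<Pi>\<^sub>M i\<in>{..<m}. lborel) (\<lambda>y. ennreal (G (?E y)))"
  proof (rule density_cong)
    show "AE y in \<Pi>\<^sub>M i\<in>{..<m}. lborel.
        ennreal (\<Prod>i<m. normal_density 0 (sqrt (v' i)) (y i)) = ennreal (G (?E y))"
      by (rule AE_I2) (simp add: G_def space_PiM PiE_iff onb_coord_vec[OF onb])
  qed measurable
  also have "distr \<dots> (\<Pi>\<^sub>M u\<in>F. lborel) ?E = density ?L (\<lambda>f. ennreal (G f))"
    unfolding L by (rule density_distr[symmetric]) measurable
  finally have "distr M ?L ?X = density ?L (\<lambda>f. ennreal (G f))" .
  then have D: "distributed M ?L ?X (\<lambda>f. ennreal (G f))"
    unfolding distributed_def by (intro conjI) measurable
  have "Dsp d lam F M X = - (\<integral>f. G f * log (exp 1) (G f) \<partial>?L)"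
    unfolding Dsp_def using Gpos by (intro entropy_distr D) (auto intro: less_imp_le)
  also have "(\<integral>f. G f * log (exp 1) (G f) \<partial>?L) = (LINT \<omega>|M. log (exp 1) (G (?X \<omega>)))"
    using Gpos by (intro distributed_integral[OF D]) (auto intro: less_imp_le)
  also have "\<dots> = (LINT \<omega>|M. (\<Sum>i<m. ln (normal_density 0 (sqrt (v i)) (Y i \<omega>))))"
  proof (intro Bochner_Integration.integral_cong refl)
    fix \<omega>
    have "ln (\<Prod>i<m. normal_density 0 (sqrt (v i)) (Y i \<omega>)) = (\<Sum>i<m. ln (normal_density 0 (sqrt (v i)) (Y i \<omega>)))"
      using vpos normal_density_pos[of "sqrt (v _)" 0] by (intro ln_prod) (force simp: less_le)+
    then show "log (exp 1) (G (?X \<omega>)) = (\<Sum>i<m. ln (normal_density 0 (sqrt (v i)) (Y i \<omega>)))"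
      by (simp add: G_def KX log_def v'_def)
  qed
  also have "\<dots> = (\<Sum>i<m. - ln (2 * pi * exp 1 * v i) / 2)"
  proof (subst Bochner_Integration.integral_sum, goal_cases)
    case (1 i)
    then show ?case using normal_log_expectation(1)[OF prob_space_axioms Ydist] vpos by auto
  next
    case 2
    show ?case
    proof (intro sum.cong refl)
      fix i assume "i \<in> {..<m}"
      then show "(LINT \<omega>|M. ln (normal_density 0 (sqrt (v i)) (Y i \<omega>))) = - ln (2 * pi * exp 1 * v i) / 2"
        using normal_log_expectation(2)[OF prob_space_axioms Ydist] vpos by (simp add: less_imp_le)
    qed
  qed
  finally show ?thesis by (simp add: sum_negf)
qed

text \<open>Passing to unit vectors multiplies each weight \<open>w i\<close> by the squared norm of
  \<open>A i\<close>; this product is the eigenvalue.\<close>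

lemma Dsp_orthogonal_expansion:
  fixes A :: "'i \<Rightarrow> nat list \<Rightarrow> real"
  assumes F: "finite F" "\<And>u. u \<in> F \<Longrightarrow> tvert d u" and I: "finite I"
    and W: "\<And>i. i \<in> I \<Longrightarrow> restrict (A i) F \<in> Wlam d lam F"
    and orth: "\<And>i j. i \<in> I \<Longrightarrow> j \<in> I \<Longrightarrow> i \<noteq> j \<Longrightarrow> (\<Sum>u\<in>F. A i u * A j u) = 0"
    and npos: "\<And>i. i \<in> I \<Longrightarrow> 0 < (\<Sum>u\<in>F. (A i u)\<^sup>2)"
    and span: "\<And>f. f \<in> Wlam d lam F \<Longrightarrow> \<exists>c. \<forall>u\<in>F. f u = (\<Sum>i\<in>I. c i * A i u)"
    and wpos: "\<And>i. i \<in> I \<Longrightarrow> 0 < w i"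
    and cov: "\<And>u v. u \<in> F \<Longrightarrow> v \<in> F \<Longrightarrow> wcov d lam u v = (\<Sum>i\<in>I. w i * A i u * A i v)"
  shows "Dsp d lam F M X = (\<Sum>i\<in>I. ln (2 * pi * exp 1 * (w i * (\<Sum>u\<in>F. (A i u)\<^sup>2))) / 2)"
proof -
  define N where "N i = (\<Sum>u\<in>F. (A i u)\<^sup>2)" for i
  obtain e where e: "bij_betw e {..<card I} I"
    using ex_bij_betw_nat_finite[OF I] by (auto simp: atLeast0LessThan)
  have eI: "e i \<in> I" if "i < card I" for i using e that by (auto simp: bij_betw_def)
  have e_inj: "e i = e j \<longleftrightarrow> i = j" if "i < card I" "j < card I" for i j
    using e that by (auto simp: bij_betw_def inj_on_def)
  have Np: "0 < N (e i)" if "i < card I" for i using npos[OF eI[OF that]] by (simp add: N_def)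
  define b where "b i = (\<lambda>u\<in>F. A (e i) u / sqrt (N (e i)))" for i
  have reindex: "(\<Sum>i\<in>I. g i) = (\<Sum>i<card I. g (e i))" for g :: "'i \<Rightarrow> real"
    by (rule sum.reindex_bij_betw[OF e, symmetric])
  have onb: "is_onb F (Wlam d lam F) (card I) b"
    unfolding is_onb_def
  proof (intro conjI allI impI ballI)
    fix i assume i: "i < card I"
    let ?s = "1 / sqrt (N (e i))"
    have A: "restrict (A (e i)) F \<in> Wlam d lam F" using W[OF eI[OF i]] .
    show "b i \<in> Wlam d lam F"
      unfolding Wlam_def
    proof (intro CollectI conjI ballI impI)
      show "b i \<in> F \<rightarrow>\<^sub>E UNIV" by (auto simp: b_def)
      fix u assume u: "u \<in> F" "\<forall>w. tadj d u w \<longrightarrow> w \<in> F"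
      have "lam * A (e i) u = (\<Sum>w\<in>{w. tadj d u w}. restrict (A (e i)) F w)"
        using A u unfolding Wlam_def by auto
      then have "lam * b i u = (\<Sum>w\<in>{w. tadj d u w}. restrict (A (e i)) F w) / sqrt (N (e i))"
        using u by (simp add: b_def)
      also have "\<dots> = (\<Sum>w\<in>{w. tadj d u w}. b i w)"
        using u by (simp add: sum_divide_distrib) (intro sum.cong refl, auto simp: b_def)
      finally show "lam * b i u = (\<Sum>w\<in>{w. tadj d u w}. b i w)" .
    qed
    fix j assume j: "j < card I"
    have "(\<Sum>u\<in>F. b i u * b j u) = (\<Sum>u\<in>F. A (e i) u * A (e j) u) / (sqrt (N (e i)) * sqrt (N (e j)))"
      by (simp add: b_def sum_divide_distrib)
    also have "\<dots> = (if i = j then 1 else 0)"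
    proof (cases "i = j")
      case True
      then show ?thesis using Np[OF i] by (simp add: N_def power2_eq_square)
    next
      case False
      then show ?thesis using orth[OF eI[OF i] eI[OF j]] e_inj[OF i j] by simp
    qed
    finally show "(\<Sum>u\<in>F. b i u * b j u) = (if i = j then 1 else 0)" .
  next
    fix f assume f: "f \<in> Wlam d lam F"
    obtain c where c: "\<forall>u\<in>F. f u = (\<Sum>i\<in>I. c i * A i u)" using span[OF f] by blast
    have "f = (\<lambda>u\<in>F. \<Sum>i<card I. (c (e i) * sqrt (N (e i))) * b i u)"
    proof
      fix u
      show "f u = (\<lambda>u\<in>F. \<Sum>i<card I. (c (e i) * sqrt (N (e i))) * b i u) u"
      proof (cases "u \<in> F")
        case True
        have "f u = (\<Sum>i<card I. c (e i) * A (e i) u)" using c True by (simp add: reindex)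
        also have "\<dots> = (\<Sum>i<card I. (c (e i) * sqrt (N (e i))) * b i u)"
          using True by (intro sum.cong refl) (use Np in \<open>force simp: b_def\<close>)
        finally show ?thesis using True by simp
      next
        case False
        then show ?thesis using f by (auto simp: Wlam_def PiE_def extensional_def)
      qed
    qed
    then show "\<exists>c. f = (\<lambda>u\<in>F. \<Sum>i<card I. c i * b i u)" by fast
  qed
  have "Dsp d lam F M X = (\<Sum>i<card I. ln (2 * pi * exp 1 * (w (e i) * N (e i))) / 2)"
  proof (rule Dsp_eigenbasis[OF F onb])
    show "0 < w (e i) * N (e i)" if "i < card I" for i using Np[OF that] wpos[OF eI[OF that]] by simp
    fix u v assume uv: "u \<in> F" "v \<in> F"
    have "wcov d lam u v = (\<Sum>i<card I. w (e i) * A (e i) u * A (e i) v)"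
      by (simp add: cov[OF uv] reindex)
    also have "\<dots> = (\<Sum>i<card I. w (e i) * N (e i) * b i u * b i v)"
    proof (intro sum.cong refl)
      fix i assume "i \<in> {..<card I}"
      then have N: "0 < N (e i)" using Np by simp
      have "w (e i) * N (e i) * b i u * b i v = w (e i) * A (e i) u * A (e i) v * (N (e i) / (sqrt (N (e i)) * sqrt (N (e i))))"
        using uv by (simp add: b_def)
      then show "w (e i) * A (e i) u * A (e i) v = w (e i) * N (e i) * b i u * b i v"
        unfolding real_sqrt_mult_self using N by (metis abs_of_pos divide_self_if less_irrefl mult.right_neutral)
    qed
    finally show "wcov d lam u v = (\<Sum>i<card I. w (e i) * N (e i) * b i u * b i v)" .
  qed
  then show ?thesis by (simp add: reindex N_def)
qed

end

subsection \<open>Solutions of the radial recurrence\<close>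

text \<open>The eigenvalue equation at a vertex with one parent and \<open>d - 1\<close> children,
  for a function of the depth alone.\<close>

fun lrec :: "nat \<Rightarrow> real \<Rightarrow> real \<Rightarrow> real \<Rightarrow> nat \<Rightarrow> real" where
  "lrec d lam a b 0 = a"
| "lrec d lam a b (Suc 0) = b"
| "lrec d lam a b (Suc (Suc n)) = (lam * lrec d lam a b (Suc n) - lrec d lam a b n) / (real d - 1)"

lemma lrec_step:
  "d \<ge> 3 \<Longrightarrow> (real d - 1) * lrec d lam a b (Suc (Suc n)) = lam * lrec d lam a b (Suc n) - lrec d lam a b n"
  by simp

definition recsol :: "real \<Rightarrow> real \<Rightarrow> (nat \<Rightarrow> real) \<Rightarrow> bool" where
  "recsol q lam x \<longleftrightarrow> (\<forall>n. q * x (Suc (Suc n)) = lam * x (Suc n) - x n)"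

lemma recsol_lrec: "d \<ge> 3 \<Longrightarrow> recsol (real d - 1) lam (lrec d lam a b)"
  by (simp add: recsol_def)

lemma recsol_linear:
  "recsol q lam x \<Longrightarrow> recsol q lam (\<lambda>n. x (Suc n))"
  "recsol q lam x \<Longrightarrow> recsol q lam (\<lambda>n. x (k + n))"
  "recsol q lam x \<Longrightarrow> recsol q lam (\<lambda>n. x (n + k))"
  "recsol q lam x \<Longrightarrow> recsol q lam (\<lambda>n. c * x n)"
  "recsol q lam x \<Longrightarrow> recsol q lam (\<lambda>n. x n * c)"
  "recsol q lam x \<Longrightarrow> recsol q lam (\<lambda>n. x n / c)"
  "recsol q lam x \<Longrightarrow> recsol q lam y \<Longrightarrow> recsol q lam (\<lambda>n. x n + y n)"
  "recsol q lam x \<Longrightarrow> recsol q lam y \<Longrightarrow> recsol q lam (\<lambda>n. x n - y n)"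
proof -
  assume "recsol q lam x"
  then show "recsol q lam (\<lambda>n. x (Suc n))" "recsol q lam (\<lambda>n. x (k + n))" "recsol q lam (\<lambda>n. x (n + k))"
    by (simp_all add: recsol_def)
next
  assume x: "recsol q lam x"
  have 1: "q * (c * x (Suc (Suc n))) = lam * (c * x (Suc n)) - c * x n" for c n
    using x[unfolded recsol_def, rule_format, of n] by (simp only: mult.left_commute[of _ c] right_diff_distrib[symmetric])
  then show 2: "recsol q lam (\<lambda>n. c * x n)" for c by (simp add: recsol_def)
  from 2[of c] show "recsol q lam (\<lambda>n. x n * c)" by (simp add: mult.commute)
  from 2[of "1 / c"] show "recsol q lam (\<lambda>n. x n / c)" by simp
next
  assume "recsol q lam x" "recsol q lam y"
  then show "recsol q lam (\<lambda>n. x n + y n)" "recsol q lam (\<lambda>n. x n - y n)"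
    by (simp_all add: recsol_def ring_distribs)
qed

lemma recsol_unique:
  assumes q: "q \<noteq> 0" and x: "recsol q lam x" and y: "recsol q lam y" and "x 0 = y 0" "x 1 = y 1"
  shows "x n = y n"
proof -
  have "x n = y n \<and> x (Suc n) = y (Suc n)"
  proof (induction n)
    case (Suc n)
    then have "q * x (Suc (Suc n)) = q * y (Suc (Suc n))"
      using x y by (simp add: recsol_def)
    then show ?case using Suc q by simp
  qed (use assms in simp)
  then show ?thesis by blast
qed

text \<open>Reduces an identity in two variables to four values. The addition formulas below are
  proved in this way.\<close>

lemma recsol_unique2:
  assumes q: "q \<noteq> 0"
    and g: "\<And>j. recsol q lam (\<lambda>i. g i j)" "\<And>i. recsol q lam (g i)"
    and h: "\<And>j. recsol q lam (\<lambda>i. h i j)" "\<And>i. recsol q lam (h i)"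
    and init: "g 0 0 = h 0 0" "g 0 1 = h 0 1" "g 1 0 = h 1 0" "g 1 1 = h 1 1"
  shows "g i j = h i j"
proof (rule recsol_unique[OF q g(2) h(2)])
  show "g i 0 = h i 0" by (rule recsol_unique[OF q g(1)[of 0] h(1)[of 0]]) (use init in auto)
  show "g i 1 = h i 1" by (rule recsol_unique[OF q g(1)[of 1] h(1)[of 1]]) (use init in auto)
qed

text \<open>The branch profile: the value, \<open>j\<close> steps down a branch, of the eigenfunction that vanishes at
  the branching vertex and equals \<open>1\<close> at its child.\<close>
abbreviation brp :: "nat \<Rightarrow> real \<Rightarrow> nat \<Rightarrow> real" where
  "brp d lam \<equiv> lrec d lam 0 1"

text \<open>The spherical function: the radial eigenfunction around the root with value 1 there. The
  next value is \<open>lam / d\<close> because all \<open>d\<close> neighbours of the root are its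
  children.\<close>

abbreviation sph :: "nat \<Rightarrow> real \<Rightarrow> nat \<Rightarrow> real" where
  "sph d lam \<equiv> lrec d lam 1 (lam / real d)"

text \<open>Radial profiles around an edge, symmetric for \<open>s = 1\<close> and antisymmetric for \<open>s = -1\<close>.\<close>
abbreviation edp :: "nat \<Rightarrow> real \<Rightarrow> real \<Rightarrow> nat \<Rightarrow> real" where
  "edp d lam s \<equiv> lrec d lam 1 ((lam - s) / (real d - 1))"

text \<open>This is \<open>1 - sph d lam 2\<close>, variance minus covariance of two siblings, hence
  the variance of a zero-sum combination of siblings with unit norm.\<close>

definition innov_var :: "nat \<Rightarrow> real \<Rightarrow> real" where
  "innov_var d lam = ((real d)\<^sup>2 - lam\<^sup>2) / (real d * (real d - 1))"

text \<open>The quadratic form \<open>a^2 + b^2 - 2 x a b\<close> in consecutive values is conserved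
  by the recurrence. It bounds them from below and, for \<open>\<bar>x\<bar> < 1\<close>, from
  above.\<close>

lemma chebU_invariant:
  "(chebU (Suc n) x)\<^sup>2 + (chebU n x)\<^sup>2 - 2 * x * chebU (Suc n) x * chebU n x = 1"
proof (induction n)
  case (Suc n)
  then show ?case by (simp add: power2_eq_square algebra_simps)
qed simp

lemma chebU_one: "chebU n 1 = real n"
  by (induction n rule: induct_nat_012) auto

lemma chebU_minus: "chebU n (- x) = (- 1) ^ Suc n * chebU n x"
  by (induction n rule: induct_nat_012) (auto simp: algebra_simps)

section \<open>Addition formulas for the spherical functions\<close>

context
  fixes d :: nat and lam :: real
  assumes d3: "d \<ge> 3" and lam: "\<bar>lam\<bar> \<le> 2 * sqrt (real d - 1)"
begin

text \<open>Amounts to \<open>(d - 2)^2 > 0\<close>. It makes \<open>innov_var\<close> and both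
  weights of an edge positive.\<close>

lemma lam_sq_less: "lam\<^sup>2 < (real d)\<^sup>2" and abs_lam_less: "\<bar>lam\<bar> < real d"
proof -
  have "lam\<^sup>2 \<le> (2 * sqrt (real d - 1))\<^sup>2"
    using lam by (metis abs_ge_zero power2_abs power_mono)
  also have "\<dots> = 4 * (real d - 1)" using d3 by (simp add: power_mult_distrib)
  also have "\<dots> < (real d)\<^sup>2"
  proof -
    have "0 < (real d - 2)\<^sup>2" using d3 by simp
    then show ?thesis by (simp add: power2_eq_square algebra_simps)
  qed
  finally show *: "lam\<^sup>2 < (real d)\<^sup>2" .
  then show "\<bar>lam\<bar> < real d" using power2_less_imp_less[of "\<bar>lam\<bar>" "real d"] by simp
qed

lemma innov_var_pos: "0 < innov_var d lam"
  using lam_sq_less d3 by (simp add: innov_var_def)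

text \<open>Turns the denominators \<open>real d - 1\<close> into a positive variable, so that
  initial values can be compared as polynomials.\<close>

lemma deg: obtains q where "real d = q + 1" "2 \<le> q"
  using that[of "real d - 1"] d3 by simp

text \<open>One step of the telescoping: the change of covariance when two paths separate one level
  lower.\<close>

lemma sph_diff: "sph d lam k - sph d lam (Suc (Suc k)) = innov_var d lam * brp d lam (Suc k)"
  (is "?g k = ?h k")
proof (rule recsol_unique[where q = "real d - 1" and lam = lam and x = ?g and y = ?h and n = k])
  obtain q where q: "real d = q + 1" "2 \<le> q" by (rule deg)
  show "real d - 1 \<noteq> 0" using d3 by simp
  show "sph d lam 0 - sph d lam (Suc (Suc 0)) = innov_var d lam * brp d lam (Suc 0)"
    "sph d lam 1 - sph d lam (Suc (Suc 1)) = innov_var d lam * brp d lam (Suc 1)"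
    using q(2) by (simp_all add: q(1) innov_var_def divide_simps power2_eq_square) (simp_all add: algebra_simps)
qed (intro recsol_linear recsol_lrec d3)+

text \<open>Splits the increment of a telescoping step into a product at the old level of separation
  and one at the next level.\<close>

lemma brp_add: "brp d lam (Suc (i + j)) = brp d lam (Suc i) * brp d lam (Suc j) - brp d lam i * brp d lam j / (real d - 1)"
  (is "_ = ?h i j")
proof (rule recsol_unique2[where q = "real d - 1" and lam = lam and h = ?h and i = i and j = j and g = "\<lambda>i j. brp d lam (Suc (i + j))"])
  obtain q where q: "real d = q + 1" "2 \<le> q" by (rule deg)
  show "real d - 1 \<noteq> 0" using d3 by simp
  show "brp d lam (Suc (0 + 0)) = brp d lam (Suc 0) * brp d lam (Suc 0) - brp d lam 0 * brp d lam 0 / (real d - 1)"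
    "brp d lam (Suc (0 + 1)) = brp d lam (Suc 0) * brp d lam (Suc 1) - brp d lam 0 * brp d lam 1 / (real d - 1)"
    "brp d lam (Suc (1 + 0)) = brp d lam (Suc 1) * brp d lam (Suc 0) - brp d lam 1 * brp d lam 0 / (real d - 1)"
    by simp_all
  show "brp d lam (Suc (1 + 1)) = brp d lam (Suc 1) * brp d lam (Suc 1) - brp d lam 1 * brp d lam 1 / (real d - 1)"
    using q(2) by (simp add: q(1) divide_simps)
qed (intro recsol_linear recsol_lrec d3)+

text \<open>Start of the telescoping at the root: vertices in different branches are correlated
  through the top vector and through the zero-sum projection on \<open>d\<close> children, whose
  off-diagonal entries are \<open>- 1 / d\<close>.\<close>

lemma sph_add: "sph d lam (i + j) = sph d lam i * sph d lam j - innov_var d lam / real d * (brp d lam i * brp d lam j)"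
  (is "_ = ?h i j")
proof (rule recsol_unique2[where q = "real d - 1" and lam = lam and h = ?h and i = i and j = j and g = "\<lambda>i j. sph d lam (i + j)"])
  obtain q where q: "real d = q + 1" "2 \<le> q" by (rule deg)
  show "real d - 1 \<noteq> 0" using d3 by simp
  show "sph d lam (0 + 0) = sph d lam 0 * sph d lam 0 - innov_var d lam / real d * (brp d lam 0 * brp d lam 0)"
    "sph d lam (0 + 1) = sph d lam 0 * sph d lam 1 - innov_var d lam / real d * (brp d lam 0 * brp d lam 1)"
    "sph d lam (1 + 0) = sph d lam 1 * sph d lam 0 - innov_var d lam / real d * (brp d lam 1 * brp d lam 0)"
    by simp_all
  show "sph d lam (1 + 1) = sph d lam 1 * sph d lam 1 - innov_var d lam / real d * (brp d lam 1 * brp d lam 1)"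
    using q(2) by (simp add: q(1) innov_var_def divide_simps power2_eq_square) (simp add: algebra_simps)
qed (intro recsol_linear recsol_lrec d3)+

text \<open>The same on one side of an edge, whose ends have \<open>d - 1\<close> children. The
  covariance matrix of the two ends has eigenvalues \<open>1 + lam / d\<close> and
  \<open>1 - lam / d\<close>; the halves normalise the vectors \<open>(1, 1)\<close> and
  \<open>(1, -1)\<close>.\<close>

lemma edp_add:
  "sph d lam (i + j) = (1 + lam / d) / 2 * edp d lam 1 i * edp d lam 1 j
     + (1 - lam / d) / 2 * edp d lam (-1) i * edp d lam (-1) j
     - innov_var d lam / (real d - 1) * (brp d lam i * brp d lam j)"
  (is "_ = ?h i j")
proof (rule recsol_unique2[where q = "real d - 1" and lam = lam and h = ?h and i = i and j = j and g = "\<lambda>i j. sph d lam (i + j)"])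
  obtain q where q: "real d = q + 1" "2 \<le> q" by (rule deg)
  show "real d - 1 \<noteq> 0" using d3 by simp
  show "sph d lam (0 + 0) = ?h 0 0" "sph d lam (0 + 1) = ?h 0 1" "sph d lam (1 + 0) = ?h 1 0" "sph d lam (1 + 1) = ?h 1 1"
    using q(2) by (simp_all add: q(1) innov_var_def divide_simps power2_eq_square) (simp_all add: algebra_simps)
qed (intro recsol_linear recsol_lrec d3)+

text \<open>Without correction term, because no zero-sum vector has support on both sides of the
  edge.\<close>

lemma edp_across:
  "sph d lam (Suc (i + j)) = (1 + lam / d) / 2 * edp d lam 1 i * edp d lam 1 j
     - (1 - lam / d) / 2 * edp d lam (-1) i * edp d lam (-1) j"
  (is "_ = ?h i j")
proof (rule recsol_unique2[where q = "real d - 1" and lam = lam and h = ?h and i = i and j = j and g = "\<lambda>i j. sph d lam (Suc (i + j))"])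
  obtain q where q: "real d = q + 1" "2 \<le> q" by (rule deg)
  show "real d - 1 \<noteq> 0" using d3 by simp
  show "sph d lam (Suc (0 + 0)) = ?h 0 0" "sph d lam (Suc (0 + 1)) = ?h 0 1" "sph d lam (Suc (1 + 0)) = ?h 1 0" "sph d lam (Suc (1 + 1)) = ?h 1 1"
    using q(2) by (simp_all add: q(1) divide_simps power2_eq_square) (simp_all add: algebra_simps)
qed (intro recsol_linear recsol_lrec d3)+

text \<open>Covariance of two vertices at depths \<open>i\<close> and \<open>j\<close> whose paths from the top separate at depth \<open>m\<close>:
  \<open>c l\<close> is the number of children at depth \<open>l\<close>, and passing from \<open>m\<close> to \<open>m + 1\<close> telescopes.\<close>
lemma sph_telescope:
  assumes top: "\<And>i j. sph d lam (i + j) = B i j - innov_var d lam / c 0 * (brp d lam i * brp d lam j)"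
    and c: "\<And>l. 0 < l \<Longrightarrow> c l = real d - 1"
    and m: "m \<le> i" "m \<le> j"
  shows "sph d lam (i + j - 2 * m) = B i j
     + (\<Sum>l<m. innov_var d lam * (1 - 1 / c l) * (brp d lam (i - l) * brp d lam (j - l)))
     - innov_var d lam / c m * (brp d lam (i - m) * brp d lam (j - m))"
  using m
proof (induction m)
  case 0
  then show ?case using top by simp
next
  case (Suc m)
  obtain i' j' where ij: "i = Suc m + i'" "j = Suc m + j'"
    using Suc.prems le_iff_add by metis
  have e: "i + j - 2 * m = Suc (Suc (i' + j'))" "i + j - 2 * Suc m = i' + j'"
    "i - m = Suc i'" "j - m = Suc j'" "i - Suc m = i'" "j - Suc m = j'" using ij by auto
  have "sph d lam (i' + j') = sph d lam (Suc (Suc (i' + j'))) + innov_var d lam * brp d lam (Suc (i' + j'))"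
    using sph_diff[of "i' + j'"] by linarith
  also have "brp d lam (Suc (i' + j')) = brp d lam (Suc i') * brp d lam (Suc j') - brp d lam i' * brp d lam j' / (real d - 1)"
    by (rule brp_add)
  finally have step: "sph d lam (i' + j') = sph d lam (Suc (Suc (i' + j')))
     + innov_var d lam * (brp d lam (Suc i') * brp d lam (Suc j') - brp d lam i' * brp d lam j' / (real d - 1))" .
  \<comment> \<open>The increment \<open>Y\<close> turns the off-diagonal entry
    \<open>- 1 / k\<close> of the old level into the diagonal entry \<open>1 - 1 / k\<close>, and
    \<open>- Z / q\<close> is the off-diagonal term of the new level.\<close>
  have alg: "A + v * (Y - Z / q) = B0 + (S + v * (1 - 1 / k) * Y) - v / q * Z"
    if "A = B0 + S - v / k * Y" for A B0 S Y Z v q k :: real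
    using that by (simp add: algebra_simps)
  have "sph d lam (Suc (Suc (i' + j'))) = B i j
     + (\<Sum>l<m. innov_var d lam * (1 - 1 / c l) * (brp d lam (i - l) * brp d lam (j - l)))
     - innov_var d lam / c m * (brp d lam (Suc i') * brp d lam (Suc j'))"
    using Suc.IH Suc.prems unfolding e by simp
  from alg[OF this] show ?case
    unfolding e sum.lessThan_Suc step c[OF zero_less_Suc] .
qed

subsection \<open>Chebyshev form and asymptotics\<close>

definition xpar :: real where "xpar = lam / (2 * sqrt (real d - 1))"

lemma xpar: "\<bar>xpar\<bar> \<le> 1" "2 * xpar * sqrt (real d - 1) = lam"
  using lam d3 by (simp_all add: xpar_def abs_mult)

lemma lam_sqrt: "lam * sqrt (real d - 1) = 2 * xpar * (real d - 1)"
proof -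
  have "lam * sqrt (real d - 1) = (2 * xpar * sqrt (real d - 1)) * sqrt (real d - 1)"
    by (simp only: xpar(2))
  also have "\<dots> = 2 * xpar * (real d - 1)" using d3 by (simp add: mult.assoc)
  finally show ?thesis .
qed

text \<open>The factor \<open>sqrt (d - 1) ^ n\<close> turns the recurrence into the Chebyshev one.
  The value \<open>- 1\<close> at \<open>n = 0\<close> is the polynomial of index -2, which the
  truncated \<open>n - 1\<close> would miss.\<close>

lemma lrec_chebU:
  "lrec d lam a b n * sqrt (real d - 1) ^ n =
     b * sqrt (real d - 1) * chebU n xpar - a * (if n = 0 then - 1 else chebU (n - 1) xpar)"
proof (induction n rule: induct_nat_012)
  case (ge2 n)
  let ?s = "sqrt (real d - 1)" and ?A = "lrec d lam a b (Suc n)" and ?B = "lrec d lam a b n"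
  have "lrec d lam a b (Suc (Suc n)) * ?s ^ Suc (Suc n) = (lam * ?A - ?B) / (real d - 1) * ((real d - 1) * ?s ^ n)"
    using d3 by (simp add: mult.assoc[symmetric])
  also have "\<dots> = (lam * ?A - ?B) * ?s ^ n" using d3 by simp
  also have "\<dots> = ((2 * xpar * ?s) * ?A - ?B) * ?s ^ n" by (simp only: xpar(2))
  also have "\<dots> = 2 * xpar * (?A * ?s ^ Suc n) - ?B * ?s ^ n" by (simp add: algebra_simps)
  finally show ?case unfolding ge2 by (cases n) (auto simp: algebra_simps)
qed auto

lemma brp_chebU: "brp d lam (Suc n) * sqrt (real d - 1) ^ n = chebU (Suc n) xpar"
  using lrec_chebU[of 0 1 "Suc n"] d3 by (simp del: lrec.simps chebU.simps add: algebra_simps)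

lemma edp_chebU:
  "edp d lam s n * sqrt (real d - 1) ^ n = chebU (Suc n) xpar - s / sqrt (real d - 1) * chebU n xpar"
proof -
  let ?s = "sqrt (real d - 1)"
  have q: "real d - 1 = ?s * ?s" "?s \<noteq> 0" using d3 by auto
  have "(lam - s) / (real d - 1) * ?s = 2 * xpar - s / ?s"
  proof -
    have "(lam - s) / (real d - 1) * ?s = (lam * ?s - s * ?s) / (real d - 1)" by (simp add: algebra_simps)
    also have "\<dots> = 2 * xpar - s * ?s / (?s * ?s)"
      unfolding lam_sqrt using d3 by (simp add: diff_divide_distrib)
    also have "\<dots> = 2 * xpar - s / ?s" using q(2) by (simp del: real_sqrt_mult_self)
    finally show ?thesis .
  qed
  note e = this
  show ?thesis
    unfolding lrec_chebU e by (cases n) (auto simp: algebra_simps)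
qed

lemma sph_chebU:
  "real d * sph d lam (Suc n) * sqrt (real d - 1) ^ Suc n
    = 2 * xpar * (real d - 1) * chebU (Suc n) xpar - real d * chebU n xpar"
proof -
  let ?s = "sqrt (real d - 1)"
  note lam_sqrt
  moreover have "real d * (sph d lam (Suc n) * ?s ^ Suc n) = lam * ?s * chebU (Suc n) xpar - real d * chebU n xpar"
    unfolding lrec_chebU using d3 by (simp add: right_diff_distrib del: chebU.simps)
  ultimately show ?thesis by (simp only: mult.assoc)
qed

text \<open>Scaled by \<open>d * sqrt (d - 1) ^ k\<close>, both sides become
  \<open>(d - 1) U_k - U_{k-2}\<close> for positive \<open>k\<close>.\<close>

lemma wavecov_eq_sph: "wavecov d k (lam / (2 * sqrt (real d - 1))) = sph d lam k"
proof (cases k)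
  case (Suc n)
  let ?s = "sqrt (real d - 1)" and ?d = "sqrt (real d)"
  have q: "real d - 1 = ?s * ?s" "?s \<noteq> 0" "?s > 0" using d3 by auto
  have dd: "real d = ?d * ?d" "?d \<noteq> 0" using d3 by auto
  have "wavecov d k (lam / (2 * sqrt (real d - 1))) =
     1 / (?d * ?s ^ n) * (?s / ?d * chebU (Suc (Suc n)) xpar - 1 / (?d * ?s) * chebU n xpar)"
    by (simp add: wavecov_def Suc xpar_def real_sqrt_mult real_sqrt_divide real_sqrt_power del: chebU.simps)
  also have "\<dots> * (?d * ?d * ?s ^ Suc n) = ?s * ?s * chebU (Suc (Suc n)) xpar - chebU n xpar"
    using q(2) dd(2) by (simp add: field_simps del: chebU.simps real_sqrt_mult_self)
  finally have "wavecov d k (lam / (2 * sqrt (real d - 1))) * (real d * ?s ^ Suc n)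
     = (real d - 1) * chebU (Suc (Suc n)) xpar - chebU n xpar"
    using q(1) dd(1) by simp
  also have "\<dots> = sph d lam (Suc n) * (real d * ?s ^ Suc n)"
    using sph_chebU[of n] by (simp add: algebra_simps)
  finally show ?thesis using q dd d3 by (simp add: Suc del: lrec.simps)
qed (simp add: wavecov_def)

text \<open>The squared norm of one branch with \<open>n\<close> levels: the
  \<open>(d - 1) ^ j\<close> vertices at its level \<open>j\<close> exactly offset the decay of the
  profile and contribute \<open>U_j^2\<close>.\<close>

definition chebS :: "nat \<Rightarrow> real" where "chebS n = (\<Sum>j<n. (chebU (Suc j) xpar)\<^sup>2)"

text \<open>For \<open>\<bar>x\<bar> \<le> 1\<close> the conserved form is at most twice the sum of
  both squares, so two consecutive squares sum to at least 1/2.\<close>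

lemma chebS_at_top: "filterlim chebS at_top sequentially"
proof -
  let ?U = "\<lambda>n. chebU n xpar"
  have pair: "1 / 2 \<le> (?U (Suc n))\<^sup>2 + (?U n)\<^sup>2" for n
  proof -
    have "- (2 * xpar * ?U (Suc n) * ?U n) \<le> \<bar>xpar\<bar> * (2 * \<bar>?U (Suc n)\<bar> * \<bar>?U n\<bar>)"
      by (rule order_trans[OF abs_ge_minus_self]) (simp add: abs_mult del: chebU.simps)
    also have "\<dots> \<le> 1 * (2 * \<bar>?U (Suc n)\<bar> * \<bar>?U n\<bar>)"
      using xpar(1) by (intro mult_right_mono) auto
    also have "\<dots> \<le> (?U (Suc n))\<^sup>2 + (?U n)\<^sup>2"
      using sum_squares_bound[of "\<bar>?U (Suc n)\<bar>" "\<bar>?U n\<bar>"] by simp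
    finally show ?thesis using chebU_invariant[of n xpar] by linarith
  qed
  have S: "real n / 4 \<le> chebS n" for n
  proof -
    have "(\<Sum>j<n. 1 / 2) \<le> (\<Sum>j<n. (?U (Suc j))\<^sup>2 + (?U j)\<^sup>2)"
      by (intro sum_mono pair)
    also have "\<dots> = chebS n + (\<Sum>j<n. (?U j)\<^sup>2)" by (simp add: chebS_def sum.distrib)
    also have "(\<Sum>j<n. (?U j)\<^sup>2) \<le> chebS n"
    proof (cases n)
      case (Suc m)
      have "(\<Sum>j<n. (?U j)\<^sup>2) = (\<Sum>j<m. (?U (Suc j))\<^sup>2)"
        unfolding Suc by (subst sum.lessThan_Suc_shift) simp
      then show ?thesis by (simp add: chebS_def Suc)
    qed (simp add: chebS_def)
    finally show ?thesis by simp
  qed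
  have "filterlim (\<lambda>n. real n / 4) at_top sequentially" by real_asymp
  then show ?thesis by (rule filterlim_at_top_mono) (intro always_eventually allI S)
qed

text \<open>Two regimes: at \<open>\<bar>x\<bar> = 1\<close> the squares grow quadratically and
  their sum cubically; otherwise the conserved form bounds the squares while the sum
  diverges.\<close>

lemma chebU_sq_negligible: "(\<lambda>n. (chebU (Suc n) xpar)\<^sup>2 / chebS n) \<longlonglongrightarrow> 0"
proof (cases "\<bar>xpar\<bar> = 1")
  case True
  then consider "xpar = 1" | "xpar = - 1" by linarith
  then have sq: "(chebU n xpar)\<^sup>2 = (real n)\<^sup>2" for n
  proof cases
    case 2
    then show ?thesis using chebU_minus[of n 1] by (simp add: chebU_one power2_eq_square)
  qed (simp add: chebU_one)
  have "chebS n = real n * (real n + 1) * (2 * real n + 1) / 6" for n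
    unfolding chebS_def sq by (induction n) (auto simp: field_simps power2_eq_square)
  then have "(\<lambda>n. (chebU (Suc n) xpar)\<^sup>2 / chebS n)
     = (\<lambda>n. (real n + 1)\<^sup>2 / (real n * (real n + 1) * (2 * real n + 1) / 6))"
    by (intro ext) (simp only: sq of_nat_Suc add.commute[of 1])
  moreover have "\<dots> \<longlonglongrightarrow> 0" by real_asymp
  ultimately show ?thesis by simp
next
  case False
  then have x: "\<bar>xpar\<bar> < 1" using xpar(1) by simp
  have bnd: "(chebU (Suc n) xpar)\<^sup>2 \<le> 1 / (1 - \<bar>xpar\<bar>)" for n
  proof -
    let ?a = "chebU (Suc n) xpar" and ?b = "chebU n xpar"
    have "2 * xpar * ?a * ?b \<le> \<bar>xpar\<bar> * (2 * \<bar>?a\<bar> * \<bar>?b\<bar>)"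
      by (rule order_trans[OF abs_ge_self]) (simp add: abs_mult del: chebU.simps)
    also have "\<dots> \<le> \<bar>xpar\<bar> * (?a\<^sup>2 + ?b\<^sup>2)"
      using sum_squares_bound[of "\<bar>?a\<bar>" "\<bar>?b\<bar>"] by (intro mult_left_mono) auto
    finally have "(1 - \<bar>xpar\<bar>) * (?a\<^sup>2 + ?b\<^sup>2) \<le> 1"
      using chebU_invariant[of n xpar] unfolding left_diff_distrib[of 1] by (simp only: mult_1)
    moreover have "(1 - \<bar>xpar\<bar>) * ?a\<^sup>2 \<le> (1 - \<bar>xpar\<bar>) * (?a\<^sup>2 + ?b\<^sup>2)"
      using x by (intro mult_left_mono) auto
    ultimately show ?thesis using x by (simp add: field_simps)
  qed
  have lim: "((\<lambda>n. 1 / (1 - \<bar>xpar\<bar>) / chebS n) \<longlongrightarrow> 0) sequentially"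
    by (rule tendsto_divide_0[OF tendsto_const])
      (use chebS_at_top filterlim_at_top_imp_at_infinity in blast)
  have s0: "0 \<le> chebS n" for n by (simp add: chebS_def sum_nonneg)
  show ?thesis
  proof (rule tendsto_sandwich[OF _ _ tendsto_const lim])
    show "\<forall>\<^sub>F n in sequentially. 0 \<le> (chebU (Suc n) xpar)\<^sup>2 / chebS n"
      by (intro always_eventually allI divide_nonneg_nonneg s0) simp
    show "\<forall>\<^sub>F n in sequentially. (chebU (Suc n) xpar)\<^sup>2 / chebS n \<le> 1 / (1 - \<bar>xpar\<bar>) / chebS n"
      by (intro always_eventually allI divide_right_mono bnd s0)
  qed
qed

lemma chebS_pos: "0 < n \<Longrightarrow> 0 < chebS n"
  unfolding chebS_def by (rule sum_pos2[of _ 0]) auto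

text \<open>Summing the recurrence \<open>2 x U\<^sub>j = U\<^sub>j\<^sub>+\<^sub>1 + U\<^sub>j\<^sub>-\<^sub>1\<close> against \<open>U\<^sub>j\<close>
  expresses the mixed sum through the sum of squares, up to a negligible boundary term.\<close>
lemma quadratic_sum_asymp:
  "(\<lambda>n. (\<Sum>j<n. (\<alpha> * chebU (Suc j) xpar + \<beta> * chebU j xpar)\<^sup>2) / chebS n)
     \<longlonglongrightarrow> \<alpha>\<^sup>2 + \<beta>\<^sup>2 + 2 * \<alpha> * \<beta> * xpar"
proof -
  let ?U = "\<lambda>n. chebU n xpar"
  have sh: "(\<Sum>j<n. (?U j)\<^sup>2) = chebS n - (?U n)\<^sup>2" for n
  proof -
    have "(\<Sum>j<Suc n. (?U j)\<^sup>2) = (\<Sum>j<n. (?U (Suc j))\<^sup>2)"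
      by (subst sum.lessThan_Suc_shift) simp
    then show ?thesis by (simp add: chebS_def)
  qed
  have mix: "2 * (\<Sum>j<n. ?U (Suc j) * ?U j) = 2 * xpar * chebS n - ?U (Suc n) * ?U n" for n
    by (induction n) (auto simp: chebS_def power2_eq_square algebra_simps)
  have eq: "(\<Sum>j<n. (\<alpha> * ?U (Suc j) + \<beta> * ?U j)\<^sup>2)
     = (\<alpha>\<^sup>2 + \<beta>\<^sup>2 + 2 * \<alpha> * \<beta> * xpar) * chebS n - \<beta>\<^sup>2 * (?U n)\<^sup>2 - \<alpha> * \<beta> * (?U (Suc n) * ?U n)" for n
  proof -
    have "(\<Sum>j<n. (\<alpha> * ?U (Suc j) + \<beta> * ?U j)\<^sup>2)
      = \<alpha>\<^sup>2 * chebS n + \<beta>\<^sup>2 * (\<Sum>j<n. (?U j)\<^sup>2) + \<alpha> * \<beta> * (2 * (\<Sum>j<n. ?U (Suc j) * ?U j))"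
      unfolding chebS_def sum_distrib_left sum.distrib[symmetric]
      by (intro sum.cong refl) (simp add: power2_eq_square algebra_simps)
    then show ?thesis unfolding sh mix by (simp add: algebra_simps del: chebU.simps)
  qed
  have a: "(\<lambda>n. (?U (Suc n))\<^sup>2 / chebS n) \<longlonglongrightarrow> 0" by (rule chebU_sq_negligible)
  have b: "(\<lambda>n. (?U n)\<^sup>2 / chebS n) \<longlonglongrightarrow> 0"
  proof -
    have "(\<lambda>n. (?U (Suc n))\<^sup>2 / chebS (Suc n)) \<longlonglongrightarrow> 0"
    proof (rule tendsto_sandwich[OF _ _ tendsto_const a])
      show "\<forall>\<^sub>F n in sequentially. 0 \<le> (?U (Suc n))\<^sup>2 / chebS (Suc n)"
        by (simp add: chebS_def sum_nonneg del: chebU.simps)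
      show "\<forall>\<^sub>F n in sequentially. (?U (Suc n))\<^sup>2 / chebS (Suc n) \<le> (?U (Suc n))\<^sup>2 / chebS n"
        using eventually_gt_at_top[of 0]
      proof eventually_elim
        case (elim n)
        have "chebS n \<le> chebS (Suc n)" by (simp add: chebS_def)
        then show ?case using chebS_pos[OF elim] by (intro divide_left_mono) (auto intro: mult_pos_pos)
      qed
    qed
    then show ?thesis by (rule LIMSEQ_imp_Suc)
  qed
  have c: "(\<lambda>n. ?U (Suc n) * ?U n / chebS n) \<longlonglongrightarrow> 0"
  proof (rule tendsto_rabs_zero_cancel, rule tendsto_sandwich[OF _ _ tendsto_const])
    show "(\<lambda>n. (?U (Suc n))\<^sup>2 / chebS n + (?U n)\<^sup>2 / chebS n) \<longlonglongrightarrow> 0"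
      using tendsto_add[OF a b] by simp
    have "\<bar>?U (Suc n) * ?U n\<bar> \<le> (?U (Suc n))\<^sup>2 + (?U n)\<^sup>2" for n
      using sum_squares_bound[of "\<bar>?U (Suc n)\<bar>" "\<bar>?U n\<bar>"]
        mult_nonneg_nonneg[of "\<bar>?U (Suc n)\<bar>" "\<bar>?U n\<bar>"]
      unfolding abs_mult power2_abs by linarith
    moreover have "0 \<le> chebS n" for n by (simp add: chebS_def sum_nonneg)
    ultimately show "\<forall>\<^sub>F n in sequentially. \<bar>?U (Suc n) * ?U n / chebS n\<bar> \<le> (?U (Suc n))\<^sup>2 / chebS n + (?U n)\<^sup>2 / chebS n"
      by (auto simp: abs_divide add_divide_distrib[symmetric] intro!: always_eventually divide_right_mono simp del: chebU.simps)
  qed simp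
  have "(\<lambda>n. (\<alpha>\<^sup>2 + \<beta>\<^sup>2 + 2 * \<alpha> * \<beta> * xpar) - \<beta>\<^sup>2 * ((?U n)\<^sup>2 / chebS n) - \<alpha> * \<beta> * (?U (Suc n) * ?U n / chebS n))
     \<longlonglongrightarrow> (\<alpha>\<^sup>2 + \<beta>\<^sup>2 + 2 * \<alpha> * \<beta> * xpar) - \<beta>\<^sup>2 * 0 - \<alpha> * \<beta> * 0"
    by (intro tendsto_intros b c)
  then have "(\<lambda>n. (\<alpha>\<^sup>2 + \<beta>\<^sup>2 + 2 * \<alpha> * \<beta> * xpar) - \<beta>\<^sup>2 * ((?U n)\<^sup>2 / chebS n) - \<alpha> * \<beta> * (?U (Suc n) * ?U n / chebS n))
     \<longlonglongrightarrow> \<alpha>\<^sup>2 + \<beta>\<^sup>2 + 2 * \<alpha> * \<beta> * xpar" by simp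
  then show ?thesis
  proof (rule Lim_transform_eventually)
    show "\<forall>\<^sub>F n in sequentially. (\<alpha>\<^sup>2 + \<beta>\<^sup>2 + 2 * \<alpha> * \<beta> * xpar) - \<beta>\<^sup>2 * ((?U n)\<^sup>2 / chebS n) - \<alpha> * \<beta> * (?U (Suc n) * ?U n / chebS n)
      = (\<Sum>j<n. (\<alpha> * chebU (Suc j) xpar + \<beta> * chebU j xpar)\<^sup>2) / chebS n"
      using eventually_gt_at_top[of 0]
    proof eventually_elim
      case (elim n)
      then show ?case unfolding eq using chebS_pos[OF elim] by (simp add: diff_divide_distrib del: chebU.simps)
    qed
  qed
qed

end

subsection \<open>Vertices seen from the root or from an edge\<close>

text \<open>The flag \<open>E\<close> selects the top: the root if \<open>E\<close> is false, the edge \<open>{[], [0]}\<close> if it is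
  true. In the latter case the root and \<open>[0]\<close> are not children of each other, so the children of the
  root start at index \<open>1\<close>.\<close>

definition dep :: "bool \<Rightarrow> nat list \<Rightarrow> nat" where
  "dep E v = (if E \<and> v \<noteq> [] \<and> hd v = 0 then length v - 1 else length v)"

text \<open>The bound is strict: \<open>tvs d E (Suc n)\<close> is the ball of radius
  \<open>n\<close> around the top, and \<open>tvs d E n\<close> consists of its vertices with all
  neighbours inside.\<close>

definition tvs :: "nat \<Rightarrow> bool \<Rightarrow> nat \<Rightarrow> nat list set" where
  "tvs d E N = {v. tvert d v \<and> dep E v < N}"

definition klo :: "bool \<Rightarrow> nat list \<Rightarrow> nat" where "klo E u = (if E \<and> u = [] then 1 else 0)"

definition nk :: "nat \<Rightarrow> bool \<Rightarrow> nat list \<Rightarrow> nat" where "nk d E u = (if u = [] \<and> \<not> E then d else d - 1)"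

definition kids :: "nat \<Rightarrow> bool \<Rightarrow> nat list \<Rightarrow> nat set" where
  "kids d E u = {klo E u..<klo E u + nk d E u}"

definition words :: "nat \<Rightarrow> nat \<Rightarrow> nat list set" where
  "words q N = {ys. set ys \<subseteq> {..<q} \<and> length ys < N}"

text \<open>The part of the ball strictly below \<open>u\<close>, where
  \<open>N - 1 - dep E u\<close> levels remain. With \<open>E\<close>, the side of
  \<open>[0]\<close> does not count as below the root.\<close>

definition branch :: "nat \<Rightarrow> bool \<Rightarrow> nat \<Rightarrow> nat list \<Rightarrow> nat list set" where
  "branch d E N u = (\<lambda>(a, ys). u @ a # ys) ` (kids d E u \<times> words (d - 1) (N - 1 - dep E u))"

lemma finite_words [simp]: "finite (words q N)"
proof -
  have "words q N \<subseteq> {ys. set ys \<subseteq> {..<q} \<and> length ys \<le> N}" by (auto simp: words_def)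
  then show ?thesis using finite_lists_length_le[of "{..<q}" N] finite_subset by blast
qed

lemma finite_kids [simp]: "finite (kids d E u)" by (simp add: kids_def)

lemma sum_words: "(\<Sum>ys\<in>words q N. g (length ys)) = (\<Sum>j<N. real q ^ j * g j)"
proof (induction N)
  case (Suc N)
  let ?L = "{ys. set ys \<subseteq> {..<q} \<and> length ys = N}"
  have "words q (Suc N) = words q N \<union> ?L" by (auto simp: words_def)
  moreover have "words q N \<inter> ?L = {}" by (auto simp: words_def)
  moreover have "finite ?L" by (simp add: finite_lists_length_eq)
  moreover have "(\<Sum>ys\<in>?L. g (length ys)) = real q ^ N * g N"
    using card_lists_length_eq[of "{..<q}" N] by simp
  ultimately show ?case using Suc by (simp add: sum.union_disjoint)
qed (simp add: words_def)

lemma tvert_append: "tvert d (u @ a # ys) \<longleftrightarrow> tvert d u \<and> a < (if u = [] then d else d - 1) \<and> set ys \<subseteq> {..<d - 1}"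
  by (cases u) (auto simp: tvert_def)

definition tops :: "bool \<Rightarrow> nat list set" where "tops E = (if E then {[], [0]} else {[]})"

lemma finite_tops: "finite (tops E)" by (simp add: tops_def)

lemma finite_branch: "finite (branch d E N u)" by (simp add: branch_def)

lemma card_kids: "card (kids d E u) = nk d E u" by (simp add: kids_def)

lemma sum_branch:
  "(\<Sum>w\<in>branch d E N u. G w) = (\<Sum>a\<in>kids d E u. \<Sum>ys\<in>words (d - 1) (N - 1 - dep E u). G (u @ a # ys))"
  unfolding branch_def sum.cartesian_product
  by (subst sum.reindex) (auto simp: inj_on_def intro!: sum.cong)

text \<open>The two ends of an edge are parents of each other, whence the value at
  \<open>[]\<close>. Without \<open>E\<close> the equation \<open>loceq\<close> has no parent term
  at the root.\<close>

definition par :: "nat list \<Rightarrow> nat list" where "par u = (if u = [] then [0] else butlast u)"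

definition loceq :: "nat \<Rightarrow> real \<Rightarrow> bool \<Rightarrow> (nat list \<Rightarrow> real) \<Rightarrow> nat list \<Rightarrow> bool" where
  "loceq d lam E g u \<longleftrightarrow>
     lam * g u = (\<Sum>a\<in>kids d E u. g (u @ [a])) + (if u = [] \<and> \<not> E then 0 else g (par u))"

context
  fixes d :: nat
  assumes d3: "d \<ge> 3"
begin

lemma tvert_kid: "a \<in> kids d E u \<Longrightarrow> tvert d (u @ a # ys) \<longleftrightarrow> tvert d u \<and> set ys \<subseteq> {..<d - 1}"
  using d3 by (auto simp: tvert_append kids_def klo_def nk_def split: if_splits)

lemma dep_kid: "a \<in> kids d E u \<Longrightarrow> dep E (u @ a # ys) = Suc (dep E u + length ys)"
  by (cases u) (auto simp: dep_def kids_def klo_def)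

lemma klo_in_kids: "klo E u \<in> kids d E u"
  using d3 by (auto simp: kids_def nk_def)

lemma branch_subset: "tvert d u \<Longrightarrow> branch d E N u \<subseteq> tvs d E N"
  by (auto simp: branch_def tvs_def tvert_kid dep_kid words_def)

text \<open>\<open>length w - dep E w\<close> is 1 on the side of \<open>[0]\<close> and 0
  elsewhere. The bound on \<open>l\<close> excludes the step across the edge, which does not lead to
  a child.\<close>

lemma nth_kid:
  assumes "tvert d w" "l < length w" "length w - dep E w \<le> l"
  shows "w ! l \<in> kids d E (take l w)"
proof -
  have w: "w = take l w @ w ! l # drop (Suc l) w" using assms(2) by (rule id_take_nth_drop)
  have "w ! l < (if take l w = [] then d else d - 1)"
    using assms(1) w tvert_append by metis
  moreover have "l = 0 \<Longrightarrow> E \<Longrightarrow> w ! l \<noteq> 0"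
    using assms(2,3) by (cases w) (auto simp: dep_def split: if_splits)
  ultimately show ?thesis using assms(2) d3 by (auto simp: kids_def klo_def nk_def split: if_splits)
qed

lemma in_branch:
  assumes "w \<in> tvs d E N" "take (length u) w = u" "length u < length w" "klo E u \<le> w ! length u"
  shows "w \<in> branch d E N u" "tvert d u" "dep E u < N - 1"
proof -
  let ?a = "w ! length u" and ?ys = "drop (Suc (length u)) w"
  have w: "w = u @ ?a # ?ys" using id_take_nth_drop[OF assms(3)] assms(2) by simp
  have v: "tvert d w" "dep E w < N" using assms(1) by (auto simp: tvs_def)
  have 1: "tvert d u \<and> ?a < (if u = [] then d else d - 1) \<and> set ?ys \<subseteq> {..<d - 1}"
    using v(1) w tvert_append by metis
  then have a: "?a \<in> kids d E u" using assms(4) d3 by (auto simp: kids_def klo_def nk_def split: if_splits)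
  have "dep E w = Suc (dep E u + length ?ys)" using dep_kid[OF a] w by metis
  then show "dep E u < N - 1" "tvert d u" using v 1 by auto
  have "?ys \<in> words (d - 1) (N - 1 - dep E u)"
    using 1 v(2) \<open>dep E w = _\<close> by (auto simp: words_def)
  then show "w \<in> branch d E N u"
    unfolding branch_def by (intro image_eqI[of _ _ "(?a, ?ys)"]) (use w a in auto)
qed

lemma top_tvert: "u \<in> tops E \<Longrightarrow> tvert d u"
  and top_dep: "u \<in> tops E \<Longrightarrow> dep E u = 0"
  using d3 by (auto simp: tops_def tvert_def dep_def split: if_splits)

lemma tvs_decomp: "tvs d E (Suc n) = tops E \<union> (\<Union>u\<in>tops E. branch d E (Suc n) u)"
proof (intro set_eqI iffI)
  fix w assume w: "w \<in> tvs d E (Suc n)"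
  show "w \<in> tops E \<union> (\<Union>u\<in>tops E. branch d E (Suc n) u)"
  proof (cases "w \<in> tops E")
    case False
    then have "w \<noteq> []" by (auto simp: tops_def split: if_splits)
    then obtain a ys where aw: "w = a # ys" by (cases w) auto
    show ?thesis
    proof (cases "E \<and> a = 0")
      case True
      then have "ys \<noteq> []" using False aw by (auto simp: tops_def)
      then have "w \<in> branch d E (Suc n) [0]"
        using w aw True by (intro in_branch(1)) (auto simp: klo_def)
      then show ?thesis using True by (auto simp: tops_def)
    next
      case a: False
      then have "w \<in> branch d E (Suc n) []"
        using w aw by (intro in_branch(1)) (auto simp: klo_def)
      then show ?thesis by (auto simp: tops_def)
    qed
  qed simp
next
  fix w assume "w \<in> tops E \<union> (\<Union>u\<in>tops E. branch d E (Suc n) u)"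
  then show "w \<in> tvs d E (Suc n)"
    using branch_subset top_tvert top_dep by (auto simp: tvs_def; blast)
qed

lemma finite_tvs [simp]: "finite (tvs d E N)"
proof (cases N)
  case (Suc n)
  then show ?thesis by (simp add: tvs_decomp finite_tops finite_branch)
qed (simp add: tvs_def)

lemma sum_tvs:
  "(\<Sum>v\<in>tvs d E (Suc n). G v) = (\<Sum>u\<in>tops E. G u + (\<Sum>a\<in>kids d E u. \<Sum>ys\<in>words (d - 1) n. G (u @ a # ys)))"
proof -
  have disj: "tops E \<inter> (\<Union>u\<in>tops E. branch d E (Suc n) u) = {}"
  proof -
    have False if "w \<in> tops E" "w \<in> branch d E (Suc n) u" for w u
      using that dep_kid top_dep[OF that(1)] by (auto simp: branch_def)
    then show ?thesis by blast
  qed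
  have "(\<Sum>v\<in>tvs d E (Suc n). G v) = (\<Sum>v\<in>tops E. G v) + (\<Sum>v\<in>(\<Union>u\<in>tops E. branch d E (Suc n) u). G v)"
    unfolding tvs_decomp by (intro sum.union_disjoint disj) (auto simp: finite_tops finite_branch)
  also have "(\<Sum>v\<in>(\<Union>u\<in>tops E. branch d E (Suc n) u). G v) = (\<Sum>u\<in>tops E. \<Sum>v\<in>branch d E (Suc n) u. G v)"
    by (intro sum.UNION_disjoint)
      (auto simp: finite_tops finite_branch tops_def branch_def kids_def klo_def split: if_splits)
  also have "\<dots> = (\<Sum>u\<in>tops E. \<Sum>a\<in>kids d E u. \<Sum>ys\<in>words (d - 1) n. G (u @ a # ys))"
    by (intro sum.cong refl) (simp add: sum_branch top_dep)
  finally show ?thesis by (simp add: sum.distrib)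
qed

lemma sum_dep:
  fixes g :: "nat \<Rightarrow> real"
  shows "(\<Sum>v\<in>tvs d E (Suc n). g (dep E v)) =
    (\<Sum>u\<in>tops E. g 0 + real (nk d E u) * (\<Sum>j<n. real (d - 1) ^ j * g (Suc j)))"
proof -
  have "(\<Sum>a\<in>kids d E u. \<Sum>ys\<in>words (d - 1) n. g (dep E (u @ a # ys)))
    = real (nk d E u) * (\<Sum>j<n. real (d - 1) ^ j * g (Suc j))" if "u \<in> tops E" for u
  proof -
    have "(\<Sum>a\<in>kids d E u. \<Sum>ys\<in>words (d - 1) n. g (dep E (u @ a # ys)))
      = (\<Sum>a\<in>kids d E u. \<Sum>ys\<in>words (d - 1) n. g (Suc (length ys)))"
      by (intro sum.cong refl) (simp add: dep_kid top_dep[OF that])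
    also have "\<dots> = real (nk d E u) * (\<Sum>j<n. real (d - 1) ^ j * g (Suc j))"
      using sum_words[of "\<lambda>j. g (Suc j)" "d - 1" n] by (simp add: card_kids)
    finally show ?thesis .
  qed
  then show ?thesis by (simp add: sum_tvs top_dep)
qed

lemma sum_dep_root:
  fixes g :: "nat \<Rightarrow> real"
  shows "(\<Sum>v\<in>tvs d False (Suc n). g (dep False v)) = g 0 + real d * (\<Sum>j<n. real (d - 1) ^ j * g (Suc j))"
  unfolding sum_dep by (simp add: tops_def nk_def)

lemma sum_dep_edge:
  fixes g :: "nat \<Rightarrow> real"
  shows "(\<Sum>v\<in>tvs d True n. g (dep True v)) = 2 * (\<Sum>j<n. real (d - 1) ^ j * g j)"
proof (cases n)
  case (Suc m)
  show ?thesis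
    unfolding Suc sum_dep sum.lessThan_Suc_shift
    by (simp add: tops_def nk_def sum_distrib_left mult_ac)
qed (simp add: tvs_def)

text \<open>The neighbours do not depend on \<open>E\<close>; with \<open>E\<close>, the neighbour
  \<open>[0]\<close> of the root moves from the children to the parent.\<close>

lemma neighbour_sum:
  fixes g :: "nat list \<Rightarrow> real"
  assumes "tvert d u"
  shows "(\<Sum>w\<in>{w. tadj d u w}. g w) = (\<Sum>a\<in>kids d E u. g (u @ [a])) + (if u = [] \<and> \<not> E then 0 else g (par u))"
proof -
  let ?K = "{..<(if u = [] then d else d - 1)}"
  have s: "{w. tadj d u w} = (\<lambda>a. u @ [a]) ` ?K \<union> (if u = [] then {} else {butlast u})"
  proof (intro set_eqI iffI)
    fix w assume "w \<in> {w. tadj d u w}"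
    then show "w \<in> (\<lambda>a. u @ [a]) ` ?K \<union> (if u = [] then {} else {butlast u})"
      by (auto simp: tadj_def tvert_append tvert_def[of d "[_]"] split: if_splits)
  next
    fix w assume w: "w \<in> (\<lambda>a. u @ [a]) ` ?K \<union> (if u = [] then {} else {butlast u})"
    have "u \<noteq> [] \<Longrightarrow> tvert d (butlast u)"
      using assms tvert_append[of d "butlast u" "last u" "[]"] by simp
    then show "w \<in> {w. tadj d u w}"
      using w assms append_butlast_last_id[of u]
      by (cases "u = []") (auto simp: tadj_def tvert_append tvert_def[of d "[_]"] intro: exI[of _ "last u"])
  qed
  have inj: "inj_on (\<lambda>a. u @ [a]) ?K" by (auto simp: inj_on_def)
  have "(\<Sum>w\<in>{w. tadj d u w}. g w) = (\<Sum>a\<in>?K. g (u @ [a])) + (if u = [] then 0 else g (butlast u))"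
  proof (cases "u = []")
    case True
    then show ?thesis unfolding s using sum.reindex[OF inj, of g] by (simp add: comp_def)
  next
    case False
    have "butlast u \<notin> (\<lambda>a. u @ [a]) ` ?K"
    proof
      assume "butlast u \<in> (\<lambda>a. u @ [a]) ` ?K"
      then obtain a where e: "butlast u = u @ [a]" by blast
      have "length (butlast u) = length u + 1" unfolding e by simp
      then show False by simp
    qed
    with False show ?thesis
      unfolding s using sum.reindex[OF inj, of g] by (simp add: comp_def)
  qed
  also have "\<dots> = (\<Sum>a\<in>kids d E u. g (u @ [a])) + (if u = [] \<and> \<not> E then 0 else g (par u))"
  proof (cases "u = [] \<and> E")
    case True
    have "{..<d} = insert 0 {1..<d}" using d3 by auto
    moreover have "kids d E u = {1..<d}" using True d3 by (auto simp: kids_def klo_def nk_def)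
    ultimately show ?thesis using True by (simp add: par_def)
  next
    case False
    then have "kids d E u = ?K" using d3 by (auto simp: kids_def klo_def nk_def)
    then show ?thesis using False by (simp add: par_def)
  qed
  finally show ?thesis .
qed

lemma dep_par: "tvert d u \<Longrightarrow> \<not> (u = [] \<and> \<not> E) \<Longrightarrow> dep E (par u) \<le> dep E u"
  by (cases u rule: rev_cases; cases "butlast u") (auto simp: dep_def par_def hd_append split: if_splits)

lemma tvert_par: "tvert d u \<Longrightarrow> tvert d (par u)"
  using tvert_append[of d "butlast u" "last u" "[]"] d3 by (cases "u = []") (auto simp: par_def tvert_def)

text \<open>Translates the interior condition of \<open>Wlam\<close> into depth: neighbours differ
  in depth by at most one, and a vertex on the last level has a child outside.\<close>

lemma interior_iff:
  assumes "u \<in> tvs d E (Suc n)"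
  shows "(\<forall>w. tadj d u w \<longrightarrow> w \<in> tvs d E (Suc n)) \<longleftrightarrow> u \<in> tvs d E n"
proof
  assume *: "\<forall>w. tadj d u w \<longrightarrow> w \<in> tvs d E (Suc n)"
  have "tvert d u" using assms by (simp add: tvs_def)
  then have "tadj d u (u @ [klo E u])"
    using tvert_kid[OF klo_in_kids[of E u], of "[]"] by (auto simp: tadj_def)
  then have "u @ [klo E u] \<in> tvs d E (Suc n)" using * by blast
  then show "u \<in> tvs d E n" using dep_kid[OF klo_in_kids, of E u "[]"] \<open>tvert d u\<close> by (simp add: tvs_def)
next
  assume u: "u \<in> tvs d E n"
  show "\<forall>w. tadj d u w \<longrightarrow> w \<in> tvs d E (Suc n)"
  proof (intro allI impI)
    fix w assume w: "tadj d u w"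
    have v: "tvert d u" "tvert d w" "dep E u < n" using w u by (auto simp: tadj_def tvs_def)
    consider a where "w = u @ [a]" | a where "u = w @ [a]" using w by (auto simp: tadj_def)
    then have "dep E w \<le> Suc (dep E u)"
      by cases (auto simp: dep_def hd_append split: if_splits)
    then show "w \<in> tvs d E (Suc n)" using v by (simp add: tvs_def)
  qed
qed

lemma WlamD:
  assumes "f \<in> Wlam d lam (tvs d E (Suc n))" "u \<in> tvs d E n"
  shows "loceq d lam E f u"
proof -
  have u: "u \<in> tvs d E (Suc n)" "tvert d u" using assms(2) by (auto simp: tvs_def)
  then have "lam * f u = (\<Sum>w\<in>{w. tadj d u w}. f w)"
    using assms interior_iff[OF u(1)] by (auto simp: Wlam_def)
  then show ?thesis unfolding loceq_def neighbour_sum[OF u(2), of f E] .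
qed

lemma WlamI:
  assumes "\<And>u. u \<in> tvs d E n \<Longrightarrow> loceq d lam E f u"
  shows "restrict f (tvs d E (Suc n)) \<in> Wlam d lam (tvs d E (Suc n))"
  unfolding Wlam_def
proof (intro CollectI conjI ballI impI)
  fix u assume u: "u \<in> tvs d E (Suc n)" and nb: "\<forall>w. tadj d u w \<longrightarrow> w \<in> tvs d E (Suc n)"
  then have "u \<in> tvs d E n" "tvert d u" using interior_iff[OF u] by (auto simp: tvs_def)
  then have "lam * f u = (\<Sum>w\<in>{w. tadj d u w}. f w)"
    using assms unfolding loceq_def neighbour_sum[OF \<open>tvert d u\<close>, of f E] by blast
  also have "\<dots> = (\<Sum>w\<in>{w. tadj d u w}. restrict f (tvs d E (Suc n)) w)"
    using nb by (intro sum.cong) auto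
  finally show "lam * restrict f (tvs d E (Suc n)) u = (\<Sum>w\<in>{w. tadj d u w}. restrict f (tvs d E (Suc n)) w)"
    using u by simp
qed auto

end

subsection \<open>Helmert vectors\<close>

text \<open>The Helmert vectors with \<open>1 \<le> r < n\<close> form an orthogonal basis of the vectors of sum zero in
  dimension \<open>n\<close>.\<close>
definition helm :: "nat \<Rightarrow> nat \<Rightarrow> real" where
  "helm r a = (if a < r then 1 else if a = r then - real r else 0)"

lemma sum_helm: "r < n \<Longrightarrow> (\<Sum>a<n. helm r a) = 0"
proof -
  have "(\<Sum>a<n. helm r a) = (if n \<le> r then real n else 0)" for n
    by (induction n) (auto simp: helm_def)
  then show "r < n \<Longrightarrow> (\<Sum>a<n. helm r a) = 0" by simp
qed

lemma sum_helm_sq: "r < n \<Longrightarrow> (\<Sum>a<n. (helm r a)\<^sup>2) = real r * (real r + 1)"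
proof -
  have "(\<Sum>a<n. (helm r a)\<^sup>2) = (if n \<le> r then real n else real r * (real r + 1))" for n
    by (induction n) (auto simp: helm_def power2_eq_square algebra_simps not_less le_Suc_eq)
  then show "r < n \<Longrightarrow> (\<Sum>a<n. (helm r a)\<^sup>2) = real r * (real r + 1)" by simp
qed

lemma sum_helm_orth: "r < n \<Longrightarrow> s < n \<Longrightarrow> r \<noteq> s \<Longrightarrow> (\<Sum>a<n. helm r a * helm s a) = 0"
proof (induction r s rule: linorder_wlog)
  case (le r s)
  have "(\<Sum>a<n. helm r a * helm s a) = (\<Sum>a<n. helm r a)"
    by (intro sum.cong refl) (use le in \<open>auto simp: helm_def\<close>)
  then show ?case using sum_helm le by simp
qed (simp add: mult.commute)

text \<open>The projections to the Helmert vectors, of squared norm \<open>r (r + 1)\<close>, add up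
  to the identity minus the projection to constants.\<close>

lemma helm_complete:
  "a < n \<Longrightarrow> b < n \<Longrightarrow>
    (\<Sum>r=1..<n. helm r a * helm r b / (real r * (real r + 1))) = (if a = b then 1 else 0) - 1 / real n"
proof (induction n)
  case (Suc n)
  have z: "helm r n = 0" if "r < n" for r using that by (simp add: helm_def)
  show ?case
  proof (cases "n = 0")
    case False
    have S: "(\<Sum>r=1..<Suc n. helm r a * helm r b / (real r * (real r + 1))) =
       (\<Sum>r=1..<n. helm r a * helm r b / (real r * (real r + 1))) + helm n a * helm n b / (real n * (real n + 1))"
      using False by simp
    consider "a < n" "b < n" | "a = n" | "b = n" using Suc.prems by linarith
    then show ?thesis
    proof cases
      case 1
      then show ?thesis unfolding S Suc.IH[OF 1] using False
        by (simp add: helm_def divide_simps) (simp add: algebra_simps)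
    next
      case 2
      then show ?thesis unfolding S using False Suc.prems
        by (auto simp: z helm_def divide_simps; simp add: algebra_simps)
    next
      case 3
      then show ?thesis unfolding S using False Suc.prems
        by (auto simp: z helm_def divide_simps; simp add: algebra_simps)
    qed
  qed (use Suc.prems in simp)
qed simp

subsection \<open>The orthogonal basis\<close>

text \<open>An index below \<open>klo E u\<close> denotes the other end of the edge, which is not a
  child and gets weight 0.\<close>

definition khelm :: "bool \<Rightarrow> nat list \<Rightarrow> nat \<Rightarrow> nat \<Rightarrow> real" where
  "khelm E u r a = (if a < klo E u then 0 else helm r (a - klo E u))"

text \<open>At \<open>w = u\<close> the letter \<open>w ! length u\<close> is unspecified, but the
  profile vanishes there.\<close>

definition innov :: "nat \<Rightarrow> real \<Rightarrow> bool \<Rightarrow> nat list \<times> nat \<Rightarrow> nat list \<Rightarrow> real" where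
  "innov d lam E = (\<lambda>(u, r) w. if take (length u) w = u
     then khelm E u r (w ! length u) * brp d lam (length w - length u) else 0)"

text \<open>Index \<open>0\<close> is the symmetric and index \<open>1\<close> the antisymmetric top vector of an edge; for the
  root only index \<open>0\<close> is used.\<close>
definition sgnv :: "nat \<Rightarrow> real" where "sgnv i = (if i = 0 then 1 else - 1)"

definition side :: "bool \<Rightarrow> nat list \<Rightarrow> bool" where "side E w \<longleftrightarrow> E \<and> w \<noteq> [] \<and> hd w = 0"

definition topv :: "nat \<Rightarrow> real \<Rightarrow> bool \<Rightarrow> nat \<Rightarrow> nat list \<Rightarrow> real" where
  "topv d lam E i w = (if E then (if side E w then sgnv i else 1) * edp d lam (sgnv i) (dep E w)
     else sph d lam (dep E w))"

definition basisv :: "nat \<Rightarrow> real \<Rightarrow> bool \<Rightarrow> nat + nat list \<times> nat \<Rightarrow> nat list \<Rightarrow> real" where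
  "basisv d lam E = case_sum (topv d lam E) (innov d lam E)"

definition topidx :: "bool \<Rightarrow> nat set" where "topidx E = (if E then {0, 1} else {0})"

definition innidx :: "nat \<Rightarrow> bool \<Rightarrow> nat \<Rightarrow> (nat list \<times> nat) set" where
  "innidx d E n = (SIGMA u:tvs d E n. {1..<nk d E u})"

definition topw :: "nat \<Rightarrow> real \<Rightarrow> bool \<Rightarrow> nat \<Rightarrow> real" where
  "topw d lam E i = (if E then (1 + sgnv i * (lam / real d)) / 2 else 1)"

text \<open>Weights of unnormalised vectors. Dividing by \<open>r (r + 1)\<close> cancels the norm
  of the Helmert vector, so the eigenvalue does not depend on \<open>r\<close>.\<close>

definition basisw :: "nat \<Rightarrow> real \<Rightarrow> bool \<Rightarrow> nat + nat list \<times> nat \<Rightarrow> real" where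
  "basisw d lam E = case_sum (topw d lam E) (\<lambda>(u, r). innov_var d lam / (real r * (real r + 1)))"

lemma sum_kids: "(\<Sum>a\<in>kids d E u. g (a - klo E u)) = (\<Sum>a<nk d E u. g a)"
  unfolding kids_def
  by (rule sum.reindex_bij_witness[of _ "\<lambda>a. a + klo E u" "\<lambda>a. a - klo E u"]) auto

lemma khelm_kid: "a \<in> kids d E u \<Longrightarrow> khelm E u r a = helm r (a - klo E u)"
  by (simp add: khelm_def kids_def)

lemma sum_khelm: "r < nk d E u \<Longrightarrow> (\<Sum>a\<in>kids d E u. khelm E u r a) = 0"
  using sum_kids[of "helm r" E u] sum_helm by (simp add: khelm_kid)

lemma sum_khelm_sq: "r < nk d E u \<Longrightarrow> (\<Sum>a\<in>kids d E u. (khelm E u r a)\<^sup>2) = real r * (real r + 1)"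
  using sum_kids[of "\<lambda>a. (helm r a)\<^sup>2" E u] sum_helm_sq by (simp add: khelm_kid)

lemma sum_khelm_orth:
  "r < nk d E u \<Longrightarrow> s < nk d E u \<Longrightarrow> r \<noteq> s \<Longrightarrow> (\<Sum>a\<in>kids d E u. khelm E u r a * khelm E u s a) = 0"
  using sum_kids[of "\<lambda>a. helm r a * helm s a" E u] sum_helm_orth by (simp add: khelm_kid)

lemma khelm_complete:
  assumes "a \<in> kids d E u" "b \<in> kids d E u"
  shows "(\<Sum>r=1..<nk d E u. khelm E u r a * khelm E u r b / (real r * (real r + 1)))
    = (if a = b then 1 else 0) - 1 / real (nk d E u)"
proof -
  have "a - klo E u < nk d E u" "b - klo E u < nk d E u" "a - klo E u = b - klo E u \<longleftrightarrow> a = b"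
    using assms by (auto simp: kids_def)
  then show ?thesis using helm_complete assms by (simp add: khelm_kid)
qed

lemma innov_kid: "innov d lam E (u, r) (u @ a # ys) = khelm E u r a * brp d lam (Suc (length ys))"
  by (simp add: innov_def)

lemma innov_short: "length w \<le> length u \<Longrightarrow> innov d lam E (u, r) w = 0"
  by (simp add: innov_def)

lemma innov_const:
  assumes "length u' \<le> length u" "u' \<noteq> u"
  obtains \<gamma> where "\<And>a ys. innov d lam E (u', r') (u @ a # ys) = \<gamma> (length ys)"
proof (cases "take (length u') u = u'")
  case True
  then have l: "length u' < length u" using assms by (metis le_neq_implies_less take_all order_refl)
  show ?thesis
    by (rule that[of "\<lambda>k. khelm E u' r' (u ! length u') * brp d lam (length u + Suc k - length u')"])
      (use l True in \<open>simp add: innov_def nth_append\<close>)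
next
  case False
  then show ?thesis using assms(1) by (intro that[of "\<lambda>_. 0"]) (simp add: innov_def)
qed

lemma innov_child_const:
  assumes "u' \<noteq> u"
  obtains c where "\<And>a. innov d lam E (u', r') (u @ [a]) = c"
proof (cases "length u' \<le> length u")
  case True
  from innov_const[OF this assms, of d lam E r'] obtain \<gamma>
    where \<gamma>: "\<And>a ys. innov d lam E (u', r') (u @ a # ys) = \<gamma> (length ys)" by blast
  show ?thesis by (rule that[of "\<gamma> 0"]) (simp add: \<gamma>)
next
  case False
  then show ?thesis by (intro that[of 0]) (simp add: innov_short)
qed

lemma side_kid: "a \<in> kids d E u \<Longrightarrow> side E (u @ a # ys) \<longleftrightarrow> side E u"
  by (cases u) (auto simp: side_def kids_def klo_def)

section \<open>Orthogonality, norms and the eigenvalue equation\<close>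

context
  fixes d :: nat and lam :: real
  assumes d3: "d \<ge> 3" and lam: "\<bar>lam\<bar> \<le> 2 * sqrt (real d - 1)"
begin

lemma topv_kid:
  assumes "a \<in> kids d E u"
  shows "topv d lam E i (u @ a # ys) =
    (if E then (if side E u then sgnv i else 1) * edp d lam (sgnv i) (Suc (dep E u + length ys))
     else sph d lam (Suc (dep E u + length ys)))"
  unfolding topv_def side_kid[OF assms] dep_kid[OF d3 assms] ..

lemma innov_support:
  assumes "w \<in> tvs d E N" "innov d lam E (u, r) w \<noteq> 0"
  shows "w \<in> branch d E N u" "tvert d u" "dep E u < N - 1"
proof -
  have "take (length u) w = u" "length u < length w" "klo E u \<le> w ! length u"
    using assms(2) by (auto simp: innov_def khelm_def not_less split: if_splits intro: ccontr)
  then show "w \<in> branch d E N u" "tvert d u" "dep E u < N - 1"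
    using in_branch[OF d3 assms(1)] by auto
qed

lemma sum_innov:
  assumes "tvert d u"
  shows "(\<Sum>w\<in>tvs d E N. innov d lam E (u, r) w * G w) =
    (\<Sum>a\<in>kids d E u. \<Sum>ys\<in>words (d - 1) (N - 1 - dep E u). khelm E u r a * brp d lam (Suc (length ys)) * G (u @ a # ys))"
proof -
  have "(\<Sum>w\<in>tvs d E N. innov d lam E (u, r) w * G w) = (\<Sum>w\<in>branch d E N u. innov d lam E (u, r) w * G w)"
    using innov_support(1) branch_subset[OF d3 assms] finite_tvs[OF d3]
    by (intro sum.mono_neutral_right) (auto, blast)
  then show ?thesis unfolding sum_branch innov_kid .
qed

text \<open>The common source of orthogonality: the zero sum over the children annihilates whatever
  is radial below \<open>u\<close>.\<close>

lemma innov_orth_const: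
  assumes "tvert d u" "r < nk d E u"
    and G: "\<And>a ys. a \<in> kids d E u \<Longrightarrow> G (u @ a # ys) = \<gamma> (length ys)"
  shows "(\<Sum>w\<in>tvs d E N. innov d lam E (u, r) w * G w) = 0"
proof -
  have "(\<Sum>w\<in>tvs d E N. innov d lam E (u, r) w * G w)
    = (\<Sum>a\<in>kids d E u. khelm E u r a * (\<Sum>ys\<in>words (d - 1) (N - 1 - dep E u). brp d lam (Suc (length ys)) * \<gamma> (length ys)))"
    unfolding sum_innov[OF assms(1)] sum_distrib_left
    by (intro sum.cong refl) (simp add: G mult.assoc del: lrec.simps)
  also have "\<dots> = 0" unfolding sum_distrib_right[symmetric] sum_khelm[OF assms(2)] by simp
  finally show ?thesis .
qed

lemma innov_orth:
  assumes "(u, r) \<in> innidx d E n" "(v, s) \<in> innidx d E n" "(u, r) \<noteq> (v, s)"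
  shows "(\<Sum>w\<in>tvs d E N. innov d lam E (u, r) w * innov d lam E (v, s) w) = 0"
proof -
  \<comment> \<open>For distinct branching vertices the zero sum is taken at the deeper one.\<close>
  have *: "(\<Sum>w\<in>tvs d E N. innov d lam E (u, r) w * innov d lam E (v, s) w) = 0"
    if "(u, r) \<in> innidx d E n" "(v, s) \<in> innidx d E n" "u \<noteq> v" "length v \<le> length u" for u v r s
  proof -
    have ur: "tvert d u" "r < nk d E u" using that(1) by (auto simp: innidx_def tvs_def)
    from innov_const[OF that(4) that(3)[symmetric], of d lam E s] obtain \<gamma>
      where \<gamma>: "\<And>a ys. innov d lam E (v, s) (u @ a # ys) = \<gamma> (length ys)" by blast
    show ?thesis by (rule innov_orth_const[OF ur]) (rule \<gamma>)
  qed
  show ?thesis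
  proof (cases "u = v")
    case True
    then have ur: "tvert d u" "r < nk d E u" "s < nk d E u" "r \<noteq> s"
      using assms by (auto simp: innidx_def tvs_def)
    have "(\<Sum>w\<in>tvs d E N. innov d lam E (u, r) w * innov d lam E (v, s) w)
      = (\<Sum>a\<in>kids d E u. (khelm E u r a * khelm E u s a) * (\<Sum>ys\<in>words (d - 1) (N - 1 - dep E u). (brp d lam (Suc (length ys)))\<^sup>2))"
      unfolding sum_innov[OF ur(1)] sum_distrib_left
      by (intro sum.cong refl) (simp add: True[symmetric] innov_kid power2_eq_square del: lrec.simps)
    also have "\<dots> = 0" unfolding sum_distrib_right[symmetric] sum_khelm_orth[OF ur(2-4)] by simp
    finally show ?thesis .
  next
    case False
    then show ?thesis
      using *[of u r v s] *[of v s u r] assms by (cases "length v \<le> length u") (auto simp: mult.commute)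
  qed
qed

lemma innov_norm:
  assumes "(u, r) \<in> innidx d E n"
  shows "(\<Sum>w\<in>tvs d E N. (innov d lam E (u, r) w)\<^sup>2)
    = real r * (real r + 1) * (\<Sum>j<N - 1 - dep E u. real (d - 1) ^ j * (brp d lam (Suc j))\<^sup>2)"
proof -
  have ur: "tvert d u" "r < nk d E u" using assms by (auto simp: innidx_def tvs_def)
  have "(\<Sum>w\<in>tvs d E N. (innov d lam E (u, r) w)\<^sup>2)
      = (\<Sum>a\<in>kids d E u. (khelm E u r a)\<^sup>2 * (\<Sum>ys\<in>words (d - 1) (N - 1 - dep E u). (brp d lam (Suc (length ys)))\<^sup>2))"
    unfolding power2_eq_square[of "innov d lam E (u, r) _"] sum_innov[OF ur(1)] sum_distrib_left
    by (intro sum.cong refl) (simp add: innov_kid power2_eq_square del: lrec.simps)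
  also have "\<dots> = real r * (real r + 1) * (\<Sum>ys\<in>words (d - 1) (N - 1 - dep E u). (brp d lam (Suc (length ys)))\<^sup>2)"
    unfolding sum_distrib_right[symmetric] sum_khelm_sq[OF ur(2)] ..
  finally show ?thesis
    using sum_words[of "\<lambda>j. (brp d lam (Suc j))\<^sup>2" "d - 1" "N - 1 - dep E u"] by (simp del: lrec.simps)
qed

lemma topv_orth_innov:
  assumes "(u, r) \<in> innidx d E n"
  shows "(\<Sum>w\<in>tvs d E N. innov d lam E (u, r) w * topv d lam E i w) = 0"
proof -
  have ur: "tvert d u" "r < nk d E u" using assms by (auto simp: innidx_def tvs_def)
  show ?thesis
    by (rule innov_orth_const[OF ur]) (rule topv_kid)
qed

text \<open>Exchanging the sides of the edge preserves one vector and negates the other, so their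
  contributions cancel.\<close>

lemma topv_orth: "E \<Longrightarrow> (\<Sum>w\<in>tvs d E N. topv d lam E 0 w * topv d lam E 1 w) = 0"
proof (cases N)
  case (Suc n)
  assume E
  have "tops E = {[], [0]}" using \<open>E\<close> by (simp add: tops_def)
  moreover have "side E [0]" "\<not> side E []" "dep E [0] = 0" "dep E [] = 0" using \<open>E\<close> by (auto simp: side_def dep_def)
  moreover have "card (kids d E []) = card (kids d E [0])" using \<open>E\<close> by (simp add: card_kids nk_def)
  ultimately show ?thesis
    unfolding Suc sum_tvs[OF d3] using \<open>E\<close>
    by (simp add: topv_kid sgnv_def topv_def[of d lam True _ "[]"] topv_def[of d lam True _ "[0]"] sum_negf del: lrec.simps)
qed (simp add: tvs_def)

lemma topv_sq_sum:
  "(\<Sum>w\<in>tvs d E N. (topv d lam E i w)\<^sup>2) =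
     (\<Sum>w\<in>tvs d E N. if E then (edp d lam (sgnv i) (dep E w))\<^sup>2 else (sph d lam (dep E w))\<^sup>2)"
  by (intro sum.cong refl) (simp add: topv_def sgnv_def power_mult_distrib del: lrec.simps)

text \<open>Strictly below \<open>u0\<close> this is the recurrence of the profile, at
  \<open>u0\<close> the zero sum of the Helmert vector, and elsewhere all terms vanish.\<close>

lemma loceq_innov:
  assumes u0: "u0 \<in> tvs d E n" "r < nk d E u0" and u: "tvert d u"
  shows "loceq d lam E (innov d lam E (u0, r)) u"
proof -
  let ?A = "innov d lam E (u0, r)"
  consider (below) a ys where "u = u0 @ a # ys" | (same) "u = u0" | (off) "take (length u0) u \<noteq> u0"
    by (metis append_take_drop_id append.right_neutral neq_Nil_conv)
  then show ?thesis
  proof cases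
    case below
    let ?k = "Suc (length ys)"
    have nk: "card (kids d E u) = d - 1" using below by (simp add: card_kids nk_def)
    have "?A (u @ [b]) = khelm E u0 r a * brp d lam (Suc ?k)" for b
      using innov_kid[of d lam E u0 r a "ys @ [b]"] below by (simp del: lrec.simps)
    moreover have "?A (par u) = khelm E u0 r a * brp d lam (length ys)"
    proof (cases ys rule: rev_cases)
      case Nil
      then show ?thesis using below by (simp add: par_def innov_short)
    next
      case (snoc zs z)
      then have "par u = u0 @ a # zs" using below by (simp add: par_def butlast_append)
      then show ?thesis using innov_kid[of d lam E u0 r a zs] snoc by (simp del: lrec.simps)
    qed
    moreover have "?A u = khelm E u0 r a * brp d lam ?k"
      using below by (simp add: innov_kid del: lrec.simps)
    moreover have "khelm E u0 r a * ((real d - 1) * brp d lam (Suc ?k) + brp d lam (length ys)) = khelm E u0 r a * (lam * brp d lam ?k)"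
      unfolding lrec_step[OF d3] by simp
    moreover have "u \<noteq> []" using below by simp
    ultimately show ?thesis
      using d3 nk by (simp add: loceq_def of_nat_diff algebra_simps del: lrec.simps)
  next
    case same
    have "?A (u @ [b]) = khelm E u0 r b" for b
      using innov_kid[of d lam E u0 r b "[]"] same by simp
    moreover have "?A u = 0" using same by (simp add: innov_short)
    moreover have "?A (par u) = 0" if "\<not> (u = [] \<and> \<not> E)"
    proof (cases "u = []")
      \<comment> \<open>With an edge the parent of the root is \<open>[0]\<close>, where
        \<open>khelm\<close> vanishes.\<close>
      case True
      then show ?thesis using that same by (simp add: par_def innov_def khelm_def klo_def)
    next
      case False
      then show ?thesis using same by (simp add: par_def innov_short)
    qed
    ultimately show ?thesis using same sum_khelm[OF u0(2)] by (auto simp: loceq_def)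
  next
    case off
    have "?A u = 0" using off by (simp add: innov_def)
    moreover have "?A (u @ [b]) = 0" for b
    proof (cases "length u0 \<le> length u")
      case True
      then show ?thesis using off by (simp add: innov_def)
    qed (simp add: innov_short)
    moreover have "?A (par u) = 0"
    proof (cases "u = []")
      case True
      then have "length (par u) \<le> length u0" using off by (cases u0) (auto simp: par_def)
      then show ?thesis by (rule innov_short)
    next
      case False
      have "take (length u0) (butlast u) \<noteq> u0"
      proof
        assume a: "take (length u0) (butlast u) = u0"
        then have "length u0 \<le> length (butlast u)" by (metis length_take min.cobounded1)
        then show False using a off False
          by (metis append_butlast_last_id length_append take_append diff_is_0_eq' take_0 append_Nil2)
      qed
      then show ?thesis using False by (simp add: par_def innov_def)
    qed
    ultimately show ?thesis by (simp add: loceq_def)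
  qed
qed

lemma loceq_topv:
  assumes u: "tvert d u"
  shows "loceq d lam E (topv d lam E i) u"
proof -
  let ?A = "topv d lam E i" and ?k = "dep E u" and ?s = "sgnv i"
  have s2: "?s * ?s = 1" by (simp add: sgnv_def)
  have kid: "?A (u @ [a]) = (if E then (if side E u then ?s else 1) * edp d lam ?s (Suc ?k) else sph d lam (Suc ?k))"
    if "a \<in> kids d E u" for a using topv_kid[OF that, of i "[]"] by (simp del: lrec.simps)
  have sumkid: "(\<Sum>a\<in>kids d E u. ?A (u @ [a])) =
     real (nk d E u) * (if E then (if side E u then ?s else 1) * edp d lam ?s (Suc ?k) else sph d lam (Suc ?k))"
    by (simp add: kid card_kids del: lrec.simps)
  show ?thesis
  proof (cases "u \<in> tops E")
    case True
    show ?thesis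
    proof (cases E)
      case E: True
      \<comment> \<open>The second value of \<open>edp\<close> is chosen for this: the
        \<open>d - 1\<close> children of an end, plus the opposite end with \<open>sgnv i\<close>
        times its value, must give \<open>lam\<close> times its value.\<close>
      have nk: "real (nk d E u) * edp d lam ?s (Suc 0) = lam - ?s"
        using d3 E by (simp add: nk_def of_nat_diff)
      have "real (nk d E u) * (?s * edp d lam ?s (Suc 0)) = ?s * lam - 1"
        using nk s2 by (simp add: mult.left_commute right_diff_distrib del: lrec.simps)
      moreover have "u = [] \<or> u = [0]" using E True by (auto simp: tops_def)
      ultimately show ?thesis
        using nk s2 E unfolding loceq_def sumkid
        by (auto simp: topv_def side_def dep_def par_def mult.commute simp del: lrec.simps(2,3))
    next
      case False
      then have "u = []" using True by (simp add: tops_def)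
      then show ?thesis using False d3 unfolding loceq_def sumkid by (simp add: topv_def dep_def nk_def)
    qed
  next
    case False
    then have ne: "u \<noteq> []" by (auto simp: tops_def split: if_splits)
    then obtain v a where v: "u = v @ [a]" using rev_exhaust by blast
    have "a = u ! length v" using v by simp
    moreover have "length u - dep E u \<le> length v"
      using False v by (cases v) (auto simp: dep_def tops_def split: if_splits)
    ultimately have a: "a \<in> kids d E v" using nth_kid[OF d3 u, of "length v" E] v by simp
    have k: "dep E u = Suc (dep E v)" using dep_kid[OF d3 a, of "[]"] v by simp
    have sd: "side E u = side E v" using side_kid[OF a, of "[]"] v by simp
    have nk: "real (nk d E u) = real d - 1" using ne d3 by (simp add: nk_def of_nat_diff)
    have p: "par u = v" using v by (simp add: par_def)
    have e: "lam * edp d lam ?s (Suc (dep E v)) = (real d - 1) * edp d lam ?s (Suc (Suc (dep E v))) + edp d lam ?s (dep E v)"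
      "lam * sph d lam (Suc (dep E v)) = (real d - 1) * sph d lam (Suc (Suc (dep E v))) + sph d lam (dep E v)"
      unfolding lrec_step[OF d3] by simp_all
    have c: "lam * (c * edp d lam ?s (Suc (dep E v))) = (real d - 1) * (c * edp d lam ?s (Suc (Suc (dep E v)))) + c * edp d lam ?s (dep E v)" for c
      unfolding mult.left_commute[of _ c] e distrib_left ..
    show ?thesis
      unfolding loceq_def sumkid nk p unfolding topv_def sd k using ne c e(2)
      by (cases E) (simp_all del: lrec.simps)
  qed
qed

end

section \<open>Completeness of the basis and expansion of the covariance\<close>

lemma loceq_diff: "loceq d lam E f u \<Longrightarrow> loceq d lam E g u \<Longrightarrow> loceq d lam E (\<lambda>w. f w - g w) u"
  by (auto simp: loceq_def sum_subtractf algebra_simps)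

lemma loceq_add: "loceq d lam E f u \<Longrightarrow> loceq d lam E g u \<Longrightarrow> loceq d lam E (\<lambda>w. f w + g w) u"
  by (auto simp: loceq_def sum.distrib algebra_simps)

lemma loceq_sum:
  assumes "\<And>i. i \<in> I \<Longrightarrow> loceq d lam E (f i) u"
  shows "loceq d lam E (\<lambda>w. \<Sum>i\<in>I. c i * f i w) u"
proof -
  have s: "lam * (\<Sum>i\<in>I. c i * f i u) = (\<Sum>i\<in>I. c i * (lam * f i u))"
    by (simp add: sum_distrib_left mult.left_commute)
  have k: "(\<Sum>a\<in>K. \<Sum>i\<in>I. c i * f i (v a)) = (\<Sum>i\<in>I. c i * (\<Sum>a\<in>K. f i (v a)))" for K :: "nat set" and v
    by (subst sum.swap) (simp add: sum_distrib_left)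
  show ?thesis
    using assms unfolding loceq_def s k
    by (auto simp: sum.distrib[symmetric] distrib_left intro!: sum.cong)
qed

lemma lcp_le: "lcp u w \<le> length u" "lcp u w \<le> length w"
  by (induction u w rule: lcp.induct) auto

lemma take_eq_iff_le_lcp: "l \<le> length u \<Longrightarrow> l \<le> length w \<Longrightarrow> take l u = take l w \<longleftrightarrow> l \<le> lcp u w"
proof (induction u w arbitrary: l rule: lcp.induct)
  case (1 a xs b ys)
  then show ?case by (cases l) auto
qed auto

lemma nth_eq_of_less_lcp: "l < lcp u w \<Longrightarrow> u ! l = w ! l"
proof (induction u w arbitrary: l rule: lcp.induct)
  case (1 a xs b ys)
  then show ?case by (cases l) (auto split: if_splits)
qed auto

lemma nth_lcp_neq: "lcp u w < length u \<Longrightarrow> lcp u w < length w \<Longrightarrow> u ! lcp u w \<noteq> w ! lcp u w"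
  by (induction u w rule: lcp.induct) (auto split: if_splits)

definition index :: "nat \<Rightarrow> bool \<Rightarrow> nat \<Rightarrow> (nat + nat list \<times> nat) set" where
  "index d E n = topidx E <+> innidx d E n"

lemma finite_topidx: "finite (topidx E)" by (simp add: topidx_def)

context
  fixes d :: nat and lam :: real
  assumes d3: "d \<ge> 3" and lam: "\<bar>lam\<bar> \<le> 2 * sqrt (real d - 1)"
begin

lemma innov_top: "w \<in> tops E \<Longrightarrow> innov d lam E p w = 0"
  by (cases p; cases "fst p") (auto simp: tops_def innov_def khelm_def klo_def split: if_splits)

lemma finite_innidx: "finite (innidx d E n)"
  by (simp add: innidx_def finite_tvs[OF d3])

text \<open>Testing on the children of \<open>u\<close> isolates the coefficient of
  \<open>(u, r)\<close>, since vectors branching elsewhere are constant on these children.\<close>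

lemma sum_khelm_innov:
  assumes u: "r < nk d E u" and p: "p \<in> innidx d E n"
  shows "(\<Sum>a\<in>kids d E u. khelm E u r a * innov d lam E p (u @ [a])) = (if p = (u, r) then real r * (real r + 1) else 0)"
proof -
  obtain v s where vs: "p = (v, s)" by fastforce
  have s: "s < nk d E v" using p vs by (auto simp: innidx_def)
  show ?thesis
  proof (cases "v = u")
    case True
    have "innov d lam E p (u @ [a]) = khelm E u s a" for a
      using innov_kid[of d lam E u s a "[]"] vs True by simp
    then show ?thesis
      using sum_khelm_sq[OF u] sum_khelm_orth[OF u, of s] vs True s
      by (auto simp: power2_eq_square)
  next
    case False
    from innov_child_const[OF this, of d lam E s] obtain c
      where c: "\<And>a. innov d lam E (v, s) (u @ [a]) = c" by blast
    show ?thesis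
      using False sum_khelm[OF u] by (simp add: vs c sum_distrib_right[symmetric])
  qed
qed

text \<open>Induction on length: the local equation at \<open>u\<close> fixes the sum over the
  children, the Helmert tests fix the zero-sum part.\<close>

lemma eigen_determined:
  assumes loc: "\<And>u. u \<in> tvs d E n \<Longrightarrow> loceq d lam E D u"
    and top: "\<And>u. u \<in> tops E \<Longrightarrow> D u = 0"
    and khelm: "\<And>u r. (u, r) \<in> innidx d E n \<Longrightarrow> (\<Sum>a\<in>kids d E u. khelm E u r a * D (u @ [a])) = 0"
  shows "w \<in> tvs d E (Suc n) \<Longrightarrow> D w = 0"
proof (induction w rule: length_induct)
  case (1 w)
  show ?case
  proof (cases "w \<in> tops E")
    case False
    then obtain u b where w: "w = u @ [b]"
      by (cases w rule: rev_cases) (auto simp: tops_def split: if_splits)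
    have tw: "tvert d w" "dep E w < Suc n" using 1 by (auto simp: tvs_def)
    have "w ! length u = b" using w by simp
    moreover have "length w - dep E w \<le> length u"
      using False w by (cases u) (auto simp: dep_def tops_def split: if_splits)
    ultimately have b: "b \<in> kids d E u" using nth_kid[OF d3 tw(1), of "length u" E] w by simp
    have tu: "tvert d u" using tw(1) w tvert_kid[OF d3 b, of "[]"] by simp
    have du: "dep E w = Suc (dep E u)" using w dep_kid[OF d3 b, of "[]"] by simp
    have u: "u \<in> tvs d E n" using tu du tw by (simp add: tvs_def)
    have Du: "D u = 0" using 1 w u by (simp add: tvs_def)
    have Dp: "D (par u) = 0" if "\<not> (u = [] \<and> \<not> E)"
    proof (cases "u = []")
      \<comment> \<open>The parent is \<open>[0]\<close> here, which is not shorter; it is covered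
        by the hypothesis on the top.\<close>
      case True
      then show ?thesis using that by (intro top) (simp add: par_def tops_def)
    next
      case False
      have "par u \<in> tvs d E (Suc n)"
        using dep_par[OF d3 tu that] tvert_par[OF d3 tu] u by (simp add: tvs_def)
      moreover have "length (par u) < length w" using False w by (simp add: par_def)
      ultimately show ?thesis using 1 by blast
    qed
    have sum0: "(\<Sum>a\<in>kids d E u. D (u @ [a])) = 0"
      using loc[OF u] Du Dp unfolding loceq_def by (cases "u = [] \<and> \<not> E") simp_all
    \<comment> \<open>Recovers \<open>D w\<close> from its Helmert coefficients; the missing
      constant part is zero by \<open>sum0\<close>.\<close>
    have "0 = (\<Sum>r=1..<nk d E u. khelm E u r b / (real r * (real r + 1)) * (\<Sum>a\<in>kids d E u. khelm E u r a * D (u @ [a])))"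
      using khelm u by (simp add: innidx_def)
    also have "\<dots> = (\<Sum>r=1..<nk d E u. \<Sum>a\<in>kids d E u. khelm E u r b * khelm E u r a / (real r * (real r + 1)) * D (u @ [a]))"
      by (simp add: sum_distrib_left mult_ac)
    also have "\<dots> = (\<Sum>a\<in>kids d E u. (\<Sum>r=1..<nk d E u. khelm E u r b * khelm E u r a / (real r * (real r + 1))) * D (u @ [a]))"
      by (subst sum.swap) (simp add: sum_distrib_right)
    also have "\<dots> = (\<Sum>a\<in>kids d E u. (if b = a then D (u @ [a]) else 0) - 1 / real (nk d E u) * D (u @ [a]))"
      by (intro sum.cong refl) (simp add: khelm_complete[OF b] left_diff_distrib del: One_nat_def)
    also have "\<dots> = D w"
      using b sum0 w by (simp add: sum_subtractf sum_divide_distrib[symmetric])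
    finally show ?thesis by simp
  qed (rule top)
qed

lemma finite_index: "finite (index d E n)"
  by (simp add: index_def finite_topidx finite_innidx)

lemma sum_index: "(\<Sum>i\<in>index d E n. g i) = (\<Sum>k\<in>topidx E. g (Inl k)) + (\<Sum>p\<in>innidx d E n. g (Inr p))"
  unfolding index_def by (simp add: sum.Plus finite_topidx finite_innidx)

text \<open>The coefficients are read off from the top and from Helmert tests on children. The
  remainder passes all tests of \<open>eigen_determined\<close> and vanishes.\<close>

lemma basis_spans:
  assumes f: "f \<in> Wlam d lam (tvs d E (Suc n))"
  shows "\<exists>c. \<forall>w\<in>tvs d E (Suc n). f w = (\<Sum>i\<in>index d E n. c i * basisv d lam E i w)"
proof -
  define cT where "cT k = (if E then (f [] + sgnv k * f [0]) / 2 else f [])" for k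
  define cI where "cI = (\<lambda>(u, r). (\<Sum>a\<in>kids d E u. khelm E u r a * f (u @ [a])) / (real r * (real r + 1)))"
  define g where "g w = (\<Sum>k\<in>topidx E. cT k * topv d lam E k w) + (\<Sum>p\<in>innidx d E n. cI p * innov d lam E p w)" for w
  define D where "D w = f w - g w" for w
  have "D w = 0" if "w \<in> tvs d E (Suc n)" for w
  proof (rule eigen_determined[OF _ _ _ that])
    fix u assume u: "u \<in> tvs d E n"
    then have tu: "tvert d u" by (simp add: tvs_def)
    have "loceq d lam E (innov d lam E p) u" if "p \<in> innidx d E n" for p
      using that loceq_innov[OF d3 lam _ _ tu] by (cases p) (auto simp: innidx_def)
    then have "loceq d lam E g u"
      unfolding g_def by (intro loceq_add loceq_sum loceq_topv[OF d3 lam tu])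
    then show "loceq d lam E D u"
      unfolding D_def by (intro loceq_diff WlamD[OF d3 f u])
  next
    fix u assume u: "u \<in> tops E"
    show "D u = 0"
      using u unfolding D_def g_def innov_top[OF u]
      by (auto simp: tops_def topidx_def topv_def cT_def sgnv_def side_def dep_def field_simps split: if_splits)
  next
    fix u r assume ur: "(u, r) \<in> innidx d E n"
    then have r: "0 < r" "r < nk d E u" by (auto simp: innidx_def)
    have T: "(\<Sum>a\<in>kids d E u. khelm E u r a * topv d lam E k (u @ [a])) = 0" for k
    proof -
      have "(\<Sum>a\<in>kids d E u. khelm E u r a * topv d lam E k (u @ [a]))
        = (\<Sum>a\<in>kids d E u. khelm E u r a * topv d lam E k (u @ [klo E u]))"
        by (intro sum.cong refl) (simp add: topv_kid[OF d3 lam] klo_in_kids[OF d3] del: lrec.simps)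
      then show ?thesis by (simp add: sum_distrib_right[symmetric] sum_khelm[OF r(2)])
    qed
    have "(\<Sum>a\<in>kids d E u. khelm E u r a * g (u @ [a])) =
        (\<Sum>a\<in>kids d E u. \<Sum>k\<in>topidx E. cT k * (khelm E u r a * topv d lam E k (u @ [a])))
      + (\<Sum>a\<in>kids d E u. \<Sum>p\<in>innidx d E n. cI p * (khelm E u r a * innov d lam E p (u @ [a])))"
      by (simp add: g_def sum.distrib distrib_left sum_distrib_left mult_ac)
    also have "\<dots> = (\<Sum>k\<in>topidx E. cT k * (\<Sum>a\<in>kids d E u. khelm E u r a * topv d lam E k (u @ [a])))
      + (\<Sum>p\<in>innidx d E n. cI p * (\<Sum>a\<in>kids d E u. khelm E u r a * innov d lam E p (u @ [a])))"
      by (subst sum.swap, subst sum.swap[of _ "innidx d E n"]) (simp add: sum_distrib_left)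
    also have "\<dots> = (\<Sum>p\<in>innidx d E n. if p = (u, r) then cI p * (real r * (real r + 1)) else 0)"
      by (simp add: T) (intro sum.cong refl, simp add: sum_khelm_innov[OF r(2)])
    also have "\<dots> = cI (u, r) * (real r * (real r + 1))"
      using ur finite_innidx by simp
    also have "\<dots> = (\<Sum>a\<in>kids d E u. khelm E u r a * f (u @ [a]))"
      using r by (simp add: cI_def)
    finally show "(\<Sum>a\<in>kids d E u. khelm E u r a * D (u @ [a])) = 0"
      by (simp add: D_def right_diff_distrib sum_subtractf)
  qed
  then have "\<forall>w\<in>tvs d E (Suc n). f w = (\<Sum>i\<in>index d E n. case_sum cT cI i * basisv d lam E i w)"
    by (simp add: D_def g_def sum_index basisv_def)
  then show ?thesis by blast
qed

text \<open>Both vectors are nonzero only below the branching vertex, so common prefixes of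
  \<open>u\<close> and \<open>w\<close> alone contribute, one for each length. If \<open>l\<close>
  is the length of \<open>u\<close> or \<open>w\<close>, a letter is unspecified but a profile
  factor is 0.\<close>

lemma sum_innov_product:
  assumes u: "u \<in> tvs d E (Suc n)" and w: "w \<in> tvs d E (Suc n)"
  defines "\<kappa> \<equiv> \<lambda>l. innov_var d lam * (brp d lam (length u - l) * brp d lam (length w - l)) *
      (\<Sum>r=1..<nk d E (take l u). khelm E (take l u) r (u ! l) * khelm E (take l u) r (w ! l) / (real r * (real r + 1)))"
  shows "(\<Sum>p\<in>innidx d E n. basisw d lam E (Inr p) * innov d lam E p u * innov d lam E p w) = (\<Sum>l\<le>lcp u w. \<kappa> l)"
proof -
  let ?L = "lcp u w"
  define h where "h z = (\<Sum>r=1..<nk d E z. basisw d lam E (Inr (z, r)) * innov d lam E (z, r) u * innov d lam E (z, r) w)" for z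
  have h\<kappa>: "h (take l u) = \<kappa> l" if "l \<le> ?L" for l
  proof -
    have l: "l \<le> length u" "l \<le> length w" using that lcp_le order_trans by blast+
    then have "take l u = take l w" using that take_eq_iff_le_lcp by blast
    then show ?thesis
      unfolding h_def \<kappa>_def sum_distrib_left using l
      by (intro sum.cong refl) (simp add: innov_def basisw_def min_absorb2 del: lrec.simps)
  qed
  have out1: "h z = 0" if "z \<notin> (\<lambda>l. take l u) ` {..?L}" for z
  proof -
    have "\<not> (take (length z) u = z \<and> take (length z) w = z)"
    proof
      assume a: "take (length z) u = z \<and> take (length z) w = z"
      then have "length z \<le> length u" "length z \<le> length w" by (metis length_take min.cobounded1)+
      then have "length z \<le> ?L" using a take_eq_iff_le_lcp by metis
      then show False using that a by (metis atMost_iff image_eqI)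
    qed
    then show ?thesis by (auto simp: h_def innov_def intro!: sum.neutral)
  qed
  have out2: "h z = 0" if "z \<notin> tvs d E n" for z
  proof -
    have "innov d lam E (z, r) u = 0" for r
    proof (rule ccontr)
      assume "innov d lam E (z, r) u \<noteq> 0"
      from innov_support(2,3)[OF d3 lam u this] show False using that by (simp add: tvs_def)
    qed
    then show ?thesis by (simp add: h_def)
  qed
  have "(\<Sum>p\<in>innidx d E n. basisw d lam E (Inr p) * innov d lam E p u * innov d lam E p w) = (\<Sum>z\<in>tvs d E n. h z)"
    unfolding innidx_def h_def by (subst sum.Sigma) (auto simp: finite_tvs[OF d3] case_prod_beta')
  also have "\<dots> = (\<Sum>z\<in>(\<lambda>l. take l u) ` {..?L}. h z)"
    using out1 out2 by (intro sum.mono_neutral_cong) (auto simp: finite_tvs[OF d3])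
  also have "\<dots> = (\<Sum>l\<le>?L. h (take l u))"
  proof (subst sum.reindex)
    show "inj_on (\<lambda>l. take l u) {..?L}"
    proof (rule inj_onI)
      fix l l' assume "l \<in> {..?L}" "l' \<in> {..?L}" "take l u = take l' u"
      then have "length (take l u) = length (take l' u)" "l \<le> length u" "l' \<le> length u"
        using lcp_le(1)[of u w] by auto
      then show "l = l'" by simp
    qed
  qed simp
  also have "\<dots> = (\<Sum>l\<le>?L. \<kappa> l)" by (intro sum.cong refl h\<kappa>) simp
  finally show ?thesis .
qed

text \<open>Matches the sum over common prefixes with \<open>sph_telescope\<close>: before the
  separation both letters agree and give diagonal entries, at the separation they differ and give an
  off-diagonal one.\<close>

lemma covariance_expansion:
  assumes u: "u \<in> tvs d E (Suc n)" and w: "w \<in> tvs d E (Suc n)"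
  shows "sph d lam (tdist u w) = (\<Sum>i\<in>index d E n. basisw d lam E i * basisv d lam E i u * basisv d lam E i w)"
proof -
  let ?L = "lcp u w"
  define C where "C l = (\<Sum>r=1..<nk d E (take l u). khelm E (take l u) r (u ! l) * khelm E (take l u) r (w ! l) / (real r * (real r + 1)))" for l
  define K where "K l = innov_var d lam * (brp d lam (length u - l) * brp d lam (length w - l)) * C l" for l
  define B where "B = (\<Sum>k\<in>topidx E. topw d lam E k * topv d lam E k u * topv d lam E k w)"
  have tu: "tvert d u" "tvert d w" using u w by (auto simp: tvs_def)
  have exp: "(\<Sum>i\<in>index d E n. basisw d lam E i * basisv d lam E i u * basisv d lam E i w) = B + (\<Sum>l\<le>?L. K l)"
    unfolding sum_index B_def K_def C_def using sum_innov_product[OF u w] by (simp add: basisv_def basisw_def)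
  show ?thesis
  proof (cases "side E u = side E w")
    case False
    then have E: E by (auto simp: side_def)
    have L: "?L = 0" using False by (cases u; cases w) (auto simp: side_def)
    \<comment> \<open>The only common prefix is the root, and one of the two first letters is 0,
      where \<open>khelm\<close> vanishes.\<close>
    have "C 0 = 0"
      using False E by (auto simp: C_def side_def khelm_def klo_def hd_conv_nth intro!: sum.neutral)
    then have "(\<Sum>l\<le>?L. K l) = 0" by (simp add: L K_def)
    moreover have "tdist u w = Suc (dep E u + dep E w)"
      using False E L by (cases u; cases w) (auto simp: tdist_def side_def dep_def)
    moreover have "sph d lam (Suc (dep E u + dep E w)) = B"
      unfolding edp_across[OF d3 lam] B_def using False E
      by (auto simp: topidx_def topw_def topv_def sgnv_def simp del: lrec.simps)
    ultimately show ?thesis unfolding exp by simp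
  next
    case True
    \<comment> \<open>The number of letters spent on crossing the edge: 1 on the side of
      \<open>[0]\<close>, 0 elsewhere. It converts word positions into depths.\<close>
    define t where "t = length u - dep E u"
    have t: "length u = dep E u + t" "length w = dep E w + t" "t \<le> 1" "t = 1 \<longleftrightarrow> side E u"
      using True by (cases u; cases w; auto simp: t_def dep_def side_def)+
    have tL: "t \<le> ?L" using True t(3,4) by (cases u; cases w) (auto simp: side_def le_Suc_eq)
    define m where "m = ?L - t"
    define c where "c l = (if l = 0 \<and> \<not> E then real d else real d - 1)" for l :: nat
    have nk: "real (nk d E (take l u)) = c (l - t)" if "t \<le> l" "l \<le> ?L" for l
    proof -
      have "take l u = [] \<longleftrightarrow> l = 0" using that lcp_le(1)[of u w] by auto
      moreover have "\<not> E \<Longrightarrow> t = 0" using t(3,4) by (auto simp: side_def le_Suc_eq)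
      ultimately show ?thesis using d3 by (auto simp: nk_def c_def of_nat_diff)
    qed
    have kid: "u ! l \<in> kids d E (take l u)" "w ! l \<in> kids d E (take l u)"
      if "t \<le> l" "l \<le> ?L" "l < length u" "l < length w" for l
    proof -
      have "take l u = take l w" using that take_eq_iff_le_lcp by (metis less_imp_le)
      then show "u ! l \<in> kids d E (take l u)" "w ! l \<in> kids d E (take l u)"
        using nth_kid[OF d3 tu(1) that(3), of E] nth_kid[OF d3 tu(2) that(4), of E] t that(1) by auto
    qed
    have K1: "K (l + t) = innov_var d lam * (1 - 1 / c l) * (brp d lam (dep E u - l) * brp d lam (dep E w - l))" if "l < m" for l
    proof -
      have l: "l + t < ?L" using that by (simp add: m_def)
      then have len: "l + t < length u" "l + t < length w" using lcp_le less_le_trans by blast+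
      have "C (l + t) = 1 - 1 / c l"
        unfolding C_def using khelm_complete[OF kid(1)[of "l + t"] kid(2)[of "l + t"]]
          nth_eq_of_less_lcp[OF l] l len nk[of "l + t"] by (simp del: One_nat_def)
      then show ?thesis by (simp add: K_def t(1,2) del: lrec.simps)
    qed
    have K2: "K ?L = - innov_var d lam / c m * (brp d lam (dep E u - m) * brp d lam (dep E w - m))"
    proof (cases "?L < length u \<and> ?L < length w")
      case len: True
      have "C ?L = - 1 / c m"
        unfolding C_def using khelm_complete[OF kid(1)[of ?L] kid(2)[of ?L]]
          nth_lcp_neq len tL nk[of ?L] by (simp add: m_def del: One_nat_def)
      moreover have "length u - ?L = dep E u - m" "length w - ?L = dep E w - m"
        using t tL by (auto simp: m_def)
      ultimately show ?thesis by (simp add: K_def del: lrec.simps)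
    next
      \<comment> \<open>One vertex is an ancestor of the other or equal to it: no next letters to
        compare, but both sides contain \<open>brp\<close> at 0.\<close>
      case False
      then have "?L = length u \<or> ?L = length w" using lcp_le[of u w] by linarith
      then have "length u - ?L = 0 \<and> dep E u - m = 0 \<or> length w - ?L = 0 \<and> dep E w - m = 0"
        using t by (auto simp: m_def)
      then show ?thesis by (auto simp: K_def)
    qed
    have "(\<Sum>l<?L. K l) = (\<Sum>l<m. K (l + t))"
    proof (cases "t = 0")
      case False
      then have t1: "t = 1" using t(3) by linarith
      then have "?L = Suc m" using tL by (simp add: m_def)
      \<comment> \<open>On the side of \<open>[0]\<close> the root is a common prefix that
        contributes nothing, as the letter 0 is not a child there.\<close>
      moreover have "K 0 = 0"
        using t1 t(4) by (auto simp: K_def C_def side_def khelm_def klo_def hd_conv_nth intro!: sum.neutral)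
      ultimately show ?thesis
        using t1 sum.lessThan_Suc_shift[of K m] by (simp del: sum.lessThan_Suc)
    qed (simp add: m_def)
    then have Ksum: "(\<Sum>l\<le>?L. K l) = (\<Sum>l<m. innov_var d lam * (1 - 1 / c l) * (brp d lam (dep E u - l) * brp d lam (dep E w - l)))
        - innov_var d lam / c m * (brp d lam (dep E u - m) * brp d lam (dep E w - m))"
      using K1 K2 by (simp add: lessThan_Suc_atMost[symmetric] del: lrec.simps)
    define B' where "B' i j = (if E then (1 + lam / d) / 2 * edp d lam 1 i * edp d lam 1 j
     + (1 - lam / d) / 2 * edp d lam (-1) i * edp d lam (-1) j else sph d lam i * sph d lam j)" for i j
    have "B = B' (dep E u) (dep E w)"
      using True unfolding B_def B'_def
      by (auto simp: topidx_def topw_def topv_def sgnv_def simp del: lrec.simps)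
    moreover have "sph d lam (dep E u + dep E w - 2 * m) = B' (dep E u) (dep E w)
      + (\<Sum>l<m. innov_var d lam * (1 - 1 / c l) * (brp d lam (dep E u - l) * brp d lam (dep E w - l)))
        - innov_var d lam / c m * (brp d lam (dep E u - m) * brp d lam (dep E w - m))"
    proof (rule sph_telescope[OF d3 lam])
      show "sph d lam (i + j) = B' i j - innov_var d lam / c 0 * (brp d lam i * brp d lam j)" for i j
        using sph_add[OF d3 lam, of i j] edp_add[OF d3 lam, of i j] by (simp add: B'_def c_def del: lrec.simps)
      show "m \<le> dep E u" "m \<le> dep E w" using lcp_le[of u w] t by (auto simp: m_def)
    qed (simp add: c_def)
    moreover have "tdist u w = dep E u + dep E w - 2 * m"
      using t tL by (simp add: tdist_def m_def)
    ultimately show ?thesis unfolding exp Ksum by simp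
  qed
qed

end

subsection \<open>The two entropies\<close>

lemma tdist_root: "tdist [] v = length v" by (simp add: tdist_def)

lemma tdist_single: "tdist [a] v = (if v \<noteq> [] \<and> hd v = a then length v - 1 else Suc (length v))"
  by (cases v) (auto simp: tdist_def)

lemma tball_edge: "tball d k tedge = tvs d True (Suc k)"
  by (auto simp: tball_def tedge_def troot_def tvs_def dep_def tdist_root tdist_single)

text \<open>\<open>C\<close> has radius 1 itself, so the ball is one level deeper than the one
  around the edge.\<close>

lemma tball_star: "tball d k (tC d) = tvs d False (Suc (Suc k))"
proof (intro set_eqI iffI)
  fix v assume "v \<in> tball d k (tC d)"
  then obtain s where s: "tvert d v" "length s \<le> 1" "tdist s v \<le> k"
    by (auto simp: tball_def tC_def troot_def tdist_root)
  then show "v \<in> tvs d False (Suc (Suc k))"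
    by (cases s) (auto simp: tvs_def dep_def tdist_root tdist_single split: if_splits)
next
  fix v assume v: "v \<in> tvs d False (Suc (Suc k))"
  have "\<exists>s\<in>tC d. tdist s v \<le> k"
  proof (cases v)
    case Nil
    then show ?thesis
      by (intro bexI[of _ "[]"]) (auto simp: tC_def tball_def troot_def tdist_root tvert_def)
  next
    case (Cons a ys)
    then show ?thesis using v
      by (intro bexI[of _ "[a]"]) (auto simp: tC_def tball_def troot_def tdist_root tdist_single tvert_def tvs_def dep_def)
  qed
  then show "v \<in> tball d k (tC d)" using v by (simp add: tball_def tvs_def)
qed

context
  fixes d :: nat and lam :: real and M :: "'a measure" and X :: "nat list \<Rightarrow> 'a \<Rightarrow> real"
  assumes d3: "d \<ge> 3" and lam: "\<bar>lam\<bar> \<le> 2 * sqrt (real d - 1)" and wave: "gaussian_wave d lam M X"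
begin

text \<open>The eigenvalue of a top vector: weight times squared norm.\<close>

abbreviation "topnorm E i n \<equiv> topw d lam E i * (\<Sum>w\<in>tvs d E (Suc n). (topv d lam E i w)\<^sup>2)"

lemma sqrt_power_sq: "(sqrt (real d - 1) ^ j)\<^sup>2 = real (d - 1) ^ j"
  using d3 by (simp add: power2_eq_square power_mult_distrib[symmetric] of_nat_diff)

lemma branch_sum_chebS: "(\<Sum>j<N. real (d - 1) ^ j * (brp d lam (Suc j))\<^sup>2) = chebS d lam N"
proof -
  have "real (d - 1) ^ j * (brp d lam (Suc j))\<^sup>2 = (chebU (Suc j) (xpar d lam))\<^sup>2" for j
    unfolding brp_chebU[OF d3 lam, symmetric] power_mult_distrib sqrt_power_sq by (rule mult.commute)
  then show ?thesis by (simp add: chebS_def[OF d3 lam])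
qed

lemma topw_pos: "0 < topw d lam E i"
  using abs_lam_less[OF d3 lam] d3 by (auto simp: topw_def sgnv_def field_simps)

lemma topv_norm_pos: "0 < (\<Sum>w\<in>tvs d E (Suc n). (topv d lam E i w)\<^sup>2)"
proof (rule sum_pos2[of _ "[]"])
  show "finite (tvs d E (Suc n))" by (rule finite_tvs[OF d3])
qed (auto simp: tvs_def tvert_def dep_def topv_def side_def)

text \<open>Each \<open>u\<close> carries \<open>nk d E u - 1\<close> Helmert vectors with a common
  eigenvalue, which depends only on the number of levels below \<open>u\<close>.\<close>

lemma Dsp_tvs:
  "Dsp d lam (tvs d E (Suc n)) M X = (\<Sum>i\<in>topidx E. ln (2 * pi * exp 1 * topnorm E i n) / 2)
     + (\<Sum>u\<in>tvs d E n. real (nk d E u - 1) * (ln (2 * pi * exp 1 * (innov_var d lam * chebS d lam (n - dep E u))) / 2))"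
proof -
  let ?F = "tvs d E (Suc n)" and ?I = "index d E n"
  have inn: "(\<Sum>w\<in>?F. (innov d lam E (u, r) w)\<^sup>2) = real r * (real r + 1) * chebS d lam (n - dep E u)"
    if "(u, r) \<in> innidx d E n" for u r
    using innov_norm[OF d3 lam that, of "Suc n"] by (simp add: branch_sum_chebS[symmetric] del: lrec.simps)
  have chp: "0 < chebS d lam (n - dep E u)" if "u \<in> tvs d E n" for u
    using that by (intro chebS_pos[OF d3 lam]) (simp add: tvs_def)
  have iE: "i \<in> ?I \<longleftrightarrow> (case i of Inl k \<Rightarrow> k \<in> topidx E | Inr p \<Rightarrow> p \<in> innidx d E n)" for i
    unfolding index_def by (cases i) auto
  have "Dsp d lam ?F M X = (\<Sum>i\<in>?I. ln (2 * pi * exp 1 * (basisw d lam E i * (\<Sum>w\<in>?F. (basisv d lam E i w)\<^sup>2))) / 2)"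
  proof (rule Dsp_orthogonal_expansion[OF wave])
    show "finite ?F" by (rule finite_tvs[OF d3])
    show "tvert d u" if "u \<in> ?F" for u using that by (simp add: tvs_def)
    show "finite ?I" by (rule finite_index[OF d3 lam])
    show "restrict (basisv d lam E i) ?F \<in> Wlam d lam ?F" if "i \<in> ?I" for i
    proof (rule WlamI[OF d3])
      fix u assume "u \<in> tvs d E n"
      then have u: "tvert d u" by (simp add: tvs_def)
      show "loceq d lam E (basisv d lam E i) u"
        using that loceq_topv[OF d3 lam u] loceq_innov[OF d3 lam _ _ u]
        by (auto simp: iE basisv_def innidx_def split: sum.splits)
    qed
    show "(\<Sum>u\<in>?F. basisv d lam E i u * basisv d lam E j u) = 0" if "i \<in> ?I" "j \<in> ?I" "i \<noteq> j" for i j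
    proof (cases i; cases j)
      fix k l assume ij: "i = Inl k" "j = Inl l"
      then have "E" "k = 0 \<and> l = 1 \<or> k = 1 \<and> l = 0" using that by (auto simp: iE topidx_def split: if_splits)
      then show ?thesis using topv_orth[OF d3 lam, of E "Suc n"] ij by (auto simp: basisv_def mult.commute)
    next
      fix k p assume ij: "i = Inl k" "j = Inr p"
      then show ?thesis
        using that topv_orth_innov[OF d3 lam, where u = "fst p" and r = "snd p" and E = E and n = n and N = "Suc n" and i = k] by (auto simp: iE basisv_def mult.commute)
    next
      fix k p assume ij: "i = Inr p" "j = Inl k"
      then show ?thesis
        using that topv_orth_innov[OF d3 lam, where u = "fst p" and r = "snd p" and E = E and n = n and N = "Suc n" and i = k] by (auto simp: iE basisv_def)
    next
      fix p q assume ij: "i = Inr p" "j = Inr q"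
      then show ?thesis
        using that innov_orth[OF d3 lam, where u = "fst p" and r = "snd p" and E = E and n = n and v = "fst q" and s = "snd q" and N = "Suc n"] by (auto simp: iE basisv_def)
    qed
    show "0 < (\<Sum>u\<in>?F. (basisv d lam E i u)\<^sup>2)" if "i \<in> ?I" for i
    proof (cases i)
      case (Inl k)
      then show ?thesis using topv_norm_pos by (simp add: basisv_def)
    next
      case (Inr p)
      obtain u r where p: "p = (u, r)" by fastforce
      then have ur: "(u, r) \<in> innidx d E n" using that Inr by (simp add: iE)
      then have "0 < r" "u \<in> tvs d E n" by (auto simp: innidx_def)
      then show ?thesis using inn[OF ur] chp Inr p by (simp add: basisv_def)
    qed
    show "\<exists>c. \<forall>u\<in>?F. f u = (\<Sum>i\<in>?I. c i * basisv d lam E i u)" if "f \<in> Wlam d lam ?F" for f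
      by (rule basis_spans[OF d3 lam that])
    show "0 < basisw d lam E i" if "i \<in> ?I" for i
      using that topw_pos innov_var_pos[OF d3 lam] by (auto simp: iE basisw_def innidx_def split: sum.splits)
    show "wcov d lam u v = (\<Sum>i\<in>?I. basisw d lam E i * basisv d lam E i u * basisv d lam E i v)"
      if "u \<in> ?F" "v \<in> ?F" for u v
      unfolding wcov_def wavecov_eq_sph[OF d3 lam] by (rule covariance_expansion[OF d3 lam that])
  qed
  also have "\<dots> = (\<Sum>i\<in>topidx E. ln (2 * pi * exp 1 * topnorm E i n) / 2)
    + (\<Sum>p\<in>innidx d E n. ln (2 * pi * exp 1 * (basisw d lam E (Inr p) * (\<Sum>w\<in>?F. (innov d lam E p w)\<^sup>2))) / 2)"
    unfolding sum_index[OF d3 lam] by (simp add: basisv_def basisw_def)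
  also have "(\<Sum>p\<in>innidx d E n. ln (2 * pi * exp 1 * (basisw d lam E (Inr p) * (\<Sum>w\<in>?F. (innov d lam E p w)\<^sup>2))) / 2)
    = (\<Sum>p\<in>innidx d E n. ln (2 * pi * exp 1 * (innov_var d lam * chebS d lam (n - dep E (fst p)))) / 2)"
  proof (intro sum.cong refl)
    fix p assume p: "p \<in> innidx d E n"
    obtain u r where ur: "p = (u, r)" by fastforce
    then have "0 < r" using p by (auto simp: innidx_def)
    then have "basisw d lam E (Inr p) * (\<Sum>w\<in>?F. (innov d lam E p w)\<^sup>2) = innov_var d lam * chebS d lam (n - dep E (fst p))"
      using inn[of u r] p ur by (simp add: basisw_def)
    then show "ln (2 * pi * exp 1 * (basisw d lam E (Inr p) * (\<Sum>w\<in>?F. (innov d lam E p w)\<^sup>2))) / 2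
      = ln (2 * pi * exp 1 * (innov_var d lam * chebS d lam (n - dep E (fst p)))) / 2" by simp
  qed
  also have "\<dots> = (\<Sum>u\<in>tvs d E n. \<Sum>r=1..<nk d E u. ln (2 * pi * exp 1 * (innov_var d lam * chebS d lam (n - dep E u))) / 2)"
    unfolding innidx_def by (subst sum.Sigma) (auto simp: finite_tvs[OF d3] case_prod_beta')
  finally show ?thesis by simp
qed

abbreviation "lvl k \<equiv> innov_var d lam * chebS d lam k"

text \<open>The contributions of the branchings cancel exactly, because the branching vertices of
  the ball around the star at depth \<open>j + 1\<close> number \<open>d / 2\<close> times those around the edge at
  depth \<open>j\<close>.\<close>
lemma Dsp_difference:
  "Dsp d lam (tball d k (tC d)) M X - real d / 2 * Dsp d lam (tball d k tedge) M X =
     ln (topnorm False 0 (Suc k) / lvl (Suc k)) / 2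
     - real d / 4 * (ln (topnorm True 0 k / lvl (Suc k)) + ln (topnorm True 1 k / lvl (Suc k)))"
proof -
  define \<phi> where "\<phi> k = ln (2 * pi * exp 1 * lvl k) / 2" for k
  let ?S = "\<Sum>j<k. real (d - 1) ^ j * (real (d - 2) * \<phi> (k - j))"
  have "Dsp d lam (tball d k (tC d)) M X = ln (2 * pi * exp 1 * topnorm False 0 (Suc k)) / 2
    + (\<Sum>u\<in>tvs d False (Suc k). real (nk d False u - 1) * \<phi> (Suc k - dep False u))"
    unfolding tball_star Dsp_tvs by (simp add: topidx_def \<phi>_def)
  \<comment> \<open>The root has \<open>d - 1\<close> Helmert vectors and every other vertex
    \<open>d - 2\<close>; the case distinction makes the summand a function of the depth.\<close>
  also have "(\<Sum>u\<in>tvs d False (Suc k). real (nk d False u - 1) * \<phi> (Suc k - dep False u))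
    = (\<Sum>u\<in>tvs d False (Suc k). case dep False u of 0 \<Rightarrow> real (d - 1) * \<phi> (Suc k) | Suc j \<Rightarrow> real (d - 2) * \<phi> (k - j))"
    by (intro sum.cong refl) (auto simp: dep_def nk_def numeral_2_eq_2 split: nat.splits)
  also have "\<dots> = real (d - 1) * \<phi> (Suc k) + real d * ?S"
    unfolding sum_dep_root[OF d3] by simp
  finally have 1: "Dsp d lam (tball d k (tC d)) M X =
    ln (2 * pi * exp 1 * topnorm False 0 (Suc k)) / 2 + (real (d - 1) * \<phi> (Suc k) + real d * ?S)" .
  have "Dsp d lam (tball d k tedge) M X = ln (2 * pi * exp 1 * topnorm True 0 k) / 2 + ln (2 * pi * exp 1 * topnorm True 1 k) / 2
    + (\<Sum>u\<in>tvs d True k. real (d - 2) * \<phi> (k - dep True u))"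
    unfolding tball_edge Dsp_tvs by (simp add: topidx_def \<phi>_def nk_def numeral_2_eq_2)
  also have "(\<Sum>u\<in>tvs d True k. real (d - 2) * \<phi> (k - dep True u)) = 2 * ?S"
    by (rule sum_dep_edge[OF d3])
  finally have 2: "Dsp d lam (tball d k tedge) M X =
    ln (2 * pi * exp 1 * topnorm True 0 k) / 2 + ln (2 * pi * exp 1 * topnorm True 1 k) / 2 + 2 * ?S" .
  have sp: "0 < lvl (Suc k)" using innov_var_pos[OF d3 lam] chebS_pos[OF d3 lam, of "Suc k"] by simp
  have ln_split: "ln (2 * pi * exp 1 * N) = ln (2 * pi * exp 1 * L) + ln (N / L)" if "0 < N" "0 < L" for N L :: real
    using that by (simp add: ln_mult_pos ln_div)
  \<comment> \<open>All top eigenvalues are measured against that of the root branchings. The star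
    has \<open>d - 1\<close> of these and one top vector, the edge \<open>d / 2\<close> times two
    top vectors, so the reference terms \<open>\<phi> (Suc k)\<close> cancel.\<close>
  have split: "ln (2 * pi * exp 1 * N) = 2 * \<phi> (Suc k) + ln (N / lvl (Suc k))" if "0 < N" for N
    unfolding ln_split[OF that sp] \<phi>_def by simp
  have tp: "0 < topnorm E i n" for E i n using topw_pos topv_norm_pos by simp
  have "real (d - 1) = real d - 1" using d3 by (simp add: of_nat_diff)
  then show ?thesis
    unfolding 1 2 split[OF tp] by (simp add: algebra_simps add_divide_distrib)
qed

section \<open>Limits of the radial eigenvalues\<close>

lemma topnorm_edge:
  "topnorm True i n = (1 + sgnv i * (lam / real d)) *
     (\<Sum>j<Suc n. (1 * chebU (Suc j) (xpar d lam) + (- sgnv i / sqrt (real d - 1)) * chebU j (xpar d lam))\<^sup>2)"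
proof -
  have e: "real (d - 1) ^ j * (edp d lam (sgnv i) j)\<^sup>2 =
     (1 * chebU (Suc j) (xpar d lam) + (- sgnv i / sqrt (real d - 1)) * chebU j (xpar d lam))\<^sup>2" for j
  proof -
    have "1 * chebU (Suc j) (xpar d lam) + (- sgnv i / sqrt (real d - 1)) * chebU j (xpar d lam)
      = edp d lam (sgnv i) j * sqrt (real d - 1) ^ j"
      unfolding edp_chebU[OF d3 lam] by simp
    then show ?thesis by (simp only: power_mult_distrib sqrt_power_sq mult.commute)
  qed
  show ?thesis
    unfolding topv_sq_sum[OF d3 lam] if_True sum_dep_edge[OF d3, of "\<lambda>j. (edp d lam (sgnv i) j)\<^sup>2"] e topw_def
    by (simp del: sum.lessThan_Suc chebU.simps)
qed

text \<open>The 1 is the root itself; the Chebyshev form starts at depth 1, where the factor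
  \<open>d (d - 1) ^ j\<close> counts the vertices at depth \<open>j + 1\<close>.\<close>

lemma topnorm_root:
  "topnorm False 0 n = 1 + (\<Sum>j<n. (2 * xpar d lam * (real d - 1) * chebU (Suc j) (xpar d lam) + (- real d) * chebU j (xpar d lam))\<^sup>2)
     / (real d * (real d - 1))"
proof -
  have "real d * (real (d - 1) ^ j * (sph d lam (Suc j))\<^sup>2) =
     (2 * xpar d lam * (real d - 1) * chebU (Suc j) (xpar d lam) + (- real d) * chebU j (xpar d lam))\<^sup>2 / (real d * (real d - 1))" for j
  proof -
    have "2 * xpar d lam * (real d - 1) * chebU (Suc j) (xpar d lam) + (- real d) * chebU j (xpar d lam)
      = real d * sph d lam (Suc j) * sqrt (real d - 1) ^ Suc j"
      unfolding sph_chebU[OF d3 lam] by simp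
    moreover have "(sqrt (real d - 1) ^ Suc j)\<^sup>2 = real (d - 1) ^ j * (real d - 1)"
      using sqrt_power_sq[of "Suc j"] d3 by (simp add: of_nat_diff)
    ultimately have "(2 * xpar d lam * (real d - 1) * chebU (Suc j) (xpar d lam) + (- real d) * chebU j (xpar d lam))\<^sup>2
      = (real d * (real (d - 1) ^ j * (sph d lam (Suc j))\<^sup>2)) * (real d * (real d - 1))"
      by (simp only: power_mult_distrib) (simp only: power2_eq_square mult_ac)
    then show ?thesis using d3 by simp
  qed
  then show ?thesis
    unfolding topv_sq_sum[OF d3 lam] if_False sum_dep_root[OF d3, of "\<lambda>j. (sph d lam j)\<^sup>2"]
    by (simp add: topw_def sum_distrib_left sum_divide_distrib del: lrec.simps(2,3) chebU.simps)
qed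

lemma quadratic_sum_asymp_Suc:
  "(\<lambda>n. (\<Sum>j<Suc n. (\<alpha> * chebU (Suc j) (xpar d lam) + \<beta> * chebU j (xpar d lam))\<^sup>2) / chebS d lam (Suc n))
     \<longlonglongrightarrow> \<alpha>\<^sup>2 + \<beta>\<^sup>2 + 2 * \<alpha> * \<beta> * xpar d lam"
  by (rule LIMSEQ_Suc[OF quadratic_sum_asymp[OF d3 lam]])

lemma topnorm_root_asymp: "(\<lambda>k. topnorm False 0 (Suc k) / lvl (Suc k)) \<longlonglongrightarrow> 1"
proof -
  let ?x = "xpar d lam" and ?c = "innov_var d lam"
  let ?T = "\<lambda>k. (\<Sum>j<Suc k. (2 * ?x * (real d - 1) * chebU (Suc j) ?x + (- real d) * chebU j ?x)\<^sup>2)"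
  let ?A = "(2 * ?x * (real d - 1))\<^sup>2 + (- real d)\<^sup>2 + 2 * (2 * ?x * (real d - 1)) * (- real d) * ?x"
  have "filterlim (\<lambda>n. chebS d lam (Suc n)) at_top sequentially"
    using filterlim_compose[OF chebS_at_top[OF d3 lam] filterlim_Suc] .
  then have "(\<lambda>k. 1 / ?c / chebS d lam (Suc k)) \<longlonglongrightarrow> 0"
    by (intro tendsto_divide_0[OF tendsto_const] filterlim_at_top_imp_at_infinity)
  then have L: "(\<lambda>k. 1 / ?c / chebS d lam (Suc k) + 1 / (real d * (real d - 1) * ?c) * (?T k / chebS d lam (Suc k)))
     \<longlonglongrightarrow> 0 + 1 / (real d * (real d - 1) * ?c) * ?A"
    by (intro tendsto_add tendsto_mult tendsto_const quadratic_sum_asymp_Suc)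
  have e: "topnorm False 0 (Suc k) / lvl (Suc k) =
      1 / ?c / chebS d lam (Suc k) + 1 / (real d * (real d - 1) * ?c) * (?T k / chebS d lam (Suc k))" for k
    unfolding topnorm_root by (simp add: add_divide_distrib mult_ac del: sum.lessThan_Suc chebU.simps)
  \<comment> \<open>The limiting quadratic form collapses to \<open>d^2 - lam^2\<close>, the
    numerator of \<open>innov_var\<close>.\<close>
  have v: "0 + 1 / (real d * (real d - 1) * ?c) * ?A = 1"
  proof -
    have l: "lam\<^sup>2 = 4 * ?x\<^sup>2 * (real d - 1)"
      using d3 by (subst xpar(2)[OF d3 lam, symmetric]) (simp add: power_mult_distrib)
    have "?A = (real d)\<^sup>2 - 4 * ?x\<^sup>2 * (real d - 1)"
      by (simp add: power2_eq_square algebra_simps)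
    then have "?A = (real d)\<^sup>2 - lam\<^sup>2" unfolding l .
    moreover have "real d * (real d - 1) * ?c = (real d)\<^sup>2 - lam\<^sup>2"
      using d3 by (simp add: innov_var_def)
    moreover have "(real d)\<^sup>2 - lam\<^sup>2 \<noteq> 0" using lam_sq_less[OF d3 lam] by simp
    ultimately show ?thesis by simp
  qed
  show ?thesis using L unfolding v e .
qed

lemma topnorm_edge_asymp: "(\<lambda>k. topnorm True i k / lvl (Suc k)) \<longlonglongrightarrow> 1"
proof -
  let ?x = "xpar d lam" and ?c = "innov_var d lam" and ?s = "sgnv i" and ?q = "sqrt (real d - 1)"
  let ?T = "\<lambda>k. (\<Sum>j<Suc k. (1 * chebU (Suc j) ?x + (- ?s / ?q) * chebU j ?x)\<^sup>2)"
  let ?A = "1\<^sup>2 + (- ?s / ?q)\<^sup>2 + 2 * 1 * (- ?s / ?q) * ?x"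
  have L: "(\<lambda>k. (1 + ?s * (lam / real d)) / ?c * (?T k / chebS d lam (Suc k))) \<longlonglongrightarrow> (1 + ?s * (lam / real d)) / ?c * ?A"
    by (intro tendsto_mult tendsto_const quadratic_sum_asymp_Suc)
  have e: "topnorm True i k / lvl (Suc k) = (1 + ?s * (lam / real d)) / ?c * (?T k / chebS d lam (Suc k))" for k
    unfolding topnorm_edge by simp
  \<comment> \<open>The form equals \<open>(d - s lam) / (d - 1)\<close> with \<open>s\<close> the
    sign; the factor \<open>1 + s lam / d\<close> completes it to \<open>innov_var\<close> for both
    signs.\<close>
  have v: "(1 + ?s * (lam / real d)) / ?c * ?A = 1"
  proof -
    have q: "?q * ?q = real d - 1" "0 < ?q" using d3 by auto
    have s2: "?s * ?s = 1" by (simp add: sgnv_def)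
    have gen: "(1\<^sup>2 + (- s / q)\<^sup>2 + 2 * 1 * (- s / q) * x) * (q * q) = q * q + s * s - s * (2 * x * q)"
      if "0 < q" for s q x :: real
      using that by (simp add: power2_eq_square field_simps)
    have "?A * (real d - 1) = real d - 1 + ?s * ?s - ?s * (2 * ?x * ?q)"
      using gen[OF q(2), of ?s ?x] unfolding q(1) .
    also have "\<dots> = real d - ?s * lam"
      unfolding xpar(2)[OF d3 lam] s2 by simp
    finally have A: "?A = (real d - ?s * lam) / (real d - 1)" using d3 by (simp add: field_simps)
    have "(1 + ?s * (lam / real d)) * ?A = ((real d + ?s * lam) / real d) * ((real d - ?s * lam) / (real d - 1))"
      unfolding A using d3 by (simp add: field_simps)
    also have "\<dots> = ((real d)\<^sup>2 - (?s * ?s) * lam\<^sup>2) / (real d * (real d - 1))"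
      by (simp add: power2_eq_square algebra_simps)
    also have "\<dots> = ?c" by (simp add: s2 innov_var_def)
    finally show ?thesis using innov_var_pos[OF d3 lam] by simp
  qed
  show ?thesis using L unfolding v e .
qed

lemma Dsp_difference_tendsto:
  "(\<lambda>k. Dsp d lam (tball d k (tC d)) M X - real d / 2 * Dsp d lam (tball d k tedge) M X) \<longlonglongrightarrow> 0"
proof -
  have "(\<lambda>k. ln (topnorm False 0 (Suc k) / lvl (Suc k)) / 2
     - real d / 4 * (ln (topnorm True 0 k / lvl (Suc k)) + ln (topnorm True 1 k / lvl (Suc k))))
     \<longlonglongrightarrow> ln 1 / 2 - real d / 4 * (ln 1 + ln 1)"
    by (intro tendsto_intros topnorm_root_asymp topnorm_edge_asymp) simp_all
  then show ?thesis unfolding Dsp_difference by simp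
qed

end

theorem mainTheorem14:
  fixes d :: nat and lam :: real and M :: "'a measure" and X :: "nat list \<Rightarrow> 'a \<Rightarrow> real"
  assumes "d \<ge> 3"
    and "\<bar>lam\<bar> \<le> 2 * sqrt (real d - 1)"
    and "gaussian_wave d lam M X"
  shows "(\<lambda>k. Dsp d lam (tball d k (tC d)) M X - real d / 2 * Dsp d lam (tball d k tedge) M X)
           \<longlonglongrightarrow> 0"
  using assms by (rule Dsp_difference_tendsto)

end
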